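(* Let $K$ be a field, $q,Q\in K^{\times}$, and $n,d\ge 1$ integers. The $K$-space $K[M^{\mathrm B}_{Q,q}(n)]_d^{*}$ admits a $K$-algebra structure, and is isomorphic, as a $K$-algebra, to the type B $q$-Schur algebra $S^{\mathrm B}_{Q,q}(n,d)$.
   Context: Write $[A,B]_x=AB-xBA$ and $[A,B]=[A,B]_1$. Put $I(n)=[-r,r]\cap\mathbb Z$ if $n=2r+1$ and $I(n)=([-r,r]\cap\mathbb Z)\setminus\{0\}$ if $n=2r$. Quantum matrices: $K[M^{\mathrm A}_q(n)]$ is the associative $K$-algebra with generators $x_{ij}$ $(i,j\in I(n))$ and relations $[x_{ki},x_{kj}]_{q^{-1}}=0$ for $i>j$; $[x_{ki},x_{li}]_{q^{-1}}=0$ for $k>l$; $[x_{ki},x_{lj}]=0$ for $k>l,\ i<j$; $[x_{ki},x_{lj}]=(q^{-1}-q)x_{li}x_{kj}$ for $k>l,\ i>j$. It is a graded bialgebra with comultiplication $\Delta(x_{ij})=\sum_{k\in I(n)}x_{ik}\otimes x_{kj}$; $K[M^{\mathrm A}_q(n)]_d$ is its degree $d$ component, a finite-dimensional coalgebra, whose dual is an algebra under the convolution product. Hecke algebra: $\mathcal H^{\mathrm B}_{Q,q}(d)$ is the $K$-algebra generated by $T_0,\dots,T_{d-1}$ with relations $T_iT_{i+1}T_i=T_{i+1}T_iT_{i+1}$ $(1\le i\le d-2)$, $(T_0T_1)^2=(T_1T_0)^2$, $T_iT_j=T_jT_i$ $(|i-j|>1)$, $T_0^2=(Q^{-1}-Q)T_0+1$,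 $T_i^2=(q^{-1}-q)T_i+1$ $(1\le i\le d-1)$. Tensor space: $V$ has basis $\{v_i\mid i\in I(n)\}$; for $\mu\in I(n)^d$ put $v_\mu=v_{\mu_1}\otimes\cdots\otimes v_{\mu_d}$. For $1\le t\le d-1$ let $\mu\cdot s_t$ be $\mu$ with entries $\mu_t,\mu_{t+1}$ exchanged, and $\mu\cdot s_0=(-\mu_1,\mu_2,\dots,\mu_d)$. $V^{\otimes d}$ is a right $\mathcal H^{\mathrm B}_{Q,q}(d)$-module via: $v_\mu T_t=v_{\mu\cdot s_t}$ if $\mu_t<\mu_{t+1}$, $q^{-1}v_{\mu\cdot s_t}$ if $\mu_t=\mu_{t+1}$, $v_{\mu\cdot s_t}+(q^{-1}-q)v_\mu$ if $\mu_t>\mu_{t+1}$; and $v_\mu T_0=v_{\mu\cdot s_0}$ if $\mu_1>0$, $Q^{-1}v_{\mu\cdot s_0}$ if $\mu_1=0$, $v_{\mu\cdot s_0}+(Q^{-1}-Q)v_\mu$ if $\mu_1<0$. Set $S^{\mathrm B}_{Q,q}(n,d)=\operatorname{End}_{\mathcal H^{\mathrm B}_{Q,q}(d)}(V^{\otimes d})$. Type B coordinate coalgebra: for a $K$-subspace $J\subseteq K[M^{\mathrm A}_q(n)]_d$ let $\tau_J^{\otimes d}:V^{\otimes d}\to V^{\otimes d}\otimes K[M^{\mathrm A}_q(n)]_d/J$ be $v_\mu\mapsto\sum_{\nu\in I(n)^d}v_\nu\otimes(x_{\nu_1\mu_1}\cdots x_{\nu_d\mu_d}+J)$. Let $J^{\mathrm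 B}_{Q,q}(n,d)$ be the intersection of all subspaces $J$ such that $(\tau_J^{\otimes d}(v_\mu))T_0=\tau_J^{\otimes d}(v_\mu T_0)$ for all $\mu\in I(n)^d$, where $T_0$ acts on $V^{\otimes d}\otimes K[M^{\mathrm A}_q(n)]_d/J$ through the factor $V^{\otimes d}$. Put $K[M^{\mathrm B}_{Q,q}(n)]_d=K[M^{\mathrm A}_q(n)]_d/J^{\mathrm B}_{Q,q}(n,d)$; its dual $K[M^{\mathrm B}_{Q,q}(n)]_d^*$ is identified with the space of $\phi\in K[M^{\mathrm A}_q(n)]_d^*$ vanishing on $J^{\mathrm B}_{Q,q}(n,d)$. *)

theory Defs
  imports
    "HOL-Algebra.QuotRing"
    "HOL-Algebra.Module"
    "HOL-Library.Poly_Mapping"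
    "HOL-Library.Product_Plus"
begin

section \<open>Associative algebras over a field\<close>

text \<open>The ground field is a type of class \<^class>\<open>field\<close>; this is the corresponding ring record.\<close>

definition ground_field :: "'k::field ring"
  where "ground_field = \<lparr>carrier = UNIV, mult = (*), one = 1, zero = 0, add = (+)\<rparr>"

text \<open>The library's \<^locale>\<open>algebra\<close> is commutative; here multiplication need not commute.\<close>

locale assoc_algebra = module + ring M +
  assumes smult_mult_left:
      "\<lbrakk>a \<in> carrier R; x \<in> carrier M; y \<in> carrier M\<rbrakk> \<Longrightarrow>
        (a \<odot>\<^bsub>M\<^esub> x) \<otimes>\<^bsub>M\<^esub> y = a \<odot>\<^bsub>M\<^esub> (x \<otimes>\<^bsub>M\<^esub> y)"
    and smult_mult_right:
      "\<lbrakk>a \<in> carrier R; x \<in> carrier M; y \<in> carrier M\<rbrakk> \<Longrightarrow>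
        x \<otimes>\<^bsub>M\<^esub> (a \<odot>\<^bsub>M\<^esub> y) = a \<odot>\<^bsub>M\<^esub> (x \<otimes>\<^bsub>M\<^esub> y)"

definition algebra_iso ::
    "('k::field, 'a) module \<Rightarrow> ('k, 'b) module \<Rightarrow> ('a \<Rightarrow> 'b) set"
  where "algebra_iso A B =
    {h \<in> ring_iso A B. \<forall>c. \<forall>x\<in>carrier A. h (c \<odot>\<^bsub>A\<^esub> x) = c \<odot>\<^bsub>B\<^esub> h x}"

text \<open>The quotient by an ideal, or, ignoring the multiplicative fields, by a subspace.\<close>

definition quot_alg :: "('k, 'a) module \<Rightarrow> 'a set \<Rightarrow> ('k, 'a set) module"
  where "quot_alg A J =
    ring.extend (A Quot J) (module.fields (\<lambda>c X. \<Union>x\<in>X. J +>\<^bsub>A\<^esub> (c \<odot>\<^bsub>A\<^esub> x)))"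

definition dual_space :: "('k::field, 'a) module \<Rightarrow> ('a \<Rightarrow> 'k) set"
  where "dual_space M =
    {\<phi> \<in> extensional (carrier M).
       (\<forall>x\<in>carrier M. \<forall>y\<in>carrier M. \<phi> (x \<oplus>\<^bsub>M\<^esub> y) = \<phi> x + \<phi> y) \<and>
       (\<forall>c. \<forall>x\<in>carrier M. \<phi> (c \<odot>\<^bsub>M\<^esub> x) = c * \<phi> x)}"

definition End_space :: "('k, 'a) module \<Rightarrow> ('a \<Rightarrow> 'a) set"
  where "End_space M =
    {f \<in> carrier M \<rightarrow>\<^sub>E carrier M.
       (\<forall>x\<in>carrier M. \<forall>y\<in>carrier M. f (x \<oplus>\<^bsub>M\<^esub> y) = f x \<oplus>\<^bsub>M\<^esub> f y) \<and>
       (\<forall>c. \<forall>x\<in>carrier M. f (c \<odot>\<^bsub>M\<^esub> x) = c \<odot>\<^bsub>M\<^esub> f x)}"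


section \<open>Free associative algebras\<close>

text \<open>The free monoid, written additively because \<^typ>\<open>'a \<Rightarrow>\<^sub>0 'b\<close> multiplies by adding
  exponents. Thus \<open>'g fmon \<Rightarrow>\<^sub>0 'k\<close> is the algebra of noncommutative polynomials, and
  \<open>('g fmon \<times> 'h fmon) \<Rightarrow>\<^sub>0 'k\<close> is the tensor product of two such algebras.\<close>

datatype 'g fmon = FMon (letters: "'g list")

instantiation fmon :: (type) monoid_add
begin

definition "0 = FMon []"
definition "u + v = FMon (letters u @ letters v)"

instance
  by standard (simp_all add: zero_fmon_def plus_fmon_def)

end

definition scl :: "'k::field \<Rightarrow> ('m::monoid_add \<Rightarrow>\<^sub>0 'k) \<Rightarrow> ('m \<Rightarrow>\<^sub>0 'k)"
  where "scl c f = Poly_Mapping.single 0 c * f"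

definition lin_ext ::
    "('a \<Rightarrow> ('m::monoid_add \<Rightarrow>\<^sub>0 'k::field)) \<Rightarrow> ('a \<Rightarrow>\<^sub>0 'k) \<Rightarrow> ('m \<Rightarrow>\<^sub>0 'k)"
  where "lin_ext g f = (\<Sum>w\<in>Poly_Mapping.keys f. scl (Poly_Mapping.lookup f w) (g w))"

definition gen :: "'g \<Rightarrow> ('g fmon \<Rightarrow>\<^sub>0 'k::field)"
  where "gen a = Poly_Mapping.single (FMon [a]) 1"

definition free_alg :: "'g set \<Rightarrow> ('k::field, 'g fmon \<Rightarrow>\<^sub>0 'k) module"
  where "free_alg G =
    \<lparr>carrier = {f. \<forall>w\<in>Poly_Mapping.keys f. set (letters w) \<subseteq> G},
     mult = (*), one = 1, zero = 0, add = (+), smult = scl\<rparr>"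

text \<open>The subspace of homogeneous elements of degree \<open>d\<close>; the multiplicative fields of the
  record play no role.\<close>

definition free_part :: "'g set \<Rightarrow> nat \<Rightarrow> ('k::field, 'g fmon \<Rightarrow>\<^sub>0 'k) module"
  where "free_part G d = (free_alg G)
    \<lparr>carrier := {f \<in> carrier (free_alg G). \<forall>w\<in>Poly_Mapping.keys f. length (letters w) = d}\<rparr>"

text \<open>The algebra generated by \<open>G\<close> subject to the relations \<open>f = 0\<close> for \<open>f \<in> S\<close>.\<close>

definition presented_alg ::
    "'g set \<Rightarrow> ('g fmon \<Rightarrow>\<^sub>0 'k::field) set \<Rightarrow> ('k, ('g fmon \<Rightarrow>\<^sub>0 'k) set) module"
  where "presented_alg G S = quot_alg (free_alg G) (genideal (free_alg G) S)"

text \<open>The right action of the free algebra determined by operators for the generators: a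
  monomial acts by its first letter first.\<close>

definition free_act ::
    "('g \<Rightarrow> ('m::monoid_add \<Rightarrow>\<^sub>0 'k::field) \<Rightarrow> ('m \<Rightarrow>\<^sub>0 'k)) \<Rightarrow>
      ('m \<Rightarrow>\<^sub>0 'k) \<Rightarrow> ('g fmon \<Rightarrow>\<^sub>0 'k) \<Rightarrow> ('m \<Rightarrow>\<^sub>0 'k)"
  where "free_act \<rho> v = lin_ext (\<lambda>w. fold \<rho> (letters w) v)"


section \<open>Quantum matrices\<close>

definition idx :: "nat \<Rightarrow> int set"
  where "idx n = (if odd n then {- int (n div 2)..int (n div 2)}
                else {- int (n div 2)..int (n div 2)} - {0})"

definition multi_idx :: "nat \<Rightarrow> nat \<Rightarrow> int list set"
  where "multi_idx n d = {\<mu>. length \<mu> = d \<and> set \<mu> \<subseteq> idx n}"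

definition qbr :: "'k::field \<Rightarrow> ('g fmon \<Rightarrow>\<^sub>0 'k) \<Rightarrow> ('g fmon \<Rightarrow>\<^sub>0 'k) \<Rightarrow> ('g fmon \<Rightarrow>\<^sub>0 'k)"
  where "qbr x a b = a * b - scl x (b * a)"

abbreviation xgen :: "int \<Rightarrow> int \<Rightarrow> ((int \<times> int) fmon \<Rightarrow>\<^sub>0 'k::field)"
  where "xgen i j \<equiv> gen (i, j)"

definition qmat_rels :: "nat \<Rightarrow> 'k::field \<Rightarrow> ((int \<times> int) fmon \<Rightarrow>\<^sub>0 'k) set"
  where "qmat_rels n q =
    {qbr (inverse q) (xgen k i) (xgen k j) | k i j. k \<in> idx n \<and> i \<in> idx n \<and> j \<in> idx n \<and> i > j} \<union>
    {qbr (inverse q) (xgen k i) (xgen l i) | k l i. k \<in> idx n \<and> l \<in> idx n \<and> i \<in> idx n \<and> k > l} \<union>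
    {qbr 1 (xgen k i) (xgen l j) | k l i j.
       k \<in> idx n \<and> l \<in> idx n \<and> i \<in> idx n \<and> j \<in> idx n \<and> k > l \<and> i < j} \<union>
    {qbr 1 (xgen k i) (xgen l j) - scl (inverse q - q) (xgen l i * xgen k j) | k l i j.
       k \<in> idx n \<and> l \<in> idx n \<and> i \<in> idx n \<and> j \<in> idx n \<and> k > l \<and> i > j}"

definition qmat_ideal :: "nat \<Rightarrow> 'k::field \<Rightarrow> ((int \<times> int) fmon \<Rightarrow>\<^sub>0 'k) set"
  where "qmat_ideal n q = genideal (free_alg (idx n \<times> idx n)) (qmat_rels n q)"

definition qmat :: "nat \<Rightarrow> 'k::field \<Rightarrow> ('k, ((int \<times> int) fmon \<Rightarrow>\<^sub>0 'k) set) module"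
  where "qmat n q = presented_alg (idx n \<times> idx n) (qmat_rels n q)"

abbreviation qcls ::
    "nat \<Rightarrow> 'k::field \<Rightarrow> ((int \<times> int) fmon \<Rightarrow>\<^sub>0 'k) \<Rightarrow> ((int \<times> int) fmon \<Rightarrow>\<^sub>0 'k) set"
  where "qcls n q f \<equiv> qmat_ideal n q +>\<^bsub>free_alg (idx n \<times> idx n)\<^esub> f"

definition qmat_part ::
    "nat \<Rightarrow> 'k::field \<Rightarrow> nat \<Rightarrow> ('k, ((int \<times> int) fmon \<Rightarrow>\<^sub>0 'k) set) module"
  where "qmat_part n q d = (qmat n q)
    \<lparr>carrier := qcls n q ` carrier (free_part (idx n \<times> idx n) d)\<rparr>"

text \<open>Comultiplication and counit (\<open>x\<^sub>i\<^sub>j \<mapsto> \<delta>\<^sub>i\<^sub>j\<close>) on the free algebra. The ideal is a biideal, so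
  the structure descends to the quotient; a linear form \<open>\<phi>\<close> on the degree \<open>d\<close> component is
  evaluated on a monomial through its class.\<close>

definition Delta ::
    "nat \<Rightarrow> ((int \<times> int) fmon \<Rightarrow>\<^sub>0 'k::field) \<Rightarrow>
      (((int \<times> int) fmon \<times> (int \<times> int) fmon) \<Rightarrow>\<^sub>0 'k)"
  where "Delta n = lin_ext (\<lambda>w. prod_list (map
    (\<lambda>(i, j). \<Sum>k\<in>idx n. Poly_Mapping.single (FMon [(i, k)], FMon [(k, j)]) 1) (letters w)))"

definition counit :: "((int \<times> int) fmon \<Rightarrow>\<^sub>0 'k::field) \<Rightarrow> 'k"
  where "counit f = (\<Sum>w\<in>Poly_Mapping.keys f. Poly_Mapping.lookup f w *
    prod_list (map (\<lambda>(i, j). if i = j then 1 else 0) (letters w)))"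

definition tensor_eval ::
    "nat \<Rightarrow> 'k::field \<Rightarrow> (((int \<times> int) fmon \<Rightarrow>\<^sub>0 'k) set \<Rightarrow> 'k) \<Rightarrow>
      (((int \<times> int) fmon \<Rightarrow>\<^sub>0 'k) set \<Rightarrow> 'k) \<Rightarrow>
      (((int \<times> int) fmon \<times> (int \<times> int) fmon) \<Rightarrow>\<^sub>0 'k) \<Rightarrow> 'k"
  where "tensor_eval n q \<phi> \<psi> t = (\<Sum>(u, w)\<in>Poly_Mapping.keys t. Poly_Mapping.lookup t (u, w) *
    \<phi> (qcls n q (Poly_Mapping.single u 1)) * \<psi> (qcls n q (Poly_Mapping.single w 1)))"

text \<open>The form on the degree \<open>d\<close> component induced by a form on the free algebra: evaluate on
  any homogeneous representative. The restriction to homogeneous ones matters, since a coset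
  also has representatives with components in other degrees.\<close>

definition descend ::
    "nat \<Rightarrow> 'k::field \<Rightarrow> nat \<Rightarrow> (((int \<times> int) fmon \<Rightarrow>\<^sub>0 'k) \<Rightarrow> 'k) \<Rightarrow>
      ((int \<times> int) fmon \<Rightarrow>\<^sub>0 'k) set \<Rightarrow> 'k"
  where "descend n q d g =
    (\<lambda>c\<in>carrier (qmat_part n q d). the_elem (g ` (c \<inter> carrier (free_part (idx n \<times> idx n) d))))"

definition qmat_dual ::
    "nat \<Rightarrow> 'k::field \<Rightarrow> nat \<Rightarrow> ('k, ((int \<times> int) fmon \<Rightarrow>\<^sub>0 'k) set \<Rightarrow> 'k) module"
  where "qmat_dual n q d =
    \<lparr>carrier = dual_space (qmat_part n q d),
     mult = (\<lambda>\<phi> \<psi>. descend n q d (\<lambda>f. tensor_eval n q \<phi> \<psi> (Delta n f))),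
     one = descend n q d counit,
     zero = (\<lambda>c\<in>carrier (qmat_part n q d). 0),
     add = (\<lambda>\<phi> \<psi>. \<lambda>c\<in>carrier (qmat_part n q d). \<phi> c + \<psi> c),
     smult = (\<lambda>a \<phi>. \<lambda>c\<in>carrier (qmat_part n q d). a * \<phi> c)\<rparr>"


section \<open>The Hecke algebra of type B and tensor space\<close>

definition hecke_rels :: "'k::field \<Rightarrow> 'k \<Rightarrow> nat \<Rightarrow> (nat fmon \<Rightarrow>\<^sub>0 'k) set"
  where "hecke_rels Q q d =
    {gen i * gen (i+1) * gen i - gen (i+1) * gen i * gen (i+1) | i. 1 \<le> i \<and> i + 2 \<le> d} \<union>
    (if 2 \<le> d then {(gen 0 * gen 1)^2 - (gen 1 * gen 0)^2} else {}) \<union>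
    {gen i * gen j - gen j * gen i | i j. i < d \<and> j < d \<and> \<bar>int i - int j\<bar> > 1} \<union>
    {(gen 0)^2 - (scl (inverse Q - Q) (gen 0) + 1)} \<union>
    {(gen i)^2 - (scl (inverse q - q) (gen i) + 1) | i. 1 \<le> i \<and> i < d}"

definition hecke :: "'k::field \<Rightarrow> 'k \<Rightarrow> nat \<Rightarrow> ('k, (nat fmon \<Rightarrow>\<^sub>0 'k) set) module"
  where "hecke Q q d = presented_alg {..<d} (hecke_rels Q q d)"

text \<open>\<open>V\<^sup>\<otimes>\<^sup>d\<close> is the degree \<open>d\<close> part of the tensor algebra of \<open>V\<close>, that is, of the free algebra on
  \<open>idx n\<close>, with basis the monomials \<open>v\<^sub>\<mu>\<close>.\<close>

definition tspace :: "nat \<Rightarrow> nat \<Rightarrow> ('k::field, int fmon \<Rightarrow>\<^sub>0 'k) module"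
  where "tspace n d = free_part (idx n) d"

definition bvec :: "int list \<Rightarrow> (int fmon \<Rightarrow>\<^sub>0 'k::field)"
  where "bvec \<mu> = Poly_Mapping.single (FMon \<mu>) 1"

text \<open>For \<open>t \<ge> 1\<close>, the entry \<open>\<mu>\<^sub>t\<close> is \<open>\<mu> ! (t - 1)\<close>.\<close>

definition s_act :: "int list \<Rightarrow> nat \<Rightarrow> int list"
  where "s_act \<mu> t = (if t = 0 then \<mu>[0 := - (\<mu> ! 0)]
                      else \<mu>[t - 1 := \<mu> ! t, t := \<mu> ! (t - 1)])"

definition T_basis :: "'k::field \<Rightarrow> 'k \<Rightarrow> nat \<Rightarrow> int list \<Rightarrow> (int fmon \<Rightarrow>\<^sub>0 'k)"
  where "T_basis Q q t \<mu> =
    (if t = 0 then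
       (if \<mu> ! 0 > 0 then bvec (s_act \<mu> 0)
        else if \<mu> ! 0 = 0 then scl (inverse Q) (bvec (s_act \<mu> 0))
        else bvec (s_act \<mu> 0) + scl (inverse Q - Q) (bvec \<mu>))
     else
       (if \<mu> ! (t - 1) < \<mu> ! t then bvec (s_act \<mu> t)
        else if \<mu> ! (t - 1) = \<mu> ! t then scl (inverse q) (bvec (s_act \<mu> t))
        else bvec (s_act \<mu> t) + scl (inverse q - q) (bvec \<mu>)))"

definition T_op :: "'k::field \<Rightarrow> 'k \<Rightarrow> nat \<Rightarrow> (int fmon \<Rightarrow>\<^sub>0 'k) \<Rightarrow> (int fmon \<Rightarrow>\<^sub>0 'k)"
  where "T_op Q q t = lin_ext (\<lambda>w. T_basis Q q t (letters w))"

text \<open>The operators satisfy the defining relations on \<open>V\<^sup>\<otimes>\<^sup>d\<close>, so all representatives of an element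
  of the Hecke algebra act alike.\<close>

definition hecke_act ::
    "'k::field \<Rightarrow> 'k \<Rightarrow> (int fmon \<Rightarrow>\<^sub>0 'k) \<Rightarrow> (nat fmon \<Rightarrow>\<^sub>0 'k) set \<Rightarrow> (int fmon \<Rightarrow>\<^sub>0 'k)"
  where "hecke_act Q q v h = the_elem (free_act (T_op Q q) v ` h)"

definition schurB ::
    "nat \<Rightarrow> nat \<Rightarrow> 'k::field \<Rightarrow> 'k \<Rightarrow> ('k, (int fmon \<Rightarrow>\<^sub>0 'k) \<Rightarrow> (int fmon \<Rightarrow>\<^sub>0 'k)) module"
  where "schurB n d Q q =
    \<lparr>carrier = {f \<in> End_space (tspace n d). \<forall>v\<in>carrier (tspace n d). \<forall>h\<in>carrier (hecke Q q d).
       f (hecke_act Q q v h) = hecke_act Q q (f v) h},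
     mult = (\<lambda>f g. compose (carrier (tspace n d)) f g),
     one = (\<lambda>v\<in>carrier (tspace n d). v),
     zero = (\<lambda>v\<in>carrier (tspace n d). 0),
     add = (\<lambda>f g. \<lambda>v\<in>carrier (tspace n d). f v + g v),
     smult = (\<lambda>c f. \<lambda>v\<in>carrier (tspace n d). scl c (f v))\<rparr>"


section \<open>The type B coordinate coalgebra\<close>

definition xmon :: "int list \<Rightarrow> int list \<Rightarrow> ((int \<times> int) fmon \<Rightarrow>\<^sub>0 'k::field)"
  where "xmon \<nu> \<mu> = prod_list (map2 xgen \<nu> \<mu>)"

text \<open>As the \<open>v\<^sub>\<nu>\<close> form a basis, an element \<open>\<Sum>\<^sub>\<nu> v\<^sub>\<nu> \<otimes> z\<^sub>\<nu>\<close> of \<open>V\<^sup>\<otimes>\<^sup>d \<otimes> W\<close> is encoded as the function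
  \<open>\<nu> \<mapsto> z\<^sub>\<nu>\<close> on \<open>multi_idx n d\<close>.\<close>

definition tau ::
    "nat \<Rightarrow> 'k::field \<Rightarrow> nat \<Rightarrow> ((int \<times> int) fmon \<Rightarrow>\<^sub>0 'k) set set \<Rightarrow>
      (int fmon \<Rightarrow>\<^sub>0 'k) \<Rightarrow> (int list \<Rightarrow> ((int \<times> int) fmon \<Rightarrow>\<^sub>0 'k) set set)"
  where "tau n q d J v =
    (\<lambda>\<nu>\<in>multi_idx n d. \<Oplus>\<^bsub>quot_alg (qmat_part n q d) J\<^esub>\<mu>\<in>multi_idx n d.
       Poly_Mapping.lookup v (FMon \<mu>) \<odot>\<^bsub>quot_alg (qmat_part n q d) J\<^esub>
         (J +>\<^bsub>qmat_part n q d\<^esub> qcls n q (xmon \<nu> \<mu>)))"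

definition T0_tensor ::
    "nat \<Rightarrow> nat \<Rightarrow> 'k::field \<Rightarrow> 'k \<Rightarrow> ('k, 'w) module \<Rightarrow> (int list \<Rightarrow> 'w) \<Rightarrow> (int list \<Rightarrow> 'w)"
  where "T0_tensor n d Q q W z =
    (\<lambda>\<kappa>\<in>multi_idx n d. \<Oplus>\<^bsub>W\<^esub>\<nu>\<in>multi_idx n d.
       Poly_Mapping.lookup (T_op Q q 0 (bvec \<nu>)) (FMon \<kappa>) \<odot>\<^bsub>W\<^esub> z \<nu>)"

definition JB ::
    "nat \<Rightarrow> nat \<Rightarrow> 'k::field \<Rightarrow> 'k \<Rightarrow> ((int \<times> int) fmon \<Rightarrow>\<^sub>0 'k) set set"
  where "JB n d Q q = \<Inter> {J. submodule J ground_field (qmat_part n q d) \<and>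
    (\<forall>\<mu>\<in>multi_idx n d. T0_tensor n d Q q (quot_alg (qmat_part n q d) J) (tau n q d J (bvec \<mu>)) =
                tau n q d J (T_op Q q 0 (bvec \<mu>)))}"

text \<open>The dual of \<open>qmat_part n q d\<close> modulo \<open>JB n d Q q\<close>, as the space of forms vanishing on
  \<open>JB n d Q q\<close>, with the operations inherited from \<^const>\<open>qmat_dual\<close>.\<close>

definition coordB_dual ::
    "nat \<Rightarrow> nat \<Rightarrow> 'k::field \<Rightarrow> 'k \<Rightarrow> ('k, ((int \<times> int) fmon \<Rightarrow>\<^sub>0 'k) set \<Rightarrow> 'k) module"
  where "coordB_dual n d Q q = (qmat_dual n q d)
    \<lparr>carrier := {\<phi> \<in> carrier (qmat_dual n q d). \<forall>c\<in>JB n d Q q. \<phi> c = 0}\<rparr>"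

end

theory Submission
  imports Defs
begin

text \<open>
  Write \<open>x\<^sub>\<nu>\<^sub>\<mu>\<close> for the monomial with row indices \<open>\<nu>\<close> and column indices \<open>\<mu>\<close>, where \<open>\<nu>\<close> and \<open>\<mu>\<close> are
  multi-indices of length \<open>d\<close>. A linear form \<open>\<phi>\<close> on the degree \<open>d\<close> component of the quantum matrix
  algebra is determined by the matrix \<open>\<phi>(x\<^sub>\<nu>\<^sub>\<mu>)\<close>, and an endomorphism \<open>f\<close> of \<open>V\<^sup>\<otimes>\<^sup>d\<close> by its matrix in
  the basis \<open>v\<^sub>\<mu>\<close>. The isomorphism sends \<open>\<phi>\<close> to the endomorphism with the same matrix. What has to be
  seen is that the same matrices arise on both sides and that they are multiplied in the same way.

  In the basis \<open>v\<^sub>\<mu>\<close> the operator \<open>T\<^sub>t\<close> is a symmetric matrix: the permutation \<open>\<mu> \<mapsto> \<mu> \<cdot> s\<^sub>t\<close> away from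
  its fixed points, plus a diagonal matrix. So the condition that a matrix \<open>F\<close> commutes with \<open>T\<^sub>t\<close>
  (\<open>intertwines\<close>) only relates a few entries of \<open>F\<close>, and for the matrix of a form \<open>\<phi>\<close> it says that
  \<open>\<phi>\<close> vanishes on the corresponding combinations of monomials (\<open>tau_defect\<close>). For \<open>t \<ge> 1\<close> these
  combinations are \<open>u r v\<close> with monomials \<open>u\<close>, \<open>v\<close> and with \<open>r\<close> an entry of the matrix equation
  \<open>T X\<^sub>1 X\<^sub>2 = X\<^sub>1 X\<^sub>2 T\<close> in degree two. Those entries span the same space as the defining relations of
  quantum matrices (\<open>rtt_in_ideal\<close>, \<open>qmat_rels_rtt\<close>). Hence the matrices of forms are exactly the
  matrices commuting with \<open>T\<^sub>1, \<dots>, T\<^sub>d\<^sub>-\<^sub>1\<close> (\<open>form_matrix_intertwines\<close>, \<open>ideal_vanishing\<close>). For \<open>t = 0\<close>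
  the combinations span \<open>J\<^sup>B\<close>, so the forms vanishing on \<open>J\<^sup>B\<close> are those whose matrix commutes
  with \<open>T\<^sub>0\<close> as well (\<open>vanishes_on_JB_iff\<close>). Since the comultiplication sends \<open>x\<^sub>\<nu>\<^sub>\<mu>\<close> to
  \<open>\<Sum>\<^sub>\<kappa> x\<^sub>\<nu>\<^sub>\<kappa> \<otimes> x\<^sub>\<kappa>\<^sub>\<mu>\<close>, convolution is matrix multiplication (\<open>tensor_eval_Delta\<close>).

  On the other side, an endomorphism commuting with \<open>T\<^sub>0, \<dots>, T\<^sub>d\<^sub>-\<^sub>1\<close> commutes with the whole Hecke
  algebra (\<open>schurB_carrier\<close>). An element of the Hecke algebra is a coset, and its action is the common
  value of all representatives; that there is such a value means that the operators satisfy the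
  quadratic and braid relations on \<open>V\<^sup>\<otimes>\<^sup>d\<close> (\<open>T_op_quadratic\<close>, \<open>T_op_commute\<close>, \<open>T_op_braid\<close>,
  \<open>T_op_braid_B\<close>).
\<close>

section \<open>Linear forms and linear extensions\<close>

text \<open>The linear form with prescribed values on monomials. Coefficients of \<^const>\<open>lin_ext\<close>, the counit and
  \<^const>\<open>tensor_eval\<close> are all of this shape, so that their linearity is proved once.\<close>

definition lin_form :: "('a \<Rightarrow> 'k) \<Rightarrow> ('a \<Rightarrow>\<^sub>0 'k::field) \<Rightarrow> 'k"
  where "lin_form h f = (\<Sum>w\<in>Poly_Mapping.keys f. Poly_Mapping.lookup f w * h w)"

lemma lin_form_superset:
  assumes "finite A" "Poly_Mapping.keys f \<subseteq> A"
  shows "lin_form h f = (\<Sum>w\<in>A. Poly_Mapping.lookup f w * h w)"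
  unfolding lin_form_def using assms
  by (intro sum.mono_neutral_left) (auto simp: in_keys_iff)

lemma lin_form_zero [simp]: "lin_form h 0 = 0"
  by (simp add: lin_form_def)

lemma lin_form_add: "lin_form h (f + g) = lin_form h f + lin_form h g"
  unfolding lin_form_def
  by (rule setsum_keys_plus_distrib) (simp_all add: distrib_right)

lemma lin_form_single [simp]: "lin_form h (Poly_Mapping.single w c) = c * h w"
  by (simp add: lin_form_def)

lemma lin_form_cong: "(\<And>w. w \<in> Poly_Mapping.keys f \<Longrightarrow> h w = h' w) \<Longrightarrow> lin_form h f = lin_form h' f"
  by (simp add: lin_form_def)

lemma lin_form_sum: "lin_form h (\<Sum>a\<in>A. f a) = (\<Sum>a\<in>A. lin_form h (f a))"
  by (induction A rule: infinite_finite_induct) (simp_all add: lin_form_add)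

lemma keys_subset_add:
  "Poly_Mapping.keys f \<subseteq> S \<Longrightarrow> Poly_Mapping.keys g \<subseteq> S \<Longrightarrow> Poly_Mapping.keys (f + g) \<subseteq> S"
  using keys_add[of f g] by blast

lemma sum_monomials:
  "(\<Sum>w\<in>Poly_Mapping.keys f. Poly_Mapping.single w (Poly_Mapping.lookup f w)) =
    (f :: 'a \<Rightarrow>\<^sub>0 'k::field)"
  by (rule poly_mapping_eqI)
    (simp add: lookup_sum lookup_single when_def in_keys_iff)

lemma monomial_induct [consumes 1, case_names zero monomial add]:
  assumes "Poly_Mapping.keys f \<subseteq> S"
    and "P 0" and "\<And>w c. w \<in> S \<Longrightarrow> P (Poly_Mapping.single w c)"
    and "\<And>f g. Poly_Mapping.keys f \<subseteq> S \<Longrightarrow> Poly_Mapping.keys g \<subseteq> S \<Longrightarrow> P f \<Longrightarrow> P g \<Longrightarrow> P (f + g)"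
  shows "P (f :: 'a \<Rightarrow>\<^sub>0 'k::field)"
proof -
  have "Poly_Mapping.keys (\<Sum>w\<in>A. Poly_Mapping.single w (Poly_Mapping.lookup f w)) \<subseteq> S \<and>
      P (\<Sum>w\<in>A. Poly_Mapping.single w (Poly_Mapping.lookup f w))"
    if "finite A" "A \<subseteq> S" for A
    using that
  proof (induction A rule: finite_induct)
    case (insert w A)
    have "Poly_Mapping.keys (Poly_Mapping.single w (Poly_Mapping.lookup f w)) \<subseteq> S"
      using insert by auto
    moreover have "Poly_Mapping.keys (Poly_Mapping.single w (Poly_Mapping.lookup f w) +
        (\<Sum>w\<in>A. Poly_Mapping.single w (Poly_Mapping.lookup f w))) \<subseteq> S"
      using insert calculation by (intro keys_subset_add) auto
    ultimately show ?case
      using insert assms(3,4) by auto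
  qed (use assms in auto)
  from this[of "Poly_Mapping.keys f"] show ?thesis
    using assms(1) by (simp add: sum_monomials)
qed

lemma scl_single [simp]:
  "scl c (Poly_Mapping.single w x) = Poly_Mapping.single w (c * x)"
  by (simp add: scl_def mult_single)

lemma scl_add: "scl c (f + g) = scl c f + scl c g"
  by (simp add: scl_def distrib_left)

lemma scl_zero [simp]: "scl c 0 = 0"
  by (simp add: scl_def)

lemma lookup_scl [simp]: "Poly_Mapping.lookup (scl c f) w = c * Poly_Mapping.lookup f w"
proof -
  show ?thesis
    by (induction f rule: monomial_induct[OF subset_UNIV])
      (simp_all add: scl_add lookup_add distrib_left lookup_single when_def)
qed

lemma keys_scl: "Poly_Mapping.keys (scl c f) \<subseteq> Poly_Mapping.keys f"
  by (auto simp: in_keys_iff)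

lemma lin_form_scl: "lin_form h (scl c f) = c * lin_form h f"
proof -
  have "lin_form h (scl c f) = (\<Sum>w\<in>Poly_Mapping.keys f. Poly_Mapping.lookup (scl c f) w * h w)"
    by (rule lin_form_superset) (simp_all add: keys_scl)
  then show ?thesis by (simp add: lin_form_def sum_distrib_left mult.assoc)
qed

lemma lin_form_diff: "lin_form h (f - g) = lin_form h f - lin_form h g"
proof -
  have "lin_form h (f - g) + lin_form h g = lin_form h f" by (simp flip: lin_form_add)
  then show ?thesis by (simp add: eq_diff_eq)
qed

lemma scl_one [simp]: "scl 1 f = f"
  by (simp add: scl_def)

lemma scl_0_left [simp]: "scl 0 f = 0"
  by (simp add: scl_def)

lemma scl_scl: "scl a (scl b f) = scl (a * b) f"
  by (rule poly_mapping_eqI) (simp add: mult.assoc)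

lemma scl_add_left: "scl (a + b) f = scl a f + scl b f"
  by (rule poly_mapping_eqI) (simp add: lookup_add distrib_right)

text \<open>Constants are central: the exponent \<open>0\<close> is neutral on both sides of the free monoid.\<close>

lemma scl_mult_right: "f * scl c g = scl c (f * g)"
proof -
  have "f * Poly_Mapping.single 0 c = Poly_Mapping.single 0 c * f"
    by (induction f rule: monomial_induct[OF subset_UNIV])
      (simp_all add: mult_single distrib_left distrib_right mult.commute)
  then show ?thesis by (metis scl_def mult.assoc)
qed

lemma scl_minus: "scl (- 1) f = - f"
  by (rule poly_mapping_eqI) simp

lemma lookup_lin_ext:
  "Poly_Mapping.lookup (lin_ext g f) x = lin_form (\<lambda>w. Poly_Mapping.lookup (g w) x) f"
  by (simp add: lin_ext_def lin_form_def lookup_sum)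

lemma lin_form_lin_ext: "lin_form h (lin_ext g f) = lin_form (\<lambda>w. lin_form h (g w)) f"
  by (simp add: lin_ext_def lin_form_sum lin_form_scl) (simp add: lin_form_def)

lemma lin_ext_add: "lin_ext g (f + f') = lin_ext g f + lin_ext g f'"
  by (rule poly_mapping_eqI) (simp add: lookup_lin_ext lookup_add lin_form_add)

lemma lin_ext_scl: "lin_ext g (scl c f) = scl c (lin_ext g f)"
  by (rule poly_mapping_eqI) (simp add: lookup_lin_ext lin_form_scl)

lemma lin_ext_single [simp]: "lin_ext g (Poly_Mapping.single w c) = scl c (g w)"
  by (rule poly_mapping_eqI) (simp add: lookup_lin_ext)

lemma lin_ext_zero [simp]: "lin_ext g 0 = 0"
  by (simp add: lin_ext_def)

lemma lin_ext_diff: "lin_ext g (f - f') = lin_ext g f - lin_ext g f'"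
  by (rule poly_mapping_eqI) (simp add: lookup_lin_ext lookup_minus lin_form_diff)

section \<open>Free algebras and their graded pieces\<close>

definition words :: "'g set \<Rightarrow> nat \<Rightarrow> 'g fmon set"
  where "words G d = {w. set (letters w) \<subseteq> G \<and> length (letters w) = d}"

lemma carrier_free_alg: "carrier (free_alg G) = {f. Poly_Mapping.keys f \<subseteq> {w. set (letters w) \<subseteq> G}}"
  by (auto simp: free_alg_def)

lemma carrier_free_part: "carrier (free_part G d) = {f. Poly_Mapping.keys f \<subseteq> words G d}"
  by (auto simp: free_part_def free_alg_def words_def)

lemma free_alg_sel [simp]:
  "mult (free_alg G) = (*)" "one (free_alg G) = 1" "zero (free_alg G) = 0"
  "add (free_alg G) = (+)" "smult (free_alg G) = scl"
  by (simp_all add: free_alg_def)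

lemma free_part_sel [simp]:
  "zero (free_part G d) = 0" "add (free_part G d) = (+)" "smult (free_part G d) = scl"
  by (simp_all add: free_part_def)

lemma keys_subset_uminus:
  "Poly_Mapping.keys (f :: 'a \<Rightarrow>\<^sub>0 'k::field) \<subseteq> S \<Longrightarrow> Poly_Mapping.keys (- f) \<subseteq> S"
  by (auto simp: in_keys_iff subset_iff)

lemma keys_subset_diff:
  "Poly_Mapping.keys (f :: 'a \<Rightarrow>\<^sub>0 'k::field) \<subseteq> S \<Longrightarrow> Poly_Mapping.keys g \<subseteq> S \<Longrightarrow>
    Poly_Mapping.keys (f - g) \<subseteq> S"
  by (simp only: diff_conv_add_uminus) (intro keys_subset_add keys_subset_uminus)

lemma keys_subset_scl: "Poly_Mapping.keys f \<subseteq> S \<Longrightarrow> Poly_Mapping.keys (scl c f) \<subseteq> S"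
  using keys_scl by blast

lemma keys_subset_sum:
  "(\<And>a. a \<in> A \<Longrightarrow> Poly_Mapping.keys (f a) \<subseteq> S) \<Longrightarrow> Poly_Mapping.keys (\<Sum>a\<in>A. f a) \<subseteq> S"
  by (induction A rule: infinite_finite_induct) (simp_all add: keys_subset_add)

lemma letters_plus [simp]: "letters (u + v) = letters u @ letters v"
  by (simp add: plus_fmon_def)

lemma letters_zero [simp]: "letters 0 = []"
  by (simp add: zero_fmon_def)

lemma FMon_plus: "FMon u + FMon v = FMon (u @ v)"
  by (simp add: plus_fmon_def)

lemma ring_ground_field: "cring (ground_field :: 'k::field ring)"
proof (rule cringI)
  show "abelian_group (ground_field :: 'k ring)"
    by (rule abelian_groupI)
      (auto simp: ground_field_def algebra_simps intro: exI[of _ "- x" for x])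
  show "comm_monoid (ground_field :: 'k ring)"
    by (rule comm_monoidI) (auto simp: ground_field_def)
qed (auto simp: ground_field_def algebra_simps)

lemma ground_field_sel [simp]:
  "carrier ground_field = UNIV" "mult ground_field = (*)" "one ground_field = 1"
  "zero ground_field = 0" "add ground_field = (+)"
  by (simp_all add: ground_field_def)

lemma free_alg_mult_closed:
  "f \<in> carrier (free_alg G) \<Longrightarrow> g \<in> carrier (free_alg G) \<Longrightarrow> f * g \<in> carrier (free_alg G)"
  using keys_mult[of f g] by (fastforce simp: carrier_free_alg)

lemma free_alg_abelian_group: "abelian_group (free_alg G :: ('k::field, 'g fmon \<Rightarrow>\<^sub>0 'k) module)"
proof (rule abelian_groupI)
  fix x :: "'g fmon \<Rightarrow>\<^sub>0 'k" assume "x \<in> carrier (free_alg G)"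
  then show "\<exists>y\<in>carrier (free_alg G). y \<oplus>\<^bsub>free_alg G\<^esub> x = \<zero>\<^bsub>free_alg G\<^esub>"
    by (intro bexI[of _ "- x"]) (auto simp: carrier_free_alg intro!: keys_subset_uminus)
qed (simp_all add: carrier_free_alg add.commute add.assoc keys_subset_add)

lemma free_alg_ring: "ring (free_alg G :: ('k::field, 'g fmon \<Rightarrow>\<^sub>0 'k) module)"
proof (rule ringI)
  show "monoid (free_alg G :: ('k::field, 'g fmon \<Rightarrow>\<^sub>0 'k) module)"
    by (rule monoidI) (simp_all add: free_alg_mult_closed mult.assoc, simp add: carrier_free_alg)
qed (simp_all add: free_alg_abelian_group algebra_simps)

lemma free_alg_module: "module ground_field (free_alg G :: ('k::field, 'g fmon \<Rightarrow>\<^sub>0 'k) module)"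
  by (rule moduleI)
    (auto simp: ring_ground_field free_alg_abelian_group scl_scl scl_add scl_add_left carrier_free_alg
      intro!: keys_subset_scl)

lemma free_alg_a_inv [simp]:
  assumes "f \<in> carrier (free_alg G)"
  shows "\<ominus>\<^bsub>free_alg G\<^esub> f = - (f :: 'g fmon \<Rightarrow>\<^sub>0 'k::field)"
proof -
  interpret ring "free_alg G :: ('k::field, 'g fmon \<Rightarrow>\<^sub>0 'k) module" by (rule free_alg_ring)
  show ?thesis using assms
    by (intro minus_equality) (auto simp: carrier_free_alg intro!: keys_subset_uminus)
qed

section \<open>Quotients by subspaces\<close>

lemma submodule_abelian_subgroup:
  assumes "module R M" "submodule J R M" shows "abelian_subgroup J M"
proof -
  interpret module R M by fact
  show ?thesis
    using assms by (intro abelian_subgroupI3)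
      (simp_all add: additive_subgroup_def submodule_def M.abelian_group_axioms)
qed

lemma quot_alg_sel [simp]:
  "carrier (quot_alg M J) = (\<lambda>x. J +>\<^bsub>M\<^esub> x) ` carrier M"
  "zero (quot_alg M J) = J" "add (quot_alg M J) = set_add M"
  by (auto simp: quot_alg_def FactRing_def A_RCOSETS_def' ring.defs module.defs)

text \<open>The union in \<^const>\<open>quot_alg\<close> runs over all representatives. They give the same coset, because a
  submodule is closed under scalars, and there is at least one.\<close>

lemma quot_smult:
  assumes "module R M" "submodule J R M" "c \<in> carrier R" "x \<in> carrier M"
  shows "c \<odot>\<^bsub>quot_alg M J\<^esub> (J +>\<^bsub>M\<^esub> x) = J +>\<^bsub>M\<^esub> (c \<odot>\<^bsub>M\<^esub> x)"
proof -
  interpret module R M by fact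
  interpret J: abelian_subgroup J M using assms by (intro submodule_abelian_subgroup)
  interpret S: submodule J R M by fact
  have "J +>\<^bsub>M\<^esub> (c \<odot>\<^bsub>M\<^esub> y) = J +>\<^bsub>M\<^esub> (c \<odot>\<^bsub>M\<^esub> x)" if y: "y \<in> J +>\<^bsub>M\<^esub> x" for y
  proof -
    obtain j where j: "j \<in> J" "y = j \<oplus>\<^bsub>M\<^esub> x" using y by (auto simp: a_r_coset_def')
    then have "c \<odot>\<^bsub>M\<^esub> y = c \<odot>\<^bsub>M\<^esub> j \<oplus>\<^bsub>M\<^esub> c \<odot>\<^bsub>M\<^esub> x"
      using assms J.a_Hcarr by (simp add: smult_r_distr)
    then have "c \<odot>\<^bsub>M\<^esub> y \<in> J +>\<^bsub>M\<^esub> (c \<odot>\<^bsub>M\<^esub> x)"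
      using j assms S.smult_closed by (auto simp: a_r_coset_def')
    then show ?thesis
      using a_repr_independence[of "c \<odot>\<^bsub>M\<^esub> y" J "c \<odot>\<^bsub>M\<^esub> x"] assms J.a_subgroup by auto
  qed
  then have "(\<Union>y\<in>J +>\<^bsub>M\<^esub> x. J +>\<^bsub>M\<^esub> (c \<odot>\<^bsub>M\<^esub> y)) = (\<Union>y\<in>J +>\<^bsub>M\<^esub> x. J +>\<^bsub>M\<^esub> (c \<odot>\<^bsub>M\<^esub> x))"
    by (rule SUP_cong[OF refl])
  moreover have "J +>\<^bsub>M\<^esub> x \<noteq> {}" using assms J.a_rcos_self by blast
  ultimately have "(\<Union>y\<in>J +>\<^bsub>M\<^esub> x. J +>\<^bsub>M\<^esub> (c \<odot>\<^bsub>M\<^esub> y)) = J +>\<^bsub>M\<^esub> (c \<odot>\<^bsub>M\<^esub> x)"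
    by (simp only: UN_constant if_False)
  then show ?thesis by (simp add: quot_alg_def ring.defs module.defs)
qed

lemma quot_add:
  assumes "module R M" "submodule J R M" "x \<in> carrier M" "y \<in> carrier M"
  shows "(J +>\<^bsub>M\<^esub> x) <+>\<^bsub>M\<^esub> (J +>\<^bsub>M\<^esub> y) = J +>\<^bsub>M\<^esub> (x \<oplus>\<^bsub>M\<^esub> y)"
  using abelian_subgroup.a_rcos_sum[OF submodule_abelian_subgroup[OF assms(1,2)]] assms by simp

lemma quot_zero:
  assumes "module R M" "submodule J R M"
  shows "J +>\<^bsub>M\<^esub> \<zero>\<^bsub>M\<^esub> = J"
proof -
  interpret module R M by fact
  interpret J: abelian_subgroup J M using assms by (intro submodule_abelian_subgroup)
  show ?thesis by (simp add: J.a_subset)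
qed

lemma quot_eq:
  assumes "module R M" "submodule J R M" "x \<in> carrier M" "y \<in> carrier M"
  shows "J +>\<^bsub>M\<^esub> x = J +>\<^bsub>M\<^esub> y \<longleftrightarrow> x \<ominus>\<^bsub>M\<^esub> y \<in> J"
proof -
  interpret module R M by fact
  interpret J: abelian_subgroup J M using assms by (intro submodule_abelian_subgroup)
  have "J +>\<^bsub>M\<^esub> x = J +>\<^bsub>M\<^esub> y \<longleftrightarrow> J +>\<^bsub>M\<^esub> (x \<oplus>\<^bsub>M\<^esub> (\<ominus>\<^bsub>M\<^esub> y)) = J"
    using a_coset_add_inv1[of J x y] a_coset_add_inv2[of J x y] assms J.a_subset by blast
  also have "\<dots> \<longleftrightarrow> x \<oplus>\<^bsub>M\<^esub> (\<ominus>\<^bsub>M\<^esub> y) \<in> J"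
    using M.a_coset_join1[of J "x \<oplus>\<^bsub>M\<^esub> (\<ominus>\<^bsub>M\<^esub> y)"] M.a_coset_join2[of "x \<oplus>\<^bsub>M\<^esub> (\<ominus>\<^bsub>M\<^esub> y)" J]
      assms J.a_subgroup by blast
  finally show ?thesis by (simp add: M.minus_eq)
qed

lemma quot_module:
  assumes "module R M" "submodule J R M"
  shows "module R (quot_alg M J)"
proof -
  interpret module R M by fact
  note q = quot_add[OF assms] quot_smult[OF assms] quot_zero[OF assms]
  show ?thesis
  proof (rule moduleI)
    show "abelian_group (quot_alg M J)"
    proof (rule abelian_groupI)
      show "\<exists>y\<in>carrier (quot_alg M J). y \<oplus>\<^bsub>quot_alg M J\<^esub> x = \<zero>\<^bsub>quot_alg M J\<^esub>"
        if x: "x \<in> carrier (quot_alg M J)" for x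
      proof -
        obtain y where y: "y \<in> carrier M" "x = J +>\<^bsub>M\<^esub> y" using x by auto
        then have "(J +>\<^bsub>M\<^esub> (\<ominus>\<^bsub>M\<^esub> y)) <+>\<^bsub>M\<^esub> x = J" by (simp add: q M.l_neg)
        then show ?thesis using y by auto
      qed
      show "\<zero>\<^bsub>quot_alg M J\<^esub> \<in> carrier (quot_alg M J)"
        using q(3) by (metis M.zero_closed imageI quot_alg_sel(1,2))
      show "\<zero>\<^bsub>quot_alg M J\<^esub> \<oplus>\<^bsub>quot_alg M J\<^esub> x = x" if "x \<in> carrier (quot_alg M J)" for x
        using that q(1)[of "\<zero>\<^bsub>M\<^esub>"] q(3) by auto
    qed (auto simp: q M.a_ac)
  qed (auto simp: q is_cring smult_l_distr smult_r_distr smult_assoc1 R.cring_axioms)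
qed

text \<open>A sum of cosets is the coset of the sum of representatives. This turns the sums in \<^const>\<open>tau\<close>
  and \<^const>\<open>T0_tensor\<close> into ordinary sums in the free algebra.\<close>

lemma finsum_linear_image:
  fixes W :: "('k::field, 'w) module" and k :: "('m::monoid_add \<Rightarrow>\<^sub>0 'k) \<Rightarrow> 'w"
  assumes W: "module ground_field W"
    and S: "0 \<in> S" "\<And>f g. f \<in> S \<Longrightarrow> g \<in> S \<Longrightarrow> f + g \<in> S" "\<And>c f. f \<in> S \<Longrightarrow> scl c f \<in> S"
    and k: "\<And>f. f \<in> S \<Longrightarrow> k f \<in> carrier W" "k 0 = \<zero>\<^bsub>W\<^esub>"
      "\<And>f g. f \<in> S \<Longrightarrow> g \<in> S \<Longrightarrow> k (f + g) = k f \<oplus>\<^bsub>W\<^esub> k g"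
      "\<And>c f. f \<in> S \<Longrightarrow> k (scl c f) = c \<odot>\<^bsub>W\<^esub> k f"
    and A: "finite A" "\<And>a. a \<in> A \<Longrightarrow> h a \<in> S"
  shows "(\<Oplus>\<^bsub>W\<^esub>a\<in>A. c a \<odot>\<^bsub>W\<^esub> k (h a)) = k (\<Sum>a\<in>A. scl (c a) (h a))"
proof -
  interpret W: module ground_field W by (rule W)
  have "(\<Sum>a\<in>A. scl (c a) (h a)) \<in> S \<and> (\<Oplus>\<^bsub>W\<^esub>a\<in>A. c a \<odot>\<^bsub>W\<^esub> k (h a)) = k (\<Sum>a\<in>A. scl (c a) (h a))"
    using A
  proof (induction A rule: finite_induct)
    case (insert a A)
    have "(\<lambda>a. c a \<odot>\<^bsub>W\<^esub> k (h a)) \<in> A \<rightarrow> carrier W" "c a \<odot>\<^bsub>W\<^esub> k (h a) \<in> carrier W"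
      using insert.prems k(1) by auto
    then have "(\<Oplus>\<^bsub>W\<^esub>b\<in>insert a A. c b \<odot>\<^bsub>W\<^esub> k (h b)) =
        c a \<odot>\<^bsub>W\<^esub> k (h a) \<oplus>\<^bsub>W\<^esub> (\<Oplus>\<^bsub>W\<^esub>b\<in>A. c b \<odot>\<^bsub>W\<^esub> k (h b))"
      using insert.hyps by (intro W.finsum_insert) auto
    then show ?case using insert S k by simp
  qed (use S k in simp)
  then show ?thesis by simp
qed

section \<open>The operators on tensor space\<close>

text \<open>The diagonal part of \<open>T\<^sub>t\<close>. If \<open>s\<^sub>t\<close> fixes \<open>\<mu>\<close>, the whole of \<open>v\<^sub>\<mu> T\<^sub>t\<close> counts as diagonal; this is the
  coefficient \<open>q\<^sup>-\<^sup>1\<close> or \<open>Q\<^sup>-\<^sup>1\<close>.\<close>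

definition T_diag :: "'k::field \<Rightarrow> 'k \<Rightarrow> nat \<Rightarrow> int list \<Rightarrow> 'k"
  where "T_diag Q q t \<mu> =
    (if t = 0 then (if \<mu> ! 0 > 0 then 0 else if \<mu> ! 0 = 0 then inverse Q else inverse Q - Q)
     else (if \<mu> ! (t - 1) < \<mu> ! t then 0 else if \<mu> ! (t - 1) = \<mu> ! t then inverse q else inverse q - q))"

lemma finite_idx: "finite (idx n)"
  by (simp add: idx_def)

lemma uminus_idx [simp]: "- i \<in> idx n \<longleftrightarrow> i \<in> idx n"
  by (auto simp: idx_def)

lemma finite_multi_idx [simp]: "finite (multi_idx n d)"
  using finite_lists_length_eq[OF finite_idx, of n d]
  by (simp add: multi_idx_def conj_commute)

lemma words_idx: "w \<in> words (idx n) d \<longleftrightarrow> letters w \<in> multi_idx n d"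
  by (auto simp: words_def multi_idx_def)

lemma carrier_tspace: "carrier (tspace n d) = {v. Poly_Mapping.keys v \<subseteq> words (idx n) d}"
  by (simp add: tspace_def carrier_free_part)

lemma tspace_sel [simp]:
  "zero (tspace n d) = 0" "add (tspace n d) = (+)" "smult (tspace n d) = scl"
  by (simp_all add: tspace_def)

lemma bvec_in_tspace: "\<mu> \<in> multi_idx n d \<Longrightarrow> bvec \<mu> \<in> carrier (tspace n d)"
  by (simp add: carrier_tspace bvec_def words_idx)

lemma tspace_lookup_zero:
  "v \<in> carrier (tspace n d) \<Longrightarrow> letters w \<notin> multi_idx n d \<Longrightarrow> Poly_Mapping.lookup v w = 0"
  by (metis (no_types, lifting) carrier_tspace in_keys_iff mem_Collect_eq subsetD words_idx)

lemma tspace_eqI: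
  assumes "v \<in> carrier (tspace n d)" "w \<in> carrier (tspace n d)"
    and "\<And>\<kappa>. \<kappa> \<in> multi_idx n d \<Longrightarrow> Poly_Mapping.lookup v (FMon \<kappa>) = Poly_Mapping.lookup w (FMon \<kappa>)"
  shows "v = w"
proof (rule poly_mapping_eqI)
  fix u show "Poly_Mapping.lookup v u = Poly_Mapping.lookup w u"
    using assms(3)[of "letters u"] tspace_lookup_zero[OF assms(1), of u] tspace_lookup_zero[OF assms(2), of u]
    by (cases "letters u \<in> multi_idx n d") simp_all
qed

lemma tspace_add: "v \<in> carrier (tspace n d) \<Longrightarrow> w \<in> carrier (tspace n d) \<Longrightarrow> v + w \<in> carrier (tspace n d)"
  by (simp add: carrier_tspace keys_subset_add)

lemma tspace_scl: "v \<in> carrier (tspace n d) \<Longrightarrow> scl c v \<in> carrier (tspace n d)"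
  by (simp add: carrier_tspace keys_subset_scl)

lemmas tspace_closed = tspace_add tspace_scl

lemma lin_ext_bvec [simp]: "lin_ext g (bvec \<mu>) = g (FMon \<mu>)"
  by (simp add: bvec_def)

lemma s_act_multi_idx:
  assumes "\<mu> \<in> multi_idx n d" "t < d" shows "s_act \<mu> t \<in> multi_idx n d"
proof -
  have "\<mu> ! i \<in> idx n" if "i < d" for i
    using assms that by (auto simp: multi_idx_def)
  moreover have "t - 1 < d" using assms by simp
  ultimately show ?thesis using assms
    by (auto simp: s_act_def multi_idx_def dest!: subsetD[OF set_update_subset_insert])
qed

lemma s_act_s_act:
  assumes "t < length \<mu>" shows "s_act (s_act \<mu> t) t = \<mu>"
  using assms by (intro nth_equalityI) (auto simp: s_act_def nth_list_update)

lemma s_act_eq_self: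
  assumes "t < length \<mu>"
  shows "s_act \<mu> t = \<mu> \<longleftrightarrow> (if t = 0 then \<mu> ! 0 = 0 else \<mu> ! (t - 1) = \<mu> ! t)"
proof (cases "t = 0")
  case True
  then show ?thesis using assms
    by (auto simp: s_act_def list_update_same_conv)
next
  case False
  have "\<mu> ! (t - 1) = \<mu> ! t" if "s_act \<mu> t = \<mu>"
    using arg_cong[OF that, of "\<lambda>l. l ! t"] assms False by (simp add: s_act_def)
  moreover have "s_act \<mu> t = \<mu>" if "\<mu> ! (t - 1) = \<mu> ! t"
    using that False by (simp add: s_act_def) (metis list_update_id)
  ultimately show ?thesis using False by auto
qed

lemma T_basis_eq:
  assumes "t < length \<mu>"
  shows "T_basis Q q t \<mu> =
    (if s_act \<mu> t \<noteq> \<mu> then bvec (s_act \<mu> t) else 0) + scl (T_diag Q q t \<mu>) (bvec \<mu>)"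
proof (cases "s_act \<mu> t = \<mu>")
  case True
  then have "if t = 0 then \<mu> ! 0 = 0 else \<mu> ! (t - 1) = \<mu> ! t" using s_act_eq_self[OF assms] by simp
  then show ?thesis using True by (auto simp: T_basis_def T_diag_def split: if_splits)
next
  case False
  then have "\<not> (if t = 0 then \<mu> ! 0 = 0 else \<mu> ! (t - 1) = \<mu> ! t)" using s_act_eq_self[OF assms] by simp
  then show ?thesis using False by (auto simp: T_basis_def T_diag_def split: if_splits)
qed

lemma T_op_closed:
  assumes "v \<in> carrier (tspace n d)" "t < d"
  shows "T_op Q q t v \<in> carrier (tspace n d)"
proof -
  have "T_basis Q q t \<mu> \<in> carrier (tspace n d)" if "\<mu> \<in> multi_idx n d" for \<mu>
  proof -
    have "length \<mu> = d" using that by (simp add: multi_idx_def)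
    moreover have "(0 :: int fmon \<Rightarrow>\<^sub>0 'a) \<in> carrier (tspace n d)" by (simp add: carrier_tspace)
    ultimately show ?thesis using that assms
      by (simp add: T_basis_eq tspace_closed bvec_in_tspace s_act_multi_idx)
  qed
  moreover have "letters w \<in> multi_idx n d" if "w \<in> Poly_Mapping.keys v" for w
    using that assms by (auto simp: carrier_tspace simp flip: words_idx)
  ultimately have "Poly_Mapping.keys (T_basis Q q t (letters w)) \<subseteq> words (idx n) d"
    if "w \<in> Poly_Mapping.keys v" for w
    using that by (simp add: carrier_tspace)
  then show ?thesis
    unfolding T_op_def lin_ext_def carrier_tspace mem_Collect_eq
    by (intro keys_subset_sum keys_subset_scl)
qed

lemma length_s_act [simp]: "length (s_act \<mu> t) = length \<mu>"
  by (simp add: s_act_def)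

text \<open>The off-diagonal part permutes basis vectors by an involution with coefficients \<open>1\<close>, so the matrix
  of \<open>T\<^sub>t\<close> is symmetric and the action on coefficients looks like the action on basis vectors. Words
  of another length than \<open>\<kappa>\<close> do not contribute.\<close>

lemma lookup_T_op:
  assumes "t < length \<kappa>"
  shows "Poly_Mapping.lookup (T_op Q q t v) (FMon \<kappa>) =
    (if s_act \<kappa> t \<noteq> \<kappa> then Poly_Mapping.lookup v (FMon (s_act \<kappa> t)) else 0) +
      T_diag Q q t \<kappa> * Poly_Mapping.lookup v (FMon \<kappa>)"
proof (induction v rule: monomial_induct[OF subset_UNIV, case_names zero monomial add])
  case (monomial w c)
  obtain \<mu> where w: "w = FMon \<mu>" by (cases w)
  show ?case
  proof (cases "length \<mu> = length \<kappa>")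
    case True
    then have "s_act \<mu> t = \<kappa> \<longleftrightarrow> \<mu> = s_act \<kappa> t"
      using s_act_s_act assms by metis
    then show ?thesis using True assms
      by (auto simp: w T_op_def T_basis_eq lookup_add lookup_single bvec_def when_def)
  next
    case False
    then have "s_act \<mu> t \<noteq> \<kappa>" "\<mu> \<noteq> \<kappa>" "\<mu> \<noteq> s_act \<kappa> t" for t by (metis length_s_act)+
    then show ?thesis
      by (auto simp: w T_op_def T_basis_def lookup_add lookup_single bvec_def when_def)
  qed
qed (simp_all add: T_op_def lin_ext_add lookup_add algebra_simps)

lemma T_op_add: "T_op Q q t (v + w) = T_op Q q t v + T_op Q q t w"
  by (simp add: T_op_def lin_ext_add)

lemma T_op_scl: "T_op Q q t (scl c v) = scl c (T_op Q q t v)"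
  by (simp add: T_op_def lin_ext_scl)

lemma T_op_zero [simp]: "T_op Q q t 0 = 0"
  by (simp add: T_op_def)

section \<open>The Hecke relations on tensor space\<close>

text \<open>On a fixed point of \<open>s\<^sub>t\<close> the operator is multiplication by \<open>x\<^sup>-\<^sup>1\<close>, a root of
  \<open>X\<^sup>2 = (x\<^sup>-\<^sup>1 - x) X + 1\<close>. On a two-element orbit it is a matrix with off-diagonal entries \<open>1\<close> and
  diagonal entries \<open>0\<close> and \<open>x\<^sup>-\<^sup>1 - x\<close>, which has that characteristic polynomial.\<close>

lemma T_op_quadratic:
  assumes "v \<in> carrier (tspace n d)" "t < d" "q \<noteq> 0" "Q \<noteq> 0"
  defines "x \<equiv> if t = 0 then Q else q"
  shows "T_op Q q t (T_op Q q t v) = scl (inverse x - x) (T_op Q q t v) + v"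
proof (rule tspace_eqI)
  fix \<kappa> assume \<kappa>: "\<kappa> \<in> multi_idx n d"
  have len: "length \<kappa> = d" using \<kappa> by (simp add: multi_idx_def)
  have s: "s_act (s_act \<kappa> t) t = \<kappa>" using s_act_s_act len assms by simp
  have x: "x \<noteq> 0" using assms by simp
  have diag: "T_diag Q q t \<kappa> = inverse x" if "s_act \<kappa> t = \<kappa>"
    using that s_act_eq_self[of t \<kappa>] assms len by (auto simp: T_diag_def split: if_splits)
  have diag': "(T_diag Q q t \<kappa> = 0 \<and> T_diag Q q t (s_act \<kappa> t) = inverse x - x) \<or>
      (T_diag Q q t \<kappa> = inverse x - x \<and> T_diag Q q t (s_act \<kappa> t) = 0)" if "s_act \<kappa> t \<noteq> \<kappa>"
  proof -
    have "\<not> (if t = 0 then \<kappa> ! 0 = 0 else \<kappa> ! (t - 1) = \<kappa> ! t)"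
      using that s_act_eq_self[of t \<kappa>] assms len by simp
    then show ?thesis using len assms
      by (auto simp: T_diag_def s_act_def nth_list_update split: if_splits)
  qed
  show "Poly_Mapping.lookup (T_op Q q t (T_op Q q t v)) (FMon \<kappa>) =
      Poly_Mapping.lookup (scl (inverse x - x) (T_op Q q t v) + v) (FMon \<kappa>)"
  proof (cases "s_act \<kappa> t = \<kappa>")
    case True
    then show ?thesis using assms(1,2) x
      by (simp add: lookup_T_op len lookup_add diag[OF True] field_simps)
  next
    case False
    from diag'[OF False] show ?thesis
      using False s
      by (elim disjE conjE)
        (simp_all add: lookup_T_op len lookup_add assms(2) x)
  qed
qed (use assms in \<open>auto intro!: T_op_closed tspace_closed\<close>)

text \<open>The two operators read and move disjoint sets of places.\<close>

lemma T_op_commute: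
  assumes "v \<in> carrier (tspace n d)" "i < d" "j < d" "i + 1 < j"
  shows "T_op Q q i (T_op Q q j v) = T_op Q q j (T_op Q q i v)"
proof (rule tspace_eqI)
  fix \<kappa> assume \<kappa>: "\<kappa> \<in> multi_idx n d"
  have len: "length \<kappa> = d" using \<kappa> by (simp add: multi_idx_def)
  have ss: "s_act (s_act \<kappa> i) j = s_act (s_act \<kappa> j) i"
    using assms len by (intro nth_equalityI) (auto simp: s_act_def nth_list_update)
  have d: "T_diag Q q i (s_act \<kappa> j) = T_diag Q q i \<kappa>" "T_diag Q q j (s_act \<kappa> i) = T_diag Q q j \<kappa>"
    using assms len by (auto simp: s_act_def T_diag_def nth_list_update)
  have e: "s_act (s_act \<kappa> j) i = s_act \<kappa> j \<longleftrightarrow> s_act \<kappa> i = \<kappa>"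
    "s_act (s_act \<kappa> i) j = s_act \<kappa> i \<longleftrightarrow> s_act \<kappa> j = \<kappa>"
    using s_act_s_act ss assms len by (metis length_list_update s_act_def)+
  show "Poly_Mapping.lookup (T_op Q q i (T_op Q q j v)) (FMon \<kappa>) =
      Poly_Mapping.lookup (T_op Q q j (T_op Q q i v)) (FMon \<kappa>)"
    using assms(2,3) e d ss
    by (simp add: lookup_T_op len algebra_simps)
qed (use assms in \<open>auto intro!: T_op_closed\<close>)

text \<open>The diagonal coefficients of \<open>T\<^sub>t\<close>, \<open>t \<ge> 1\<close>, and of \<open>T\<^sub>0\<close> as functions of the letters involved.\<close>

definition swap_coeff :: "'k::field \<Rightarrow> int \<Rightarrow> int \<Rightarrow> 'k"
  where "swap_coeff q a b = (if a < b then 0 else if a = b then inverse q else inverse q - q)"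

definition flip_coeff :: "'k::field \<Rightarrow> int \<Rightarrow> 'k"
  where "flip_coeff Q a = (if a > 0 then 0 else if a = 0 then inverse Q else inverse Q - Q)"

lemma s_act_append:
  assumes "length \<alpha> = t"
  shows "s_act (\<alpha> @ a # b # \<beta>) (Suc t) = \<alpha> @ b # a # \<beta>"
  using assms by (simp add: s_act_def nth_append list_update_append)

lemma T_diag_append:
  assumes "length \<alpha> = t"
  shows "T_diag Q q (Suc t) (\<alpha> @ a # b # \<beta>) = swap_coeff q a b"
  using assms by (simp add: T_diag_def nth_append swap_coeff_def)

text \<open>Both sides involve only three neighbouring letters, and the coefficients depend only on their
  relative order; each order gives a polynomial identity in \<open>q\<close> and \<open>q\<^sup>-\<^sup>1\<close>.\<close>

lemma T_op_braid:
  assumes "v \<in> carrier (tspace n d)" "1 \<le> i" "i + 1 < d" "q \<noteq> 0"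
  shows "T_op Q q i (T_op Q q (i+1) (T_op Q q i v)) = T_op Q q (i+1) (T_op Q q i (T_op Q q (i+1) v))"
proof (rule tspace_eqI)
  fix \<kappa> assume \<kappa>: "\<kappa> \<in> multi_idx n d"
  have len: "length \<kappa> = d" using \<kappa> by (simp add: multi_idx_def)
  define t where "t = i - 1"
  have i: "i = Suc t" using assms by (simp add: t_def)
  define \<alpha> a b c \<beta> where "\<alpha> = take t \<kappa>" "a = \<kappa> ! t" "b = \<kappa> ! Suc t" "c = \<kappa> ! Suc (Suc t)"
    "\<beta> = drop (Suc (Suc (Suc t))) \<kappa>"
  have eq: "\<kappa> = \<alpha> @ a # b # c # \<beta>"
    using assms len unfolding \<alpha>_a_b_c_\<beta>_def i by (simp add: Cons_nth_drop_Suc)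
  have \<alpha>: "length \<alpha> = t" "length (\<alpha> @ [x]) = Suc t" for x using assms len by (auto simp: \<alpha>_a_b_c_\<beta>_def i)
  have op1: "Poly_Mapping.lookup (T_op Q q (Suc t) w) (FMon (\<alpha> @ x # y # z # \<beta>)) =
      (if x \<noteq> y then Poly_Mapping.lookup w (FMon (\<alpha> @ y # x # z # \<beta>)) else 0) +
      swap_coeff q x y * Poly_Mapping.lookup w (FMon (\<alpha> @ x # y # z # \<beta>))" for w x y z
    by (simp add: lookup_T_op s_act_append T_diag_append \<alpha>)
  have op2: "Poly_Mapping.lookup (T_op Q q (Suc (Suc t)) w) (FMon (\<alpha> @ x # y # z # \<beta>)) =
      (if y \<noteq> z then Poly_Mapping.lookup w (FMon (\<alpha> @ x # z # y # \<beta>)) else 0) +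
      swap_coeff q y z * Poly_Mapping.lookup w (FMon (\<alpha> @ x # y # z # \<beta>))" for w x y z
    using s_act_append[OF \<alpha>(2), of x y z \<beta>] T_diag_append[OF \<alpha>(2), of Q q x y z \<beta>]
    by (simp add: lookup_T_op \<alpha>)
  have "a < b \<or> a = b \<or> b < a" "c < b \<or> c = b \<or> b < c" "a < c \<or> a = c \<or> c < a" by linarith+
  then
  show "Poly_Mapping.lookup (T_op Q q i (T_op Q q (i+1) (T_op Q q i v))) (FMon \<kappa>) =
      Poly_Mapping.lookup (T_op Q q (i+1) (T_op Q q i (T_op Q q (i+1) v))) (FMon \<kappa>)"
    unfolding eq i using \<open>q \<noteq> 0\<close>
    by (elim disjE; simp add: op1 op2; simp add: swap_coeff_def field_simps)
qed (use assms in \<open>auto intro!: T_op_closed\<close>)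

text \<open>The rank two relation of type B for coefficient functions \<open>h\<close> of two letters. The signed
  permutations of \<open>(a, b)\<close> form an orbit of eight elements unless a letter is zero or the letters agree
  up to sign. In the generic case the diagonal coefficients are constant on the eight chambers cut out
  by \<open>a = 0\<close>, \<open>b = 0\<close>, \<open>a = b\<close> and \<open>a = -b\<close>; some degenerate cases use the quadratic relations of
  \<open>q\<^sup>-\<^sup>1\<close> and \<open>Q\<^sup>-\<^sup>1\<close>.\<close>

lemma signed_permutation_braid:
  fixes h :: "int \<Rightarrow> int \<Rightarrow> 'k::field"
  assumes "q \<noteq> 0" "Q \<noteq> 0"
  defines "op0 \<equiv> \<lambda>h a b. (if a \<noteq> 0 then h (- a) b else 0) + flip_coeff Q a * h a b"
    and "op1 \<equiv> \<lambda>h a b. (if a \<noteq> b then h b a else 0) + swap_coeff q a b * h a b"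
  shows "op1 (op0 (op1 (op0 h))) a b = op0 (op1 (op0 (op1 h))) a b"
proof -
  define p X P Y where "p = inverse q" "X = inverse q - q" "P = inverse Q" "Y = inverse Q - Q"
  have sq: "p * p = X * p + 1" "P * P = Y * P + 1"
    using assms by (simp_all add: p_X_P_Y_def field_simps)
  have sq': "p * (p * z) = X * (p * z) + z" "P * (P * z) = Y * (P * z) + z" for z
    using sq by (simp_all flip: mult.assoc add: distrib_right)
  have op0: "op0 g x y = g (- x) y + flip_coeff Q x * g x y" if "x \<noteq> 0" for g x y
    using that by (simp add: op0_def)
  have op0_0: "op0 g 0 y = P * g 0 y" for g y
    by (simp add: op0_def flip_coeff_def p_X_P_Y_def)
  have op1: "op1 g x y = g y x + swap_coeff q x y * g x y" if "x \<noteq> y" for g x y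
    using that by (simp add: op1_def)
  have op1_eq: "op1 g x x = p * g x x" for g x
    by (simp add: op1_def swap_coeff_def p_X_P_Y_def)
  have swap_coeff: "x < y \<Longrightarrow> swap_coeff q x y = 0" "y < x \<Longrightarrow> swap_coeff q x y = X" for x y
    by (simp_all add: swap_coeff_def p_X_P_Y_def)
  have flip_coeff: "x > 0 \<Longrightarrow> flip_coeff Q x = 0" "x < 0 \<Longrightarrow> flip_coeff Q x = Y" for x
    by (simp_all add: flip_coeff_def p_X_P_Y_def)
  \<comment> \<open>the possible stabilisers of \<open>(a, b)\<close> in the group of signed permutations\<close>
  consider "a = 0" "b = 0" | "a = 0" "b \<noteq> 0" | "b = 0" "a \<noteq> 0"
    | "a = b" "a \<noteq> 0" | "b = - a" "a \<noteq> 0"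
    | "a \<noteq> 0" "b \<noteq> 0" "a \<noteq> b" "a \<noteq> - b"
    by linarith
  then show ?thesis
  proof cases
    case 1 then show ?thesis by (simp add: op0_0 op1_eq)
  next
    case 2
    then have "0 < b \<or> b < 0" by linarith
    with 2 show ?thesis
      by (simp add: op0_0 op0 op1) (elim disjE; simp add: swap_coeff flip_coeff algebra_simps sq sq')
  next
    case 3
    then have "0 < a \<or> a < 0" by linarith
    with 3 show ?thesis
      by (simp add: op0_0 op0 op1) (elim disjE; simp add: swap_coeff flip_coeff algebra_simps sq sq')
  next
    case 4
    then have "0 < a \<or> a < 0" by linarith
    with 4 show ?thesis
      by (simp add: op0 op1 op1_eq) (elim disjE; simp add: swap_coeff flip_coeff algebra_simps sq sq')
  next
    case 5
    then have "0 < a \<or> a < 0" by linarith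
    with 5 show ?thesis
      by (simp add: op0 op1 op1_eq) (elim disjE; simp add: swap_coeff flip_coeff algebra_simps sq sq')
  next
    case 6
    then have ne: "b \<noteq> a" "- a \<noteq> b" "b \<noteq> - a" "- b \<noteq> a" "- b \<noteq> - a" "- a \<noteq> - b" by linarith+
    consider "0 < a" "a < b" | "0 < b" "b < a" | "0 < a" "a < - b" | "b < 0" "- b < a"
      | "a < 0" "- a < b" | "0 < b" "b < - a" | "a < 0" "b < a" | "b < 0" "a < b"
      using 6 by linarith
    then show ?thesis
      by cases (simp_all add: op0 op1 6 ne swap_coeff flip_coeff algebra_simps)
  qed
qed

lemma T_op_braid_B:
  assumes "v \<in> carrier (tspace n d)" "2 \<le> d" "q \<noteq> 0" "Q \<noteq> 0"
  shows "T_op Q q 1 (T_op Q q 0 (T_op Q q 1 (T_op Q q 0 v))) =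
    T_op Q q 0 (T_op Q q 1 (T_op Q q 0 (T_op Q q 1 v)))"
proof (rule tspace_eqI)
  fix \<kappa> assume \<kappa>: "\<kappa> \<in> multi_idx n d"
  have len: "length \<kappa> = d" using \<kappa> by (simp add: multi_idx_def)
  obtain a b \<beta> where eq: "\<kappa> = a # b # \<beta>"
    using len assms(2) by (metis Suc_le_length_iff numeral_2_eq_2)
  have op0: "(\<lambda>x y. Poly_Mapping.lookup (T_op Q q 0 w) (FMon (x # y # \<beta>))) =
      (\<lambda>x y. (if x \<noteq> 0 then Poly_Mapping.lookup w (FMon ((- x) # y # \<beta>)) else 0) +
      flip_coeff Q x * Poly_Mapping.lookup w (FMon (x # y # \<beta>)))" for w
    by (simp add: lookup_T_op s_act_def T_diag_def flip_coeff_def fun_eq_iff)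
  have op1: "(\<lambda>x y. Poly_Mapping.lookup (T_op Q q 1 w) (FMon (x # y # \<beta>))) =
      (\<lambda>x y. (if x \<noteq> y then Poly_Mapping.lookup w (FMon (y # x # \<beta>)) else 0) +
      swap_coeff q x y * Poly_Mapping.lookup w (FMon (x # y # \<beta>)))" for w
    by (simp add: lookup_T_op s_act_def T_diag_def swap_coeff_def fun_eq_iff)
  note op = fun_cong[OF fun_cong[OF op0]] fun_cong[OF fun_cong[OF op1]]
  show "Poly_Mapping.lookup (T_op Q q 1 (T_op Q q 0 (T_op Q q 1 (T_op Q q 0 v)))) (FMon \<kappa>) =
      Poly_Mapping.lookup (T_op Q q 0 (T_op Q q 1 (T_op Q q 0 (T_op Q q 1 v)))) (FMon \<kappa>)"
    unfolding eq op
    by (rule signed_permutation_braid[OF assms(3,4)])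
qed (use assms in \<open>auto intro!: T_op_closed\<close>)

section \<open>Endomorphisms commuting with the Hecke algebra\<close>

lemma fold_T_op_add: "fold (T_op Q q) ts (v + w) = fold (T_op Q q) ts v + fold (T_op Q q) ts w"
  by (induction ts arbitrary: v w) (simp_all add: T_op_add)

lemma fold_T_op_scl: "fold (T_op Q q) ts (scl c v) = scl c (fold (T_op Q q) ts v)"
  by (induction ts arbitrary: v) (simp_all add: T_op_scl)

lemma fold_T_op_zero [simp]: "fold (T_op Q q) ts 0 = 0"
  by (induction ts) simp_all

lemma fold_T_op_closed:
  "v \<in> carrier (tspace n d) \<Longrightarrow> set ts \<subseteq> {..<d} \<Longrightarrow> fold (T_op Q q) ts v \<in> carrier (tspace n d)"
  by (induction ts arbitrary: v) (simp_all add: T_op_closed)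

lemma tspace_zero: "0 \<in> carrier (tspace n d)"
  by (simp add: carrier_tspace)

lemma free_act_add: "free_act \<rho> v (f + g) = free_act \<rho> v f + free_act \<rho> v g"
  by (simp add: free_act_def lin_ext_add)

lemma free_act_diff: "free_act \<rho> v (f - g) = free_act \<rho> v f - free_act \<rho> v g"
  by (simp add: free_act_def lin_ext_diff)

lemma free_act_scl: "free_act \<rho> v (scl c f) = scl c (free_act \<rho> v f)"
  by (simp add: free_act_def lin_ext_scl)

lemma free_act_single: "free_act \<rho> v (Poly_Mapping.single w c) = scl c (fold \<rho> (letters w) v)"
  by (simp add: free_act_def)

lemma free_act_zero [simp]: "free_act \<rho> v 0 = 0"
  by (simp add: free_act_def)

lemma free_act_gen [simp]: "free_act \<rho> v (gen t) = \<rho> t v"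
  by (simp add: gen_def free_act_single)

lemma free_act_one [simp]: "free_act \<rho> v 1 = v"
  using free_act_single[of \<rho> v 0 1] by simp

lemma free_act_vec_add:
  "free_act (T_op Q q) (v + w) f = free_act (T_op Q q) v f + free_act (T_op Q q) w f"
  by (induction f rule: monomial_induct[OF subset_UNIV])
    (simp_all add: free_act_single free_act_add fold_T_op_add scl_add ac_simps)

lemma free_act_vec_scl: "free_act (T_op Q q) (scl c v) f = scl c (free_act (T_op Q q) v f)"
  by (induction f rule: monomial_induct[OF subset_UNIV])
    (simp_all add: free_act_single free_act_add fold_T_op_scl scl_add scl_scl mult.commute)

lemma free_act_vec_zero [simp]: "free_act (T_op Q q) 0 f = 0"
  using free_act_vec_scl[of Q q 0 0 f] by simp

lemma free_act_mult: "free_act (T_op Q q) v (f * g) = free_act (T_op Q q) (free_act (T_op Q q) v f) g"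
proof (induction f rule: monomial_induct[OF subset_UNIV, case_names zero monomial add])
  case (monomial u a)
  show ?case
    by (induction g rule: monomial_induct[OF subset_UNIV])
      (simp_all add: mult_single free_act_single fold_T_op_scl scl_scl distrib_left free_act_add mult.commute)
qed (simp_all add: distrib_right free_act_add free_act_vec_add)

lemma free_act_closed:
  assumes "v \<in> carrier (tspace n d)" "f \<in> carrier (free_alg {..<d})"
  shows "free_act (T_op Q q) v f \<in> carrier (tspace n d)"
proof -
  have "Poly_Mapping.keys f \<subseteq> {w. set (letters w) \<subseteq> {..<d}}"
    using assms by (simp add: carrier_free_alg)
  then show ?thesis
    by (induction rule: monomial_induct)
      (use assms in \<open>auto simp: free_act_single free_act_add tspace_zero
        intro!: tspace_closed fold_T_op_closed\<close>)
qed

definition hecke_ideal :: "'k::field \<Rightarrow> 'k \<Rightarrow> nat \<Rightarrow> (nat fmon \<Rightarrow>\<^sub>0 'k) set"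
  where "hecke_ideal Q q d = genideal (free_alg {..<d}) (hecke_rels Q q d)"

lemma gen_in_free_alg: "gen a \<in> carrier (free_alg G) \<longleftrightarrow> a \<in> G"
  by (simp add: gen_def carrier_free_alg)

lemma free_alg_closed:
  shows "f \<in> carrier (free_alg G) \<Longrightarrow> g \<in> carrier (free_alg G) \<Longrightarrow> f + g \<in> carrier (free_alg G)"
    "f \<in> carrier (free_alg G) \<Longrightarrow> g \<in> carrier (free_alg G) \<Longrightarrow> f - g \<in> carrier (free_alg G)"
    "f \<in> carrier (free_alg G) \<Longrightarrow> scl c f \<in> carrier (free_alg G)"
    "f \<in> carrier (free_alg G) \<Longrightarrow> g \<in> carrier (free_alg G) \<Longrightarrow> f * g \<in> carrier (free_alg G)"
  using free_alg_mult_closed[of f G g]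
  by (simp_all add: carrier_free_alg keys_subset_add keys_subset_scl keys_subset_diff)

lemma free_alg_one: "1 \<in> carrier (free_alg G)"
  by (simp add: carrier_free_alg)

lemma hecke_rels_subset:
  assumes "1 \<le> d"
  shows "hecke_rels Q q d \<subseteq> carrier (free_alg {..<d})"
  using assms unfolding hecke_rels_def power2_eq_square
  by (auto intro!: free_alg_closed free_alg_one simp: gen_in_free_alg split: if_splits)

text \<open>Closure under negation comes for free, since \<open>-1\<close> is a constant.\<close>

lemma ideal_of_free_alg:
  fixes A :: "('g fmon \<Rightarrow>\<^sub>0 'k::field) set"
  assumes "A \<subseteq> carrier (free_alg G)" "0 \<in> A" "\<And>f g. f \<in> A \<Longrightarrow> g \<in> A \<Longrightarrow> f + g \<in> A"
    "\<And>f g. f \<in> A \<Longrightarrow> g \<in> carrier (free_alg G) \<Longrightarrow> g * f \<in> A"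
    "\<And>f g. f \<in> A \<Longrightarrow> g \<in> carrier (free_alg G) \<Longrightarrow> f * g \<in> A"
  shows "ideal A (free_alg G :: ('k, 'g fmon \<Rightarrow>\<^sub>0 'k) module)"
proof (rule idealI[OF free_alg_ring])
  interpret F: ring "free_alg G :: ('k, 'g fmon \<Rightarrow>\<^sub>0 'k) module" by (rule free_alg_ring)
  have "- f \<in> A" if "f \<in> A" for f
  proof -
    have "- 1 \<in> carrier (free_alg G :: ('k, 'g fmon \<Rightarrow>\<^sub>0 'k) module)"
      using free_alg_one by (simp add: carrier_free_alg keys_subset_uminus)
    then show ?thesis using assms(4)[OF that] by fastforce
  qed
  then show "subgroup A (add_monoid (free_alg G :: ('k, 'g fmon \<Rightarrow>\<^sub>0 'k) module))"
    using assms(1-3) by (intro F.add.subgroupI) (auto simp flip: a_inv_def)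
qed (use assms in auto)

text \<open>The annihilator of tensor space is a two-sided ideal, as the action is multiplicative, and it contains
  the defining relations.\<close>

lemma hecke_ideal_annihilates:
  assumes "q \<noteq> 0" "Q \<noteq> 0" "1 \<le> d"
    and v: "v \<in> carrier (tspace n d)" and f: "f \<in> hecke_ideal Q q d"
  shows "free_act (T_op Q q) v f = 0"
proof -
  define A where "A = {f \<in> carrier (free_alg {..<d}). \<forall>v \<in> carrier (tspace n d). free_act (T_op Q q) v f = 0}"
  have "ideal A (free_alg {..<d} :: ('a, nat fmon \<Rightarrow>\<^sub>0 'a) module)"
    by (rule ideal_of_free_alg)
      (auto simp: A_def free_act_add free_act_mult free_act_closed free_alg_closed
        intro!: free_alg_closed, simp add: carrier_free_alg)
  moreover have "hecke_rels Q q d \<subseteq> A"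
  proof
    fix f assume f: "f \<in> hecke_rels Q q d"
    have "free_act (T_op Q q) v f = 0" if v: "v \<in> carrier (tspace n d)" for v
    proof -
      have comm: "T_op Q q j (T_op Q q i v) = T_op Q q i (T_op Q q j v)"
        if "i < d" "j < d" "\<bar>int i - int j\<bar> > 1" for i j
      proof -
        have "i + 1 < j \<or> j + 1 < i" using that by linarith
        then show ?thesis
          using T_op_commute[OF v, of i j Q q] T_op_commute[OF v, of j i Q q] that by auto
      qed
      show ?thesis
        using f unfolding hecke_rels_def Un_iff
      proof (elim disjE)
        assume "f \<in> {gen i * gen (i + 1) * gen i - gen (i + 1) * gen i * gen (i + 1) |i. 1 \<le> i \<and> i + 2 \<le> d}"
        then show ?thesis
          using T_op_braid[OF v _ _ assms(1)] by (auto simp: free_act_diff free_act_mult)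
      next
        assume "f \<in> (if 2 \<le> d then {(gen 0 * gen 1)\<^sup>2 - (gen 1 * gen 0)\<^sup>2} else {})"
        then show ?thesis
          using T_op_braid_B[OF v _ assms(1,2)]
          by (auto simp: free_act_diff free_act_mult power2_eq_square split: if_splits)
      next
        assume "f \<in> {gen i * gen j - gen j * gen i |i j. i < d \<and> j < d \<and> 1 < \<bar>int i - int j\<bar>}"
        then show ?thesis
          using comm by (auto simp: free_act_diff free_act_mult)
      next
        assume "f \<in> {(gen 0)\<^sup>2 - (scl (inverse Q - Q) (gen 0) + 1)}"
        then show ?thesis
          using T_op_quadratic[OF v, of 0 q Q] assms
          by (auto simp: free_act_diff free_act_mult power2_eq_square free_act_add free_act_scl)
      next
        assume "f \<in> {(gen i)\<^sup>2 - (scl (inverse q - q) (gen i) + 1) |i. 1 \<le> i \<and> i < d}"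
        then show ?thesis
          using T_op_quadratic[OF v _ assms(1,2)] assms
          by (auto simp: free_act_diff free_act_mult power2_eq_square free_act_add free_act_scl)
      qed
    qed
    then show "f \<in> A"
      using f hecke_rels_subset[OF assms(3)] by (auto simp: A_def)
  qed
  ultimately have "hecke_ideal Q q d \<subseteq> A"
    unfolding hecke_ideal_def by (rule ring.genideal_minimal[OF free_alg_ring])
  then show ?thesis using v f by (auto simp: A_def)
qed

lemma hecke_act_coset:
  assumes "q \<noteq> 0" "Q \<noteq> 0" "1 \<le> d"
    and v: "v \<in> carrier (tspace n d)" and f: "f \<in> carrier (free_alg {..<d})"
  shows "hecke_act Q q v (hecke_ideal Q q d +>\<^bsub>free_alg {..<d}\<^esub> f) = free_act (T_op Q q) v f"
proof -
  interpret I: ideal "hecke_ideal Q q d" "free_alg {..<d}"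
    unfolding hecke_ideal_def
    by (rule ring.genideal_ideal[OF free_alg_ring hecke_rels_subset[OF assms(3)]])
  have "0 \<in> hecke_ideal Q q d" using additive_subgroup.zero_closed[OF I.is_additive_subgroup] by simp
  moreover have "free_act (T_op Q q) v (i + f) = free_act (T_op Q q) v f" if "i \<in> hecke_ideal Q q d" for i
    using hecke_ideal_annihilates[OF assms(1-3) v that] by (simp add: free_act_add)
  ultimately have "free_act (T_op Q q) v ` (hecke_ideal Q q d +>\<^bsub>free_alg {..<d}\<^esub> f) =
      {free_act (T_op Q q) v f}"
    by (force simp: a_r_coset_def')
  then show ?thesis by (simp add: hecke_act_def)
qed

lemma End_space_tspace:
  assumes "f \<in> End_space (tspace n d)"
  shows "v \<in> carrier (tspace n d) \<Longrightarrow> f v \<in> carrier (tspace n d)"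
    "v \<in> carrier (tspace n d) \<Longrightarrow> w \<in> carrier (tspace n d) \<Longrightarrow> f (v + w) = f v + f w"
    "v \<in> carrier (tspace n d) \<Longrightarrow> f (scl c v) = scl c (f v)"
    "f 0 = 0" "f \<in> extensional (carrier (tspace n d))"
proof -
  show scl: "f (scl c v) = scl c (f v)" if "v \<in> carrier (tspace n d)" for c v
    using assms that by (simp add: End_space_def)
  show "f 0 = 0" using scl[OF tspace_zero, of 0] by simp
qed (use assms in \<open>auto simp: End_space_def PiE_def\<close>)

text \<open>Commuting with the generators implies commuting with words in them, and then with linear
  combinations of words.\<close>

lemma schurB_carrier:
  fixes q Q :: "'k::field"
  assumes "q \<noteq> 0" "Q \<noteq> 0" "1 \<le> d"
  shows "f \<in> carrier (schurB n d Q q) \<longleftrightarrow> f \<in> End_space (tspace n d) \<and>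
    (\<forall>t<d. \<forall>v\<in>carrier (tspace n d). f (T_op Q q t v) = T_op Q q t (f v))"
proof -
  have hecke: "carrier (hecke Q q d) =
      (\<lambda>x. hecke_ideal Q q d +>\<^bsub>free_alg {..<d}\<^esub> x) ` carrier (free_alg {..<d})"
    by (simp add: hecke_def presented_alg_def hecke_ideal_def)
  have "(\<forall>v\<in>carrier (tspace n d). \<forall>h\<in>carrier (hecke Q q d). f (hecke_act Q q v h) = hecke_act Q q (f v) h) \<longleftrightarrow>
      (\<forall>t<d. \<forall>v\<in>carrier (tspace n d). f (T_op Q q t v) = T_op Q q t (f v))" (is "?L \<longleftrightarrow> ?R")
    if f: "f \<in> End_space (tspace n d)"
  proof -
    note E = End_space_tspace[OF f]
    have "?L \<longleftrightarrow> (\<forall>v\<in>carrier (tspace n d). \<forall>x\<in>carrier (free_alg {..<d}).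
        f (free_act (T_op Q q) v x) = free_act (T_op Q q) (f v) x)" (is "_ \<longleftrightarrow> ?M")
      unfolding hecke using E(1) by (simp add: hecke_act_coset[OF assms, of _ n])
    also have "?M \<longleftrightarrow> ?R"
    proof
      assume M: ?M
      show ?R
      proof (intro allI impI ballI)
        fix t and v :: "int fmon \<Rightarrow>\<^sub>0 'k" assume "t < d" "v \<in> carrier (tspace n d)"
        then show "f (T_op Q q t v) = T_op Q q t (f v)"
          using bspec[OF bspec[OF M], of v "gen t"] by (simp add: gen_in_free_alg)
      qed
    next
      assume R: ?R
      have word: "f (fold (T_op Q q) ts v) = fold (T_op Q q) ts (f v)"
        if "v \<in> carrier (tspace n d)" "set ts \<subseteq> {..<d}" for v ts
        using that by (induction ts arbitrary: v) (use R in \<open>simp_all add: T_op_closed\<close>)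
      show ?M
      proof (intro ballI)
        fix v :: "int fmon \<Rightarrow>\<^sub>0 'k" and x assume v: "v \<in> carrier (tspace n d)" and x: "x \<in> carrier (free_alg {..<d} :: ('k, nat fmon \<Rightarrow>\<^sub>0 'k) module)"
        from x have "Poly_Mapping.keys x \<subseteq> {w. set (letters w) \<subseteq> {..<d}}" by (simp add: carrier_free_alg)
        then show "f (free_act (T_op Q q) v x) = free_act (T_op Q q) (f v) x"
        proof (induction rule: monomial_induct)
          case (monomial w c)
          then show ?case using word[OF v] fold_T_op_closed[OF v] E(3) by (simp add: free_act_single)
        next
          case (add g h)
          then show ?case
            using E(2) free_act_closed[OF v] by (simp add: free_act_add carrier_free_alg)
        qed (simp add: E)
      qed
    qed
    finally show ?thesis .
  qed
  then show ?thesis by (auto simp: schurB_def)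
qed

section \<open>Matrices of endomorphisms\<close>

text \<open>The entry at \<open>(\<kappa>, \<mu>)\<close> of the matrix equation \<open>T\<^sub>t F = F T\<^sub>t\<close>, written out by means of the sparse form
  of \<open>T\<^sub>t\<close>.\<close>

definition intertwines :: "'k::field \<Rightarrow> 'k \<Rightarrow> nat \<Rightarrow> int list set \<Rightarrow> (int list \<Rightarrow> int list \<Rightarrow> 'k) \<Rightarrow> bool"
  where "intertwines Q q t N F \<longleftrightarrow> (\<forall>\<kappa>\<in>N. \<forall>\<mu>\<in>N.
    (if s_act \<kappa> t \<noteq> \<kappa> then F (s_act \<kappa> t) \<mu> else 0) + T_diag Q q t \<kappa> * F \<kappa> \<mu> =
    (if s_act \<mu> t \<noteq> \<mu> then F \<kappa> (s_act \<mu> t) else 0) + T_diag Q q t \<mu> * F \<kappa> \<mu>)"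

definition op_matrix :: "((int fmon \<Rightarrow>\<^sub>0 'k) \<Rightarrow> (int fmon \<Rightarrow>\<^sub>0 'k)) \<Rightarrow> int list \<Rightarrow> int list \<Rightarrow> 'k::field"
  where "op_matrix f \<nu> \<mu> = Poly_Mapping.lookup (f (bvec \<mu>)) (FMon \<nu>)"

definition matrix_op ::
    "nat \<Rightarrow> nat \<Rightarrow> (int list \<Rightarrow> int list \<Rightarrow> 'k::field) \<Rightarrow> (int fmon \<Rightarrow>\<^sub>0 'k) \<Rightarrow> (int fmon \<Rightarrow>\<^sub>0 'k)"
  where "matrix_op n d F = (\<lambda>v\<in>carrier (tspace n d).
    lin_ext (\<lambda>w. \<Sum>\<nu>\<in>multi_idx n d. scl (F \<nu> (letters w)) (bvec \<nu>)) v)"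

lemma tspace_induct [consumes 1, case_names zero monomial add]:
  assumes "v \<in> carrier (tspace n d)" "P 0" "\<And>\<mu> c. \<mu> \<in> multi_idx n d \<Longrightarrow> P (scl c (bvec \<mu>))"
    "\<And>v w. v \<in> carrier (tspace n d) \<Longrightarrow> w \<in> carrier (tspace n d) \<Longrightarrow> P v \<Longrightarrow> P w \<Longrightarrow> P (v + w)"
  shows "P (v :: int fmon \<Rightarrow>\<^sub>0 'k::field)"
proof -
  have "Poly_Mapping.keys v \<subseteq> words (idx n) d" using assms(1) by (simp add: carrier_tspace)
  then show ?thesis
  proof (induction rule: monomial_induct)
    case (monomial w c)
    then show ?case using assms(3)[of "letters w" c] by (simp add: words_idx bvec_def)
  qed (use assms in \<open>simp_all add: carrier_tspace\<close>)
qed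

lemma lookup_bvec_sum:
  assumes "\<kappa> \<in> multi_idx n d"
  shows "Poly_Mapping.lookup (\<Sum>\<nu>\<in>multi_idx n d. scl (c \<nu>) (bvec \<nu>)) (FMon \<kappa>) = c \<kappa>"
proof -
  have "Poly_Mapping.lookup (\<Sum>\<nu>\<in>multi_idx n d. scl (c \<nu>) (bvec \<nu>)) (FMon \<kappa>) =
      (\<Sum>\<nu>\<in>multi_idx n d. if \<nu> = \<kappa> then c \<nu> else 0)"
    unfolding lookup_sum by (intro sum.cong) (auto simp: bvec_def lookup_single when_def)
  then show ?thesis using assms by simp
qed

lemma matrix_op_End_space: "matrix_op n d F \<in> End_space (tspace n d)"
proof -
  have "lin_ext (\<lambda>w. \<Sum>\<nu>\<in>multi_idx n d. scl (F \<nu> (letters w)) (bvec \<nu>)) v \<in> carrier (tspace n d)"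
    for v :: "int fmon \<Rightarrow>\<^sub>0 'a"
    unfolding lin_ext_def carrier_tspace mem_Collect_eq
    by (intro keys_subset_sum keys_subset_scl) (simp add: bvec_def words_idx)
  then show ?thesis
    by (simp add: End_space_def matrix_op_def tspace_closed lin_ext_add lin_ext_scl)
qed

lemma op_matrix_matrix_op:
  assumes "\<nu> \<in> multi_idx n d" "\<mu> \<in> multi_idx n d"
  shows "op_matrix (matrix_op n d F) \<nu> \<mu> = (F \<nu> \<mu> :: 'a::field)"
  by (simp add: op_matrix_def matrix_op_def bvec_in_tspace assms lookup_bvec_sum)

lemma End_space_eqI:
  assumes f: "f \<in> End_space (tspace n d)" and g: "g \<in> End_space (tspace n d)"
    and eq: "\<And>\<mu>. \<mu> \<in> multi_idx n d \<Longrightarrow> f (bvec \<mu>) = g (bvec \<mu>)"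
  shows "f = g"
proof (rule extensionalityI[OF End_space_tspace(5)[OF f] End_space_tspace(5)[OF g]])
  fix v :: "int fmon \<Rightarrow>\<^sub>0 'a" assume "v \<in> carrier (tspace n d)"
  then show "f v = g v"
    by (induction rule: tspace_induct)
      (simp_all add: End_space_tspace(2-4)[OF f] End_space_tspace(2-4)[OF g] eq bvec_in_tspace)
qed

lemma End_space_eqI_matrix:
  assumes "f \<in> End_space (tspace n d)" "g \<in> End_space (tspace n d)"
    and "\<And>\<nu> \<mu>. \<nu> \<in> multi_idx n d \<Longrightarrow> \<mu> \<in> multi_idx n d \<Longrightarrow> op_matrix f \<nu> \<mu> = op_matrix g \<nu> \<mu>"
  shows "f = g"
proof (rule End_space_eqI[OF assms(1,2)])
  fix \<mu> assume "\<mu> \<in> multi_idx n d"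
  then show "f (bvec \<mu>) = g (bvec \<mu>)"
    using assms(3) by (intro tspace_eqI[of _ n d] End_space_tspace(1)[OF assms(1)]
      End_space_tspace(1)[OF assms(2)] bvec_in_tspace) (auto simp: op_matrix_def)
qed

lemma lookup_End_space:
  assumes f: "f \<in> End_space (tspace n d)" and v: "v \<in> carrier (tspace n d)"
  shows "Poly_Mapping.lookup (f v) (FMon \<nu>) =
    (\<Sum>\<mu>\<in>multi_idx n d. op_matrix f \<nu> \<mu> * Poly_Mapping.lookup v (FMon \<mu>))"
  using v
proof (induction rule: tspace_induct)
  case (monomial \<mu> c)
  have "(\<Sum>\<kappa>\<in>multi_idx n d. op_matrix f \<nu> \<kappa> * Poly_Mapping.lookup (scl c (bvec \<mu>)) (FMon \<kappa>)) =
      (\<Sum>\<kappa>\<in>multi_idx n d. if \<kappa> = \<mu> then op_matrix f \<nu> \<kappa> * c else 0)"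
    by (intro sum.cong) (auto simp: bvec_def lookup_single when_def)
  then show ?case using monomial
    by (simp add: End_space_tspace[OF f] bvec_in_tspace op_matrix_def)
qed (simp_all add: End_space_tspace[OF f] lookup_add distrib_left sum.distrib)

lemma op_matrix_compose:
  assumes "f \<in> End_space (tspace n d)" "g \<in> End_space (tspace n d)" "\<mu> \<in> multi_idx n d"
  shows "op_matrix (compose (carrier (tspace n d)) f g) \<nu> \<mu> =
    (\<Sum>\<kappa>\<in>multi_idx n d. op_matrix f \<nu> \<kappa> * op_matrix g \<kappa> \<mu>)"
  by (simp add: op_matrix_def compose_def bvec_in_tspace[OF assms(3)] lookup_End_space[OF assms(1)] End_space_tspace(1)[OF assms(2)])

lemma End_space_commutes_T_op:
  fixes q Q :: "'k::field"
  assumes f: "f \<in> End_space (tspace n d)" and t: "t < d"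
  shows "(\<forall>v\<in>carrier (tspace n d). f (T_op Q q t v) = T_op Q q t (f v)) \<longleftrightarrow>
    intertwines Q q t (multi_idx n d) (op_matrix f)" (is "?L \<longleftrightarrow> ?R")
proof -
  note E = End_space_tspace[OF f]
  have basis: "T_op Q q t (bvec \<mu>) = (if s_act \<mu> t \<noteq> \<mu> then bvec (s_act \<mu> t) else 0) +
      scl (T_diag Q q t \<mu>) (bvec \<mu>)" if "\<mu> \<in> multi_idx n d" for \<mu>
    using that t by (simp add: T_op_def bvec_def T_basis_eq multi_idx_def)
  have lhs: "Poly_Mapping.lookup (f (T_op Q q t (bvec \<mu>))) (FMon \<kappa>) =
      (if s_act \<mu> t \<noteq> \<mu> then op_matrix f \<kappa> (s_act \<mu> t) else 0) + T_diag Q q t \<mu> * op_matrix f \<kappa> \<mu>"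
    if "\<mu> \<in> multi_idx n d" for \<mu> \<kappa>
    using that t s_act_multi_idx[OF that t]
    by (simp add: basis E bvec_in_tspace tspace_closed tspace_zero op_matrix_def lookup_add)
  have rhs: "Poly_Mapping.lookup (T_op Q q t (f (bvec \<mu>))) (FMon \<kappa>) =
      (if s_act \<kappa> t \<noteq> \<kappa> then op_matrix f (s_act \<kappa> t) \<mu> else 0) + T_diag Q q t \<kappa> * op_matrix f \<kappa> \<mu>"
    if "\<kappa> \<in> multi_idx n d" for \<mu> \<kappa>
    using that t by (simp add: lookup_T_op multi_idx_def op_matrix_def)
  have "?L \<longleftrightarrow> (\<forall>\<mu>\<in>multi_idx n d. f (T_op Q q t (bvec \<mu>)) = T_op Q q t (f (bvec \<mu>)))" (is "_ \<longleftrightarrow> ?M")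
  proof
    assume M: ?M
    show ?L
    proof
      fix v :: "int fmon \<Rightarrow>\<^sub>0 'k" assume "v \<in> carrier (tspace n d)"
      then show "f (T_op Q q t v) = T_op Q q t (f v)"
        by (induction rule: tspace_induct)
          (use M t in \<open>simp_all add: E T_op_add T_op_scl T_op_closed bvec_in_tspace\<close>)
    qed
  qed (simp add: bvec_in_tspace)
  also have "?M \<longleftrightarrow> (\<forall>\<mu>\<in>multi_idx n d. \<forall>\<kappa>\<in>multi_idx n d.
      Poly_Mapping.lookup (f (T_op Q q t (bvec \<mu>))) (FMon \<kappa>) =
      Poly_Mapping.lookup (T_op Q q t (f (bvec \<mu>))) (FMon \<kappa>))"
  proof (intro ball_cong refl iffI)
    fix \<mu> assume "\<mu> \<in> multi_idx n d" and "\<forall>\<kappa>\<in>multi_idx n d.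
      Poly_Mapping.lookup (f (T_op Q q t (bvec \<mu>))) (FMon \<kappa>) =
      Poly_Mapping.lookup (T_op Q q t (f (bvec \<mu>))) (FMon \<kappa>)"
    then show "f (T_op Q q t (bvec \<mu>)) = T_op Q q t (f (bvec \<mu>))"
      using t by (intro tspace_eqI[of _ n d] T_op_closed E(1) bvec_in_tspace) auto
  qed simp
  also have "\<dots> \<longleftrightarrow> ?R"
    unfolding intertwines_def by (rule iffI; intro ballI; drule (1) bspec; drule (1) bspec; simp only: lhs rhs)
  finally show ?thesis .
qed

abbreviation xfree :: "nat \<Rightarrow> ('k::field, (int \<times> int) fmon \<Rightarrow>\<^sub>0 'k) module"
  where "xfree n \<equiv> free_alg (idx n \<times> idx n)"

abbreviation xpart :: "nat \<Rightarrow> nat \<Rightarrow> ((int \<times> int) fmon \<Rightarrow>\<^sub>0 'k::field) set"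
  where "xpart n d \<equiv> carrier (free_part (idx n \<times> idx n) d)"

section \<open>The homogeneous components of quantum matrices\<close>

lemma xpart_closed:
  "0 \<in> xpart n d" "f \<in> xpart n d \<Longrightarrow> g \<in> xpart n d \<Longrightarrow> f + g \<in> xpart n d"
  "f \<in> xpart n d \<Longrightarrow> g \<in> xpart n d \<Longrightarrow> f - g \<in> xpart n d"
  "f \<in> xpart n d \<Longrightarrow> scl c f \<in> xpart n d" "f \<in> xpart n d \<Longrightarrow> - f \<in> xpart n d"
  by (simp_all add: carrier_free_part keys_subset_add keys_subset_diff keys_subset_scl keys_subset_uminus)

lemma xpart_xfree: "f \<in> xpart n d \<Longrightarrow> f \<in> carrier (xfree n)"
  by (auto simp: carrier_free_part carrier_free_alg words_def)

lemma qmat_rels_subset: "qmat_rels n q \<subseteq> carrier (xfree n)"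
  unfolding qmat_rels_def qbr_def
  by (auto intro!: free_alg_closed simp: gen_in_free_alg)

lemma qmat_ideal_ideal: "ideal (qmat_ideal n q) (xfree n)"
  unfolding qmat_ideal_def by (rule ring.genideal_ideal[OF free_alg_ring qmat_rels_subset])

lemma qmat_ideal_closed:
  shows "qmat_ideal n q \<subseteq> carrier (xfree n)" "0 \<in> qmat_ideal n q"
    "f \<in> qmat_ideal n q \<Longrightarrow> g \<in> qmat_ideal n q \<Longrightarrow> f + g \<in> qmat_ideal n q"
    "f \<in> qmat_ideal n q \<Longrightarrow> scl c f \<in> qmat_ideal n q"
    "f \<in> qmat_ideal n q \<Longrightarrow> - f \<in> qmat_ideal n q"
    "f \<in> qmat_ideal n q \<Longrightarrow> h \<in> carrier (xfree n) \<Longrightarrow> f * h \<in> qmat_ideal n q"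
    "f \<in> qmat_ideal n q \<Longrightarrow> h \<in> carrier (xfree n) \<Longrightarrow> h * f \<in> qmat_ideal n q"
proof -
  interpret I: ideal "qmat_ideal n q" "xfree n" by (rule qmat_ideal_ideal)
  note add = additive_subgroup.a_subset[OF I.is_additive_subgroup]
    additive_subgroup.zero_closed[OF I.is_additive_subgroup]
    additive_subgroup.a_closed[OF I.is_additive_subgroup]
  show "qmat_ideal n q \<subseteq> carrier (xfree n)" "0 \<in> qmat_ideal n q" using add by auto
  show "f + g \<in> qmat_ideal n q" if "f \<in> qmat_ideal n q" "g \<in> qmat_ideal n q" for f g
    using add(3)[OF that] by simp
  show "f * h \<in> qmat_ideal n q" "h * f \<in> qmat_ideal n q"
    if "f \<in> qmat_ideal n q" "h \<in> carrier (xfree n)" for f h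
    using I.I_r_closed[OF that] I.I_l_closed[OF that] by simp_all
  show scl: "scl c f \<in> qmat_ideal n q" if "f \<in> qmat_ideal n q" for c f
    using I.I_l_closed[OF that, of "Poly_Mapping.single 0 c"] by (simp add: scl_def carrier_free_alg)
  show "- f \<in> qmat_ideal n q" if "f \<in> qmat_ideal n q" for f
    using scl[OF that, of "- 1"] by (simp add: scl_minus)
qed

lemma qmat_ideal_submodule: "submodule (qmat_ideal n q) ground_field (xfree n)"
  by (rule module.submoduleI[OF free_alg_module])
    (use qmat_ideal_closed in \<open>auto simp: free_alg_a_inv[OF subsetD[OF qmat_ideal_closed(1)]]\<close>)

lemma qmat_module: "module ground_field (qmat n q)"
  unfolding qmat_def presented_alg_def
  by (rule quot_module[OF free_alg_module qmat_ideal_submodule[unfolded qmat_ideal_def]])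

lemma qmat_sel:
  "carrier (qmat n q) = qcls n q ` carrier (xfree n)" "\<zero>\<^bsub>qmat n q\<^esub> = qmat_ideal n q"
  "f \<in> carrier (xfree n) \<Longrightarrow> g \<in> carrier (xfree n) \<Longrightarrow> qcls n q f \<oplus>\<^bsub>qmat n q\<^esub> qcls n q g = qcls n q (f + g)"
  "f \<in> carrier (xfree n) \<Longrightarrow> c \<odot>\<^bsub>qmat n q\<^esub> qcls n q f = qcls n q (scl c f)"
  using quot_add[OF free_alg_module qmat_ideal_submodule] quot_smult[OF free_alg_module qmat_ideal_submodule]
  by (simp_all add: qmat_def presented_alg_def qmat_ideal_def)

lemma qcls_zero: "qcls n q 0 = qmat_ideal n q"
  using quot_zero[OF free_alg_module qmat_ideal_submodule] by simp

lemma qmat_part_sel: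
  "carrier (qmat_part n q d) = qcls n q ` xpart n d"
  "\<zero>\<^bsub>qmat_part n q d\<^esub> = qcls n q 0"
  "f \<in> xpart n d \<Longrightarrow> g \<in> xpart n d \<Longrightarrow> qcls n q f \<oplus>\<^bsub>qmat_part n q d\<^esub> qcls n q g = qcls n q (f + g)"
  "f \<in> xpart n d \<Longrightarrow> c \<odot>\<^bsub>qmat_part n q d\<^esub> qcls n q f = qcls n q (scl c f)"
  by (simp_all add: qmat_part_def qmat_sel qcls_zero xpart_xfree)

lemma qcls_eq:
  assumes "f \<in> carrier (xfree n)" "g \<in> carrier (xfree n)"
  shows "qcls n q f = qcls n q g \<longleftrightarrow> f - g \<in> qmat_ideal n q"
  using quot_eq[OF free_alg_module qmat_ideal_submodule assms] assms
  by (simp add: a_minus_def)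

lemma qmat_part_module: "module ground_field (qmat_part n q d)"
proof -
  interpret Q: module ground_field "qmat n q" by (rule qmat_module)
  have "submodule (qcls n q ` xpart n d) ground_field (qmat n q)"
  proof (rule Q.submoduleI)
    show "\<zero>\<^bsub>qmat n q\<^esub> \<in> qcls n q ` xpart n d"
      using imageI[OF xpart_closed(1), of "qcls n q" n d] by (simp add: qmat_sel qcls_zero)
    show "\<ominus>\<^bsub>qmat n q\<^esub> x \<in> qcls n q ` xpart n d" if x: "x \<in> qcls n q ` xpart n d" for x
    proof -
      obtain f where f: "f \<in> xpart n d" "x = qcls n q f" using x by auto
      have "\<ominus>\<^bsub>qmat n q\<^esub> x = qcls n q (- f)"
        using f xpart_xfree[OF f(1)] xpart_xfree[OF xpart_closed(5)[OF f(1)]]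
        by (intro Q.minus_equality) (simp_all add: qmat_sel qcls_zero)
      then show ?thesis using f by (auto simp: xpart_closed)
    qed
  qed (auto simp: qmat_sel xpart_xfree xpart_closed)
  then show ?thesis
    unfolding qmat_part_def by (rule submodule.submodule_is_module[OF _ qmat_module])
qed

section \<open>Matrices of linear forms\<close>

definition form_matrix ::
    "nat \<Rightarrow> 'k::field \<Rightarrow> (((int \<times> int) fmon \<Rightarrow>\<^sub>0 'k) set \<Rightarrow> 'k) \<Rightarrow> int list \<Rightarrow> int list \<Rightarrow> 'k"
  where "form_matrix n q \<phi> \<nu> \<mu> = \<phi> (qcls n q (xmon \<nu> \<mu>))"

text \<open>The entry of \<open>F\<close> belonging to a word in the letters \<open>(i, j)\<close>, that is, to the monomial
  \<open>x\<^sub>\<nu>\<^sub>\<mu>\<close> with \<open>\<nu>\<close> the list of first and \<open>\<mu>\<close> the list of second indices.\<close>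

definition entry :: "(int list \<Rightarrow> int list \<Rightarrow> 'k) \<Rightarrow> (int \<times> int) fmon \<Rightarrow> 'k"
  where "entry F w = F (map fst (letters w)) (map snd (letters w))"

lemma xmon_eq_single: "xmon \<nu> \<mu> = (Poly_Mapping.single (FMon (zip \<nu> \<mu>)) 1 :: (int \<times> int) fmon \<Rightarrow>\<^sub>0 'k::field)"
proof -
  have "prod_list (map gen l) = (Poly_Mapping.single (FMon l) 1 :: (int \<times> int) fmon \<Rightarrow>\<^sub>0 'k)" for l
    by (induction l) (simp_all add: gen_def mult_single FMon_plus flip: zero_fmon_def)
  moreover have "map2 xgen \<nu> \<mu> = map gen (zip \<nu> \<mu>)" by auto
  ultimately show ?thesis unfolding xmon_def by simp
qed

lemma entry_zip:
  assumes "length \<nu> = length \<mu>" shows "entry F (FMon (zip \<nu> \<mu>)) = F \<nu> \<mu>"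
  using assms by (simp add: entry_def)

lemma words_idx_pairs:
  "w \<in> words (idx n \<times> idx n) d \<longleftrightarrow> map fst (letters w) \<in> multi_idx n d \<and> map snd (letters w) \<in> multi_idx n d"
  by (auto simp: words_def multi_idx_def)

lemma xmon_xpart: "\<nu> \<in> multi_idx n d \<Longrightarrow> \<mu> \<in> multi_idx n d \<Longrightarrow> xmon \<nu> \<mu> \<in> xpart n d"
  by (simp add: xmon_eq_single carrier_free_part words_idx_pairs) (simp add: multi_idx_def)

lemma lin_form_entry_xmon:
  "length \<nu> = length \<mu> \<Longrightarrow> lin_form (entry F) (xmon \<nu> \<mu>) = F \<nu> \<mu>"
  by (simp add: xmon_eq_single entry_zip)

lemma dual_space_linear:
  assumes "\<phi> \<in> dual_space (qmat_part n q d)"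
  shows "f \<in> xpart n d \<Longrightarrow> g \<in> xpart n d \<Longrightarrow> \<phi> (qcls n q (f + g)) = \<phi> (qcls n q f) + \<phi> (qcls n q g)"
    "f \<in> xpart n d \<Longrightarrow> \<phi> (qcls n q (scl c f)) = c * \<phi> (qcls n q f)"
    "\<phi> (qcls n q 0) = 0"
proof -
  show scl: "\<phi> (qcls n q (scl c f)) = c * \<phi> (qcls n q f)" if "f \<in> xpart n d" for c f
    using assms that by (auto simp: dual_space_def qmat_part_sel simp flip: qmat_part_sel(4))
  show "\<phi> (qcls n q 0) = 0" using scl[OF xpart_closed(1), of 0] by simp
  show "\<phi> (qcls n q (f + g)) = \<phi> (qcls n q f) + \<phi> (qcls n q g)"
    if "f \<in> xpart n d" "g \<in> xpart n d" for f g
    using assms that by (auto simp: dual_space_def qmat_part_sel simp flip: qmat_part_sel(3))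
qed

lemma form_eq_ev:
  assumes \<phi>: "\<phi> \<in> dual_space (qmat_part n q d)" and f: "f \<in> xpart n d"
  shows "\<phi> (qcls n q f) = lin_form (entry (form_matrix n q \<phi>)) f"
proof -
  have "Poly_Mapping.keys f \<subseteq> words (idx n \<times> idx n) d" using f by (simp add: carrier_free_part)
  then show ?thesis
  proof (induction rule: monomial_induct)
    case (monomial w c)
    have x: "xmon (map fst (letters w)) (map snd (letters w)) = Poly_Mapping.single w (1::'a)"
      by (simp add: xmon_eq_single zip_map_fst_snd)
    have "Poly_Mapping.single w (1::'a) \<in> xpart n d" using monomial by (simp add: carrier_free_part)
    then show ?case using dual_space_linear(2)[OF \<phi>, of "Poly_Mapping.single w 1" c]
      by (simp add: entry_def form_matrix_def x)
  qed (simp_all add: dual_space_linear[OF \<phi>] carrier_free_part lin_form_add)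
qed

lemma dual_space_eqI:
  assumes "\<phi> \<in> dual_space (qmat_part n q d)" "\<psi> \<in> dual_space (qmat_part n q d)"
    and "\<And>\<nu> \<mu>. \<nu> \<in> multi_idx n d \<Longrightarrow> \<mu> \<in> multi_idx n d \<Longrightarrow> form_matrix n q \<phi> \<nu> \<mu> = form_matrix n q \<psi> \<nu> \<mu>"
  shows "\<phi> = \<psi>"
proof (rule extensionalityI[of _ "carrier (qmat_part n q d)"])
  show "\<phi> \<in> extensional (carrier (qmat_part n q d))" "\<psi> \<in> extensional (carrier (qmat_part n q d))"
    using assms by (auto simp: dual_space_def)
  fix c assume "c \<in> carrier (qmat_part n q d)"
  then obtain f where f: "f \<in> xpart n d" "c = qcls n q f" by (auto simp: qmat_part_sel)
  have "lin_form (entry (form_matrix n q \<phi>)) f = lin_form (entry (form_matrix n q \<psi>)) f"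
    using f by (intro lin_form_cong) (auto simp: entry_def carrier_free_part words_idx_pairs intro!: assms(3) dest!: subsetD)
  then show "\<phi> c = \<psi> c" using assms f by (simp add: form_eq_ev)
qed

section \<open>The defining relations as a commutation equation\<close>

text \<open>The entry at \<open>((a, b), (i, j))\<close> of \<open>T X\<^sub>1 X\<^sub>2 - X\<^sub>1 X\<^sub>2 T\<close>, where \<open>T\<close> is the matrix of \<open>T\<^sub>1\<close> on \<open>V \<otimes> V\<close> and
  \<open>X\<^sub>1 X\<^sub>2\<close> has the entries \<open>x\<^sub>a\<^sub>i x\<^sub>b\<^sub>j\<close>.\<close>

definition rtt :: "'k::field \<Rightarrow> int \<Rightarrow> int \<Rightarrow> int \<Rightarrow> int \<Rightarrow> ((int \<times> int) fmon \<Rightarrow>\<^sub>0 'k)"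
  where "rtt q a b i j =
    ((if a \<noteq> b then xgen b i * xgen a j else 0) + scl (swap_coeff q a b) (xgen a i * xgen b j)) -
    ((if i \<noteq> j then xgen a j * xgen b i else 0) + scl (swap_coeff q i j) (xgen a i * xgen b j))"

text \<open>Each entry is a defining relation up to a scalar, except when \<open>b < a\<close> and \<open>i < j\<close>: there the product
  \<open>x\<^sub>b\<^sub>j x\<^sub>a\<^sub>i\<close> of the last relation has its factors in the other order, and a multiple of the
  commutator relation corrects this.\<close>

lemma rtt_in_ideal:
  assumes "q \<noteq> 0" "a \<in> idx n" "b \<in> idx n" "i \<in> idx n" "j \<in> idx n"
  shows "rtt q a b i j \<in> qmat_ideal n q"
proof -
  have gen: "r \<in> qmat_ideal n q" if "r \<in> qmat_rels n q" for r
    using ring.genideal_self[OF free_alg_ring qmat_rels_subset] that by (auto simp: qmat_ideal_def)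
  have row: "qbr (inverse q) (xgen k i) (xgen k j) \<in> qmat_ideal n q"
    if "k \<in> idx n" "i \<in> idx n" "j \<in> idx n" "j < i" for k i j
    using that by (intro gen) (unfold qmat_rels_def, blast)
  have col: "qbr (inverse q) (xgen k i) (xgen l i) \<in> qmat_ideal n q"
    if "k \<in> idx n" "l \<in> idx n" "i \<in> idx n" "l < k" for k l i
    using that by (intro gen) (unfold qmat_rels_def, blast)
  have anti: "qbr 1 (xgen k i) (xgen l j) \<in> qmat_ideal n q"
    if "k \<in> idx n" "l \<in> idx n" "i \<in> idx n" "j \<in> idx n" "l < k" "i < j" for k l i j
    using that by (intro gen) (unfold qmat_rels_def, blast)
  have diag: "qbr 1 (xgen k i) (xgen l j) - scl (inverse q - q) (xgen l i * xgen k j) \<in> qmat_ideal n q"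
    if "k \<in> idx n" "l \<in> idx n" "i \<in> idx n" "j \<in> idx n" "l < k" "j < i" for k l i j
    using that by (intro gen) (unfold qmat_rels_def, blast)
  have scl_eq: "scl c f - scl e f = scl (c - e) f" for c e and f :: "(int \<times> int) fmon \<Rightarrow>\<^sub>0 'a"
    by (rule poly_mapping_eqI) (simp add: lookup_minus algebra_simps)
  note I = qmat_ideal_closed(2-5)[where n = n and q = q]
  consider "a = b" "i = j" | "a = b" "i < j" | "a = b" "j < i" | "a < b" "i = j" | "b < a" "i = j"
    | "a < b" "i < j" | "a < b" "j < i" | "b < a" "i < j" | "b < a" "j < i" by linarith
  then show ?thesis
  proof cases
    case 1
    then show ?thesis using I by (simp add: rtt_def swap_coeff_def)
  next
    case 2
    have "rtt q a b i j = - qbr (inverse q) (xgen a j) (xgen a i)"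
      using 2 by (simp add: rtt_def swap_coeff_def qbr_def)
    then show ?thesis using row[of a j i] I(4) 2 assms by metis
  next
    case 3
    have "rtt q a b i j = scl q (qbr (inverse q) (xgen a i) (xgen a j))"
      using 3 assms by (intro poly_mapping_eqI) (simp add: rtt_def swap_coeff_def qbr_def lookup_minus lookup_add algebra_simps)
    then show ?thesis using row[of a i j] I(3) 3 assms by metis
  next
    case 4
    have "rtt q a b i j = qbr (inverse q) (xgen b i) (xgen a i)"
      using 4 by (simp add: rtt_def swap_coeff_def qbr_def)
    then show ?thesis using col[of b a i] 4 assms by metis
  next
    case 5
    have "rtt q a b i j = scl (- q) (qbr (inverse q) (xgen a i) (xgen b i))"
      using 5 assms by (intro poly_mapping_eqI) (simp add: rtt_def swap_coeff_def qbr_def lookup_minus lookup_add algebra_simps)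
    then show ?thesis using col[of a b i] I(3) 5 assms by metis
  next
    case 6
    have "rtt q a b i j = qbr 1 (xgen b i) (xgen a j)"
      using 6 by (simp add: rtt_def swap_coeff_def qbr_def)
    then show ?thesis using anti[of b a i j] 6 assms by metis
  next
    case 7
    have "rtt q a b i j = qbr 1 (xgen b i) (xgen a j) - scl (inverse q - q) (xgen a i * xgen b j)"
      using 7 by (simp add: rtt_def swap_coeff_def qbr_def)
    then show ?thesis using diag[of b a i j] 7 assms by metis
  next
    case 8
    have "rtt q a b i j = - (qbr 1 (xgen a j) (xgen b i) - scl (inverse q - q) (xgen b j * xgen a i)) +
        scl (inverse q - q) (qbr 1 (xgen a i) (xgen b j))"
      using 8 by (intro poly_mapping_eqI) (simp add: rtt_def swap_coeff_def qbr_def lookup_minus lookup_add algebra_simps)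
    then show ?thesis using diag[of a b j i] anti[of a b i j] I(2-4) 8 assms by metis
  next
    case 9
    have "rtt q a b i j = - qbr 1 (xgen a j) (xgen b i)"
      using 9 by (simp add: rtt_def swap_coeff_def qbr_def)
    then show ?thesis using anti[of a b j i] I(4) 9 assms by metis
  qed
qed

text \<open>Through this, a matrix satisfying the commutation equation yields a form that kills the generators of
  the ideal.\<close>

lemma qmat_rels_rtt:
  assumes "r \<in> qmat_rels n q"
  shows "\<exists>a\<in>idx n. \<exists>b\<in>idx n. \<exists>i\<in>idx n. \<exists>j\<in>idx n. r = rtt q a b i j \<or> r = - rtt q a b i j"
  using assms unfolding qmat_rels_def Un_iff
proof (elim disjE)
  assume "r \<in> {qbr (inverse q) (xgen k i) (xgen k j) |k i j. k \<in> idx n \<and> i \<in> idx n \<and> j \<in> idx n \<and> j < i}"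
  then obtain k i j where "k \<in> idx n" "i \<in> idx n" "j \<in> idx n" "j < i" "r = qbr (inverse q) (xgen k i) (xgen k j)"
    by blast
  moreover from this have "r = - rtt q k k j i" by (simp add: rtt_def swap_coeff_def qbr_def)
  ultimately show ?thesis by blast
next
  assume "r \<in> {qbr (inverse q) (xgen k i) (xgen l i) |k l i. k \<in> idx n \<and> l \<in> idx n \<and> i \<in> idx n \<and> l < k}"
  then obtain k l i where "k \<in> idx n" "l \<in> idx n" "i \<in> idx n" "l < k" "r = qbr (inverse q) (xgen k i) (xgen l i)"
    by blast
  moreover from this have "r = rtt q l k i i" by (simp add: rtt_def swap_coeff_def qbr_def)
  ultimately show ?thesis by blast
next
  assume "r \<in> {qbr 1 (xgen k i) (xgen l j) |k l i j.
    k \<in> idx n \<and> l \<in> idx n \<and> i \<in> idx n \<and> j \<in> idx n \<and> l < k \<and> i < j}"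
  then obtain k l i j where "k \<in> idx n" "l \<in> idx n" "i \<in> idx n" "j \<in> idx n" "l < k" "i < j"
    "r = qbr 1 (xgen k i) (xgen l j)"
    by blast
  moreover from this have "r = rtt q l k i j" by (simp add: rtt_def swap_coeff_def qbr_def)
  ultimately show ?thesis by blast
next
  assume "r \<in> {qbr 1 (xgen k i) (xgen l j) - scl (inverse q - q) (xgen l i * xgen k j) |k l i j.
    k \<in> idx n \<and> l \<in> idx n \<and> i \<in> idx n \<and> j \<in> idx n \<and> l < k \<and> j < i}"
  then obtain k l i j where "k \<in> idx n" "l \<in> idx n" "i \<in> idx n" "j \<in> idx n" "l < k" "j < i"
    "r = qbr 1 (xgen k i) (xgen l j) - scl (inverse q - q) (xgen l i * xgen k j)"
    by blast
  moreover from this have "r = rtt q l k i j" by (simp add: rtt_def swap_coeff_def qbr_def)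
  ultimately show ?thesis by blast
qed

lemma lin_form_rtt:
  "lin_form h (Poly_Mapping.single (FMon u) 1 * rtt q a b i j * Poly_Mapping.single (FMon v) 1) =
    ((if a \<noteq> b then h (FMon (u @ (b, i) # (a, j) # v)) else 0) + swap_coeff q a b * h (FMon (u @ (a, i) # (b, j) # v))) -
    ((if i \<noteq> j then h (FMon (u @ (a, j) # (b, i) # v)) else 0) + swap_coeff q i j * h (FMon (u @ (a, i) # (b, j) # v)))"
  by (simp add: rtt_def gen_def mult_single FMon_plus distrib_left distrib_right left_diff_distrib
      right_diff_distrib lin_form_diff lin_form_add)

section \<open>Matrices of forms commute with the type A generators\<close>

lemma multi_idx_append:
  "\<alpha> @ \<beta> \<in> multi_idx n d \<longleftrightarrow> length \<alpha> + length \<beta> = d \<and> set \<alpha> \<subseteq> idx n \<and> set \<beta> \<subseteq> idx n"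
  by (auto simp: multi_idx_def)

lemma intertwines_cong:
  assumes "\<And>\<nu> \<mu>. \<nu> \<in> multi_idx n d \<Longrightarrow> \<mu> \<in> multi_idx n d \<Longrightarrow> F \<nu> \<mu> = G \<nu> \<mu>" and "t < d"
  shows "intertwines Q q t (multi_idx n d) F \<longleftrightarrow> intertwines Q q t (multi_idx n d) G"
  unfolding intertwines_def using assms by (intro ball_cong refl) (simp add: s_act_multi_idx)

text \<open>The entry at \<open>(\<kappa>, \<mu>)\<close> of \<open>T\<^sub>t X - X T\<^sub>t\<close>, where \<open>X\<close> is the matrix of the monomials \<open>x\<^sub>\<nu>\<^sub>\<mu>\<close>. It
  measures how far \<open>v\<^sub>\<mu> \<mapsto> \<Sum>\<^sub>\<nu> v\<^sub>\<nu> \<otimes> x\<^sub>\<nu>\<^sub>\<mu>\<close> is from commuting with \<open>T\<^sub>t\<close>.\<close>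

definition tau_defect :: "'k::field \<Rightarrow> 'k \<Rightarrow> nat \<Rightarrow> int list \<Rightarrow> int list \<Rightarrow> ((int \<times> int) fmon \<Rightarrow>\<^sub>0 'k)"
  where "tau_defect Q q t \<kappa> \<mu> =
    ((if s_act \<kappa> t \<noteq> \<kappa> then xmon (s_act \<kappa> t) \<mu> else 0) + scl (T_diag Q q t \<kappa>) (xmon \<kappa> \<mu>)) -
    ((if s_act \<mu> t \<noteq> \<mu> then xmon \<kappa> (s_act \<mu> t) else 0) + scl (T_diag Q q t \<mu>) (xmon \<kappa> \<mu>))"

lemma tau_defect_xpart:
  assumes "\<kappa> \<in> multi_idx n d" "\<mu> \<in> multi_idx n d" "t < d"
  shows "tau_defect Q q t \<kappa> \<mu> \<in> xpart n d"
  using assms by (auto simp: tau_defect_def xmon_xpart s_act_multi_idx intro!: xpart_closed)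

lemma intertwines_iff_form:
  assumes \<phi>: "\<phi> \<in> dual_space (qmat_part n q d)" and t: "t < d"
  shows "intertwines Q q' t (multi_idx n d) (form_matrix n q \<phi>) \<longleftrightarrow>
    (\<forall>\<kappa>\<in>multi_idx n d. \<forall>\<mu>\<in>multi_idx n d. \<phi> (qcls n q (tau_defect Q q' t \<kappa> \<mu>)) = 0)"
proof -
  have "\<phi> (qcls n q (tau_defect Q q' t \<kappa> \<mu>)) =
      ((if s_act \<kappa> t \<noteq> \<kappa> then form_matrix n q \<phi> (s_act \<kappa> t) \<mu> else 0) +
        T_diag Q q' t \<kappa> * form_matrix n q \<phi> \<kappa> \<mu>) -
      ((if s_act \<mu> t \<noteq> \<mu> then form_matrix n q \<phi> \<kappa> (s_act \<mu> t) else 0) +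
        T_diag Q q' t \<mu> * form_matrix n q \<phi> \<kappa> \<mu>)"
    if "\<kappa> \<in> multi_idx n d" "\<mu> \<in> multi_idx n d" for \<kappa> \<mu>
  proof -
    have len: "length \<kappa> = d" "length \<mu> = d" using that by (auto simp: multi_idx_def)
    show ?thesis
      unfolding form_eq_ev[OF \<phi> tau_defect_xpart[OF that t]]
      by (simp add: tau_defect_def lin_form_diff lin_form_add lin_form_scl lin_form_entry_xmon len)
  qed
  then show ?thesis unfolding intertwines_def by simp
qed

lemma two_letters:
  assumes "length \<kappa> = d" "Suc t < d"
  obtains \<alpha> a b \<beta> where "\<kappa> = \<alpha> @ a # b # \<beta>" "length \<alpha> = t"
proof -
  have "\<kappa> = take t \<kappa> @ \<kappa> ! t # \<kappa> ! Suc t # drop (Suc (Suc t)) \<kappa>"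
    using assms by (simp add: Cons_nth_drop_Suc)
  then show ?thesis using that[of "take t \<kappa>" "\<kappa> ! t" "\<kappa> ! Suc t" "drop (Suc (Suc t)) \<kappa>"] assms by simp
qed

text \<open>\<open>T\<^sub>t\<close> with \<open>t \<ge> 1\<close> only affects two neighbouring places, so the remaining factors of the monomials
  split off on both sides.\<close>

lemma tau_defect_rtt:
  assumes "length \<alpha> = t" "length \<gamma> = t" "length \<beta> = length \<delta>"
  shows "tau_defect Q q (Suc t) (\<alpha> @ a # b # \<beta>) (\<gamma> @ i # j # \<delta>) =
    xmon \<alpha> \<gamma> * rtt q a b i j * xmon \<beta> \<delta>"
  using assms
  by (simp add: tau_defect_def rtt_def s_act_append T_diag_append xmon_eq_single mult_single gen_def
      distrib_left distrib_right left_diff_distrib right_diff_distrib FMon_plus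
      flip: zero_fmon_def)

lemma form_matrix_intertwines:
  assumes \<phi>: "\<phi> \<in> dual_space (qmat_part n q d)" and q: "q \<noteq> 0" and t: "1 \<le> t" "t < d"
  shows "intertwines Q q t (multi_idx n d) (form_matrix n q \<phi>)"
  unfolding intertwines_iff_form[OF \<phi> t(2)]
proof (intro ballI)
  fix \<kappa> \<mu> assume \<kappa>\<mu>: "\<kappa> \<in> multi_idx n d" "\<mu> \<in> multi_idx n d"
  obtain s where s: "t = Suc s" using t by (cases t) auto
  have len: "length \<kappa> = d" "length \<mu> = d" using \<kappa>\<mu> by (auto simp: multi_idx_def)
  obtain \<alpha> a b \<beta> where \<kappa>: "\<kappa> = \<alpha> @ a # b # \<beta>" "length \<alpha> = s" using two_letters len(1) t(2) s by metis
  obtain \<gamma> i j \<delta> where \<mu>: "\<mu> = \<gamma> @ i # j # \<delta>" "length \<gamma> = s" using two_letters len(2) t(2) s by metis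
  have len': "length \<beta> = length \<delta>" using len \<kappa> \<mu> by simp
  have in_idx: "set \<alpha> \<subseteq> idx n" "a \<in> idx n" "b \<in> idx n" "set \<beta> \<subseteq> idx n"
    "set \<gamma> \<subseteq> idx n" "i \<in> idx n" "j \<in> idx n" "set \<delta> \<subseteq> idx n"
    using \<kappa>\<mu> unfolding \<kappa> \<mu> by (auto simp: multi_idx_append)
  have "xmon \<alpha> \<gamma> \<in> carrier (xfree n)" "xmon \<beta> \<delta> \<in> carrier (xfree n)"
    using in_idx by (auto simp: xmon_eq_single carrier_free_alg dest: set_zip_leftD set_zip_rightD)
  then have "tau_defect Q q t \<kappa> \<mu> \<in> qmat_ideal n q"
    unfolding s \<kappa> \<mu> tau_defect_rtt[OF \<kappa>(2) \<mu>(2) len']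
    using in_idx q by (intro qmat_ideal_closed rtt_in_ideal)
  then have "qcls n q (tau_defect Q q t \<kappa> \<mu>) = qcls n q 0"
    using xpart_xfree[OF tau_defect_xpart[OF \<kappa>\<mu> t(2)]] xpart_xfree[OF xpart_closed(1)]
    by (subst qcls_eq) auto
  then show "\<phi> (qcls n q (tau_defect Q q t \<kappa> \<mu>)) = 0"
    using dual_space_linear(3)[OF \<phi>] by simp
qed

section \<open>Matrices commuting with the type A generators define forms\<close>

definition matrix_form :: "nat \<Rightarrow> 'k::field \<Rightarrow> nat \<Rightarrow> (int list \<Rightarrow> int list \<Rightarrow> 'k) \<Rightarrow>
      ((int \<times> int) fmon \<Rightarrow>\<^sub>0 'k) set \<Rightarrow> 'k"
  where "matrix_form n q d F = descend n q d (lin_form (entry F))"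

text \<open>The elements \<open>f\<close> such that the form vanishes on all products \<open>u f v\<close> with monomials \<open>u\<close>, \<open>v\<close> make up a
  two-sided ideal. It contains the relations: on \<open>u r v\<close> with \<open>r\<close> an entry of the commutation equation
  in degree two, the form takes as value the difference of the two sides of the commutation of \<open>F\<close>
  with \<open>T\<^sub>t\<close>, where \<open>t - 1\<close> is the length of \<open>u\<close>.\<close>

lemma ideal_vanishing:
  assumes F: "\<And>t. 1 \<le> t \<Longrightarrow> t < d \<Longrightarrow> intertwines Q q t (multi_idx n d) F"
    and f: "f \<in> qmat_ideal n q" "f \<in> xpart n d"
  shows "lin_form (entry F) f = 0"
proof -
  \<comment> \<open>extended by zero to all degrees, in order to have a form on the whole free algebra\<close>
  define h where "h w = (if w \<in> words (idx n \<times> idx n) d then entry F w else 0)" for w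
  define G where "G = {w :: (int \<times> int) fmon. set (letters w) \<subseteq> idx n \<times> idx n}"
  define A where "A = {f \<in> carrier (xfree n). \<forall>u\<in>G. \<forall>v\<in>G.
    lin_form h (Poly_Mapping.single u 1 * f * Poly_Mapping.single v 1) = 0}"
  have G_plus: "u + v \<in> G" if "u \<in> G" "v \<in> G" for u v using that by (auto simp: G_def)
  have "ideal A (xfree n)"
  proof (rule ideal_of_free_alg)
    show "f + g \<in> A" if "f \<in> A" "g \<in> A" for f g
      using that by (auto simp: A_def free_alg_closed distrib_left distrib_right lin_form_add)
    show "g * f \<in> A" if f: "f \<in> A" and g: "g \<in> carrier (xfree n)" for f g
    proof -
      have "lin_form h (Poly_Mapping.single u 1 * (g * f) * Poly_Mapping.single v 1) = 0" if uv: "u \<in> G" "v \<in> G" for u v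
      proof -
        have "Poly_Mapping.keys g \<subseteq> G" using g by (auto simp: carrier_free_alg G_def)
        then show ?thesis
        proof (induction rule: monomial_induct)
          case (monomial w c)
          have "Poly_Mapping.single u 1 * (Poly_Mapping.single w c * f) * Poly_Mapping.single v 1 =
              scl c (Poly_Mapping.single (u + w) 1 * f * Poly_Mapping.single v 1)"
            by (simp add: scl_def mult_single flip: mult.assoc)
          then show ?case using f G_plus[OF uv(1) monomial] uv by (simp add: lin_form_scl A_def)
        qed (simp_all add: lin_form_add distrib_left distrib_right)
      qed
      then show ?thesis using f g by (auto simp: A_def free_alg_closed)
    qed
    show "f * g \<in> A" if f: "f \<in> A" and g: "g \<in> carrier (xfree n)" for f g
    proof -
      have "lin_form h (Poly_Mapping.single u 1 * (f * g) * Poly_Mapping.single v 1) = 0" if uv: "u \<in> G" "v \<in> G" for u v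
      proof -
        have "Poly_Mapping.keys g \<subseteq> G" using g by (auto simp: carrier_free_alg G_def)
        then show ?thesis
        proof (induction rule: monomial_induct)
          case (monomial w c)
          have "Poly_Mapping.single u 1 * (f * Poly_Mapping.single w c) * Poly_Mapping.single v 1 =
              scl c (Poly_Mapping.single u 1 * f * Poly_Mapping.single (w + v) 1)"
            by (simp add: mult_single mult.assoc flip: scl_mult_right)
          then show ?case using f G_plus[OF monomial uv(2)] uv by (simp add: lin_form_scl A_def)
        qed (simp_all add: lin_form_add distrib_left distrib_right)
      qed
      then show ?thesis using f g by (auto simp: A_def free_alg_closed)
    qed
  qed (auto simp: A_def carrier_free_alg)
  moreover have "qmat_rels n q \<subseteq> A"
  proof
    fix r assume r: "r \<in> qmat_rels n q"
    then obtain a b i j where ab: "a \<in> idx n" "b \<in> idx n" "i \<in> idx n" "j \<in> idx n"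
      and r_eq: "r = rtt q a b i j \<or> r = - rtt q a b i j" using qmat_rels_rtt by blast
    have "lin_form h (Poly_Mapping.single u 1 * rtt q a b i j * Poly_Mapping.single v 1) = 0"
      if uv: "u \<in> G" "v \<in> G" for u v
    proof -
      obtain us vs where uv_eq: "u = FMon us" "v = FMon vs" by (cases u; cases v)
      let ?t = "length us" and ?\<alpha> = "map fst us" and ?\<gamma> = "map snd us" and ?\<beta> = "map fst vs" and ?\<delta> = "map snd vs"
      have in_idx: "set ?\<alpha> \<subseteq> idx n" "set ?\<beta> \<subseteq> idx n" "set ?\<gamma> \<subseteq> idx n" "set ?\<delta> \<subseteq> idx n"
        using uv by (auto simp: G_def uv_eq)
      show ?thesis
      proof (cases "length us + 2 + length vs = d")
        case True
        then have word: "FMon (us @ p1 # p2 # vs) \<in> words (idx n \<times> idx n) d"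
          if "p1 \<in> idx n \<times> idx n" "p2 \<in> idx n \<times> idx n" for p1 p2
          using uv that by (auto simp: words_def G_def uv_eq)
        have mem: "?\<alpha> @ a # b # ?\<beta> \<in> multi_idx n d" "?\<gamma> @ i # j # ?\<delta> \<in> multi_idx n d"
          using True in_idx ab by (auto simp: multi_idx_append)
        have "intertwines Q q (Suc ?t) (multi_idx n d) F" using F[of "Suc ?t"] True by simp
        from bspec[OF bspec[OF this[unfolded intertwines_def] mem(1)] mem(2)] show ?thesis
          using ab by (cases "a = b"; cases "i = j")
            (simp_all add: uv_eq lin_form_rtt h_def word entry_def s_act_append T_diag_append)
      next
        case False
        then have "FMon (us @ p1 # p2 # vs) \<notin> words (idx n \<times> idx n) d" for p1 p2
          by (auto simp: words_def)
        then show ?thesis by (simp add: uv_eq lin_form_rtt h_def)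
      qed
    qed
    moreover have "lin_form h (- g) = - lin_form h g" for g using lin_form_scl[of h "- 1" g] by (simp add: scl_minus)
    ultimately show "r \<in> A" using subsetD[OF qmat_rels_subset r] r_eq by (auto simp: A_def)
  qed
  ultimately have "qmat_ideal n q \<subseteq> A"
    unfolding qmat_ideal_def by (rule ring.genideal_minimal[OF free_alg_ring])
  moreover have "0 \<in> G" by (simp add: G_def)
  ultimately have "lin_form h f = 0" using f(1) by (force simp: A_def)
  moreover have "lin_form h f = lin_form (entry F) f"
    using f(2) by (intro lin_form_cong) (auto simp: h_def carrier_free_part)
  ultimately show ?thesis by simp
qed

text \<open>The homogeneous representatives of a class differ by elements of the ideal in degree \<open>d\<close>, on
  which the form vanishes.\<close>

lemma descend_qcls:
  assumes F: "\<And>t. 1 \<le> t \<Longrightarrow> t < d \<Longrightarrow> intertwines Q q t (multi_idx n d) F"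
    and g: "\<And>f. f \<in> xpart n d \<Longrightarrow> g f = lin_form (entry F) f"
    and f: "f \<in> xpart n d"
  shows "descend n q d g (qcls n q f) = lin_form (entry F) f"
proof -
  interpret I: ideal "qmat_ideal n q" "xfree n" by (rule qmat_ideal_ideal)
  have "g f' = lin_form (entry F) f" if f': "f' \<in> qcls n q f" "f' \<in> xpart n d" for f'
  proof -
    have "qcls n q f' = qcls n q f"
      using I.a_repr_independence[OF f'(1) xpart_xfree[OF f] I.a_subgroup] by simp
    then have "f' - f \<in> qmat_ideal n q" using f f' by (simp add: qcls_eq xpart_xfree)
    then show ?thesis
      using ideal_vanishing[OF F _ xpart_closed(3)[OF f'(2) f]] by (simp add: g f'(2) lin_form_diff)
  qed
  moreover have "f \<in> qcls n q f" using I.a_rcos_self xpart_xfree[OF f] by blast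
  ultimately have "g ` (qcls n q f \<inter> xpart n d) = {lin_form (entry F) f}" using f by auto
  then show ?thesis using f by (simp add: descend_def qmat_part_sel)
qed

lemma descend_eq_matrix_form:
  assumes F: "\<And>t. 1 \<le> t \<Longrightarrow> t < d \<Longrightarrow> intertwines Q q t (multi_idx n d) F"
    and g: "\<And>f. f \<in> xpart n d \<Longrightarrow> g f = lin_form (entry F) f"
  shows "descend n q d g = matrix_form n q d F"
proof (rule extensionalityI[of _ "carrier (qmat_part n q d)"])
  fix c assume "c \<in> carrier (qmat_part n q d)"
  then show "descend n q d g c = matrix_form n q d F c"
    by (auto simp: qmat_part_sel matrix_form_def descend_qcls[OF F] g)
qed (simp_all add: matrix_form_def descend_def)

lemma matrix_form_dual:
  assumes F: "\<And>t. 1 \<le> t \<Longrightarrow> t < d \<Longrightarrow> intertwines Q q t (multi_idx n d) F"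
  shows "matrix_form n q d F \<in> dual_space (qmat_part n q d)"
proof -
  have "matrix_form n q d F (qcls n q f) = lin_form (entry F) f" if "f \<in> xpart n d" for f
    unfolding matrix_form_def by (rule descend_qcls[OF F _ that]) simp_all
  moreover have "matrix_form n q d F \<in> extensional (carrier (qmat_part n q d))"
    by (simp add: matrix_form_def descend_def)
  ultimately show ?thesis
    unfolding dual_space_def by (auto simp: qmat_part_sel xpart_closed lin_form_add lin_form_scl)
qed

lemma form_matrix_matrix_form:
  assumes F: "\<And>t. 1 \<le> t \<Longrightarrow> t < d \<Longrightarrow> intertwines Q q t (multi_idx n d) F"
    and "\<nu> \<in> multi_idx n d" "\<mu> \<in> multi_idx n d"
  shows "form_matrix n q (matrix_form n q d F) \<nu> \<mu> = F \<nu> \<mu>"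
proof -
  have "length \<nu> = length \<mu>" using assms by (simp add: multi_idx_def)
  then show ?thesis
    unfolding form_matrix_def matrix_form_def using assms(2,3)
    by (subst descend_qcls[OF F]) (simp_all add: lin_form_entry_xmon xmon_xpart)
qed

section \<open>The type B coideal\<close>

lemma lookup_T_op_bvec:
  assumes "\<nu> \<in> multi_idx n d" "\<kappa> \<in> multi_idx n d" "t < d"
  shows "Poly_Mapping.lookup (T_op Q q t (bvec \<nu>)) (FMon \<kappa>) =
    (if s_act \<kappa> t \<noteq> \<kappa> \<and> \<nu> = s_act \<kappa> t then 1 else 0) + (if \<nu> = \<kappa> then T_diag Q q t \<kappa> else 0)"
  using assms by (subst lookup_T_op) (auto simp: multi_idx_def bvec_def lookup_single when_def)

lemma sum_T_row:
  fixes X :: "int list \<Rightarrow> ('m::monoid_add \<Rightarrow>\<^sub>0 'k::field)"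
  assumes "\<kappa> \<in> multi_idx n d" "t < d"
  shows "(\<Sum>\<nu>\<in>multi_idx n d. scl (Poly_Mapping.lookup (T_op Q q t (bvec \<nu>)) (FMon \<kappa>)) (X \<nu>)) =
    (if s_act \<kappa> t \<noteq> \<kappa> then X (s_act \<kappa> t) else 0) + scl (T_diag Q q t \<kappa>) (X \<kappa>)"
proof -
  have "(\<Sum>\<nu>\<in>multi_idx n d. scl (Poly_Mapping.lookup (T_op Q q t (bvec \<nu>)) (FMon \<kappa>)) (X \<nu>)) =
      (\<Sum>\<nu>\<in>multi_idx n d. (if \<nu> = s_act \<kappa> t then if s_act \<kappa> t \<noteq> \<kappa> then X \<nu> else 0 else 0) +
        (if \<nu> = \<kappa> then scl (T_diag Q q t \<kappa>) (X \<nu>) else 0))"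
    using assms by (intro sum.cong refl) (simp add: lookup_T_op_bvec scl_add_left)
  then show ?thesis using assms s_act_multi_idx by (simp add: sum.distrib)
qed

lemma sum_T_column:
  fixes X :: "int list \<Rightarrow> ('m::monoid_add \<Rightarrow>\<^sub>0 'k::field)"
  assumes "\<mu> \<in> multi_idx n d" "t < d"
  shows "(\<Sum>\<nu>\<in>multi_idx n d. scl (Poly_Mapping.lookup (T_op Q q t (bvec \<mu>)) (FMon \<nu>)) (X \<nu>)) =
    (if s_act \<mu> t \<noteq> \<mu> then X (s_act \<mu> t) else 0) + scl (T_diag Q q t \<mu>) (X \<mu>)"
proof -
  have "Poly_Mapping.lookup (T_op Q q t (bvec \<mu>)) (FMon \<nu>) = Poly_Mapping.lookup (T_op Q q t (bvec \<nu>)) (FMon \<mu>)"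
    if "\<nu> \<in> multi_idx n d" for \<nu>
  proof -
    have "s_act \<nu> t = \<mu> \<longleftrightarrow> \<nu> = s_act \<mu> t"
      using s_act_s_act that assms by (metis (mono_tags, lifting) mem_Collect_eq multi_idx_def)
    then show ?thesis using that assms by (auto simp: lookup_T_op_bvec)
  qed
  then show ?thesis using sum_T_row[OF assms, of Q q X] by simp
qed

text \<open>Both sides of the equation are cosets of explicit elements, whose difference is the defect at
  \<open>t = 0\<close>.\<close>

lemma JB_condition:
  fixes q Q :: "'k::field"
  assumes J: "submodule J ground_field (qmat_part n q d)" and d: "0 < d"
  shows "(\<forall>\<mu>\<in>multi_idx n d. T0_tensor n d Q q (quot_alg (qmat_part n q d) J) (tau n q d J (bvec \<mu>)) =
      tau n q d J (T_op Q q 0 (bvec \<mu>))) \<longleftrightarrow>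
    (\<forall>\<kappa>\<in>multi_idx n d. \<forall>\<mu>\<in>multi_idx n d. qcls n q (tau_defect Q q 0 \<kappa> \<mu>) \<in> J)"
proof -
  let ?P = "qmat_part n q d" and ?N = "multi_idx n d"
  let ?W = "quot_alg ?P J"
  define k where "k f = J +>\<^bsub>?P\<^esub> qcls n q f" for f
  note PM = qmat_part_module[of n q d]
  interpret P: module ground_field ?P by (rule PM)
  have k: "k f \<in> carrier ?W" "k (scl c f) = c \<odot>\<^bsub>?W\<^esub> k f" if "f \<in> xpart n d" for f c
    using that quot_smult[OF PM J, of c "qcls n q f"] by (simp_all add: k_def qmat_part_sel)
  have k_zero: "k 0 = \<zero>\<^bsub>?W\<^esub>"
    using quot_zero[OF PM J] by (simp add: k_def qmat_part_sel)
  have k_add: "k (f + g) = k f \<oplus>\<^bsub>?W\<^esub> k g" if "f \<in> xpart n d" "g \<in> xpart n d" for f g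
    using that quot_add[OF PM J, of "qcls n q f" "qcls n q g"] by (simp add: k_def qmat_part_sel)
  have k_eq: "k f = k g \<longleftrightarrow> qcls n q (f - g) \<in> J" if fg: "f \<in> xpart n d" "g \<in> xpart n d" for f g
  proof -
    have "\<ominus>\<^bsub>?P\<^esub> qcls n q g = qcls n q (- g)"
      using fg by (intro P.minus_equality) (auto simp: qmat_part_sel xpart_closed)
    then have "qcls n q f \<ominus>\<^bsub>?P\<^esub> qcls n q g = qcls n q (f - g)"
      using fg by (simp add: a_minus_def qmat_part_sel xpart_closed)
    then show ?thesis
      using quot_eq[OF PM J, of "qcls n q f" "qcls n q g"] fg by (simp add: k_def qmat_part_sel)
  qed
  have fs: "(\<Oplus>\<^bsub>?W\<^esub>a\<in>?N. c a \<odot>\<^bsub>?W\<^esub> k (h a)) = k (\<Sum>a\<in>?N. scl (c a) (h a))"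
    if "\<And>a. a \<in> ?N \<Longrightarrow> h a \<in> xpart n d" for c h
    by (rule finsum_linear_image[OF quot_module[OF PM J], of "xpart n d"])
      (use that xpart_closed in \<open>simp_all only: k k_zero k_add finite_multi_idx\<close>)
  interpret W: module ground_field ?W by (rule quot_module[OF PM J])
  have tau: "tau n q d J v \<nu> = k (\<Sum>\<mu>\<in>?N. scl (Poly_Mapping.lookup v (FMon \<mu>)) (xmon \<nu> \<mu>))"
    if "\<nu> \<in> ?N" for v \<nu>
    using that fs[of "\<lambda>\<mu>. xmon \<nu> \<mu>"] by (simp add: tau_def k_def xmon_xpart)
  have tau_bvec: "tau n q d J (bvec \<mu>) \<nu> = k (xmon \<nu> \<mu>)" if "\<nu> \<in> ?N" "\<mu> \<in> ?N" for \<nu> \<mu>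
  proof -
    have "(\<Sum>\<mu>'\<in>?N. scl (Poly_Mapping.lookup (bvec \<mu>) (FMon \<mu>')) (xmon \<nu> \<mu>')) =
        (\<Sum>\<mu>'\<in>?N. if \<mu>' = \<mu> then xmon \<nu> \<mu>' else (0 :: (int \<times> int) fmon \<Rightarrow>\<^sub>0 'k))"
      by (intro sum.cong refl) (simp add: bvec_def lookup_single when_def)
    then show ?thesis using that by (simp add: tau)
  qed
  have rhs: "tau n q d J (T_op Q q 0 (bvec \<mu>)) \<kappa> =
      k ((if s_act \<mu> 0 \<noteq> \<mu> then xmon \<kappa> (s_act \<mu> 0) else 0) + scl (T_diag Q q 0 \<mu>) (xmon \<kappa> \<mu>))"
    if "\<kappa> \<in> ?N" "\<mu> \<in> ?N" for \<kappa> \<mu>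
    using that d by (simp only: tau sum_T_column)
  have lhs: "T0_tensor n d Q q ?W (tau n q d J (bvec \<mu>)) \<kappa> =
      k ((if s_act \<kappa> 0 \<noteq> \<kappa> then xmon (s_act \<kappa> 0) \<mu> else 0) + scl (T_diag Q q 0 \<kappa>) (xmon \<kappa> \<mu>))"
    if "\<kappa> \<in> ?N" "\<mu> \<in> ?N" for \<kappa> \<mu>
  proof -
    have "T0_tensor n d Q q ?W (tau n q d J (bvec \<mu>)) \<kappa> =
        (\<Oplus>\<^bsub>?W\<^esub>\<nu>\<in>?N. Poly_Mapping.lookup (T_op Q q 0 (bvec \<nu>)) (FMon \<kappa>) \<odot>\<^bsub>?W\<^esub> tau n q d J (bvec \<mu>) \<nu>)"
      using that by (simp add: T0_tensor_def)
    also have "\<dots> = (\<Oplus>\<^bsub>?W\<^esub>\<nu>\<in>?N. Poly_Mapping.lookup (T_op Q q 0 (bvec \<nu>)) (FMon \<kappa>) \<odot>\<^bsub>?W\<^esub> k (xmon \<nu> \<mu>))"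
      using that by (intro W.finsum_cong') (auto simp: tau_bvec xmon_xpart simp del: quot_alg_sel intro!: W.smult_closed k(1))
    also have "\<dots> = k (\<Sum>\<nu>\<in>?N. scl (Poly_Mapping.lookup (T_op Q q 0 (bvec \<nu>)) (FMon \<kappa>)) (xmon \<nu> \<mu>))"
      using that by (intro fs) (simp add: xmon_xpart)
    also have "\<dots> = k ((if s_act \<kappa> 0 \<noteq> \<kappa> then xmon (s_act \<kappa> 0) \<mu> else 0) + scl (T_diag Q q 0 \<kappa>) (xmon \<kappa> \<mu>))"
      using that d by (simp only: sum_T_row)
    finally show ?thesis .
  qed
  have ext: "T0_tensor n d Q q ?W z = tau n q d J v \<longleftrightarrow>
      (\<forall>\<kappa>\<in>?N. T0_tensor n d Q q ?W z \<kappa> = tau n q d J v \<kappa>)" for z v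
  proof -
    have "T0_tensor n d Q q ?W z \<in> extensional ?N" "tau n q d J v \<in> extensional ?N"
      by (simp_all add: T0_tensor_def tau_def)
    then show ?thesis using extensionalityI by metis
  qed
  have "(\<forall>\<mu>\<in>?N. T0_tensor n d Q q ?W (tau n q d J (bvec \<mu>)) = tau n q d J (T_op Q q 0 (bvec \<mu>))) \<longleftrightarrow>
      (\<forall>\<mu>\<in>?N. \<forall>\<kappa>\<in>?N. qcls n q (tau_defect Q q 0 \<kappa> \<mu>) \<in> J)"
    unfolding ext
  proof (intro ball_cong refl)
    fix \<mu> \<kappa> assume \<mu>: "\<mu> \<in> ?N" and \<kappa>: "\<kappa> \<in> ?N"
    show "(T0_tensor n d Q q ?W (tau n q d J (bvec \<mu>)) \<kappa> = tau n q d J (T_op Q q 0 (bvec \<mu>)) \<kappa>) =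
        (qcls n q (tau_defect Q q 0 \<kappa> \<mu>) \<in> J)"
      unfolding lhs[OF \<kappa> \<mu>] rhs[OF \<kappa> \<mu>] tau_defect_def using d \<kappa> \<mu>
      by (intro k_eq) (auto simp: xmon_xpart s_act_multi_idx intro!: xpart_closed)
  qed
  then show ?thesis by blast
qed

text \<open>The defects lie in every subspace of the intersection defining \<^const>\<open>JB\<close>. Conversely, if \<open>\<phi>\<close> kills
  them, the kernel of \<open>\<phi>\<close> is one of these subspaces.\<close>

lemma vanishes_on_JB_iff:
  fixes q Q :: "'k::field"
  assumes \<phi>: "\<phi> \<in> dual_space (qmat_part n q d)" and d: "0 < d"
  shows "(\<forall>c\<in>JB n d Q q. \<phi> c = 0) \<longleftrightarrow> intertwines Q q 0 (multi_idx n d) (form_matrix n q \<phi>)"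
proof
  assume L: "\<forall>c\<in>JB n d Q q. \<phi> c = 0"
  have "qcls n q (tau_defect Q q 0 \<kappa> \<mu>) \<in> JB n d Q q" if "\<kappa> \<in> multi_idx n d" "\<mu> \<in> multi_idx n d" for \<kappa> \<mu>
    unfolding JB_def using JB_condition[OF _ d] that by blast
  then show "intertwines Q q 0 (multi_idx n d) (form_matrix n q \<phi>)"
    using L intertwines_iff_form[OF \<phi> d] by blast
next
  assume R: "intertwines Q q 0 (multi_idx n d) (form_matrix n q \<phi>)"
  define J where "J = {c \<in> carrier (qmat_part n q d). \<phi> c = 0}"
  note PM = qmat_part_module[of n q d]
  interpret P: module ground_field "qmat_part n q d" by (rule PM)
  have lin: "\<phi> (x \<oplus>\<^bsub>qmat_part n q d\<^esub> y) = \<phi> x + \<phi> y" "\<phi> (c \<odot>\<^bsub>qmat_part n q d\<^esub> x) = c * \<phi> x"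
    if "x \<in> carrier (qmat_part n q d)" "y \<in> carrier (qmat_part n q d)" for x y c
    using \<phi> that by (auto simp: dual_space_def)
  have zero: "\<phi> \<zero>\<^bsub>qmat_part n q d\<^esub> = 0" using dual_space_linear(3)[OF \<phi>] by (simp add: qmat_part_sel)
  have "submodule J ground_field (qmat_part n q d)"
  proof (rule P.submoduleI)
    show "\<ominus>\<^bsub>qmat_part n q d\<^esub> x \<in> J" if "x \<in> J" for x
      using that lin(1)[of "\<ominus>\<^bsub>qmat_part n q d\<^esub> x" x] zero by (simp add: J_def P.l_neg)
  qed (use zero lin in \<open>auto simp: J_def\<close>)
  moreover have "qcls n q (tau_defect Q q 0 \<kappa> \<mu>) \<in> J" if "\<kappa> \<in> multi_idx n d" "\<mu> \<in> multi_idx n d" for \<kappa> \<mu>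
    using that R unfolding intertwines_iff_form[OF \<phi> d]
    by (simp add: J_def qmat_part_sel imageI tau_defect_xpart[OF _ _ d])
  ultimately have "JB n d Q q \<subseteq> J"
    unfolding JB_def using JB_condition[of J n q d Q] d by blast
  then show "\<forall>c\<in>JB n d Q q. \<phi> c = 0" by (auto simp: J_def)
qed

section \<open>Convolution is matrix multiplication\<close>

lemma multi_idx_Suc: "multi_idx n (Suc m) = (\<lambda>(k, \<kappa>). k # \<kappa>) ` (idx n \<times> multi_idx n m)"
proof -
  have "\<mu> \<in> (\<lambda>(k, \<kappa>). k # \<kappa>) ` (idx n \<times> multi_idx n m)" if "\<mu> \<in> multi_idx n (Suc m)" for \<mu>
    using that by (cases \<mu>) (auto simp: multi_idx_def)
  then show ?thesis by (auto simp: multi_idx_def)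
qed

lemma Delta_word:
  "prod_list (map (\<lambda>(i, j). \<Sum>k\<in>idx n. Poly_Mapping.single (FMon [(i, k)], FMon [(k, j)]) 1) l) =
    (\<Sum>\<kappa>\<in>multi_idx n (length l).
      Poly_Mapping.single (FMon (zip (map fst l) \<kappa>), FMon (zip \<kappa> (map snd l))) (1::'k::field))"
proof (induction l)
  case Nil
  have "multi_idx n 0 = {[]}" by (auto simp: multi_idx_def)
  then show ?case by (simp flip: zero_fmon_def zero_prod_def)
next
  case (Cons p l)
  obtain i j where p: "p = (i, j)" by (cases p)
  have inj: "inj_on (\<lambda>(k, \<kappa>). k # \<kappa>) (idx n \<times> multi_idx n (length l))"
    by (auto simp: inj_on_def)
  have "(\<Sum>\<kappa>\<in>multi_idx n (length (p # l)).
      Poly_Mapping.single (FMon (zip (map fst (p # l)) \<kappa>), FMon (zip \<kappa> (map snd (p # l)))) (1::'k)) =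
    (\<Sum>(k, \<kappa>)\<in>idx n \<times> multi_idx n (length l).
      Poly_Mapping.single (FMon ((i, k) # zip (map fst l) \<kappa>), FMon ((k, j) # zip \<kappa> (map snd l))) 1)"
    unfolding length_Cons multi_idx_Suc sum.reindex[OF inj]
    by (simp add: p case_prod_unfold)
  also have "\<dots> = (\<Sum>k\<in>idx n. \<Sum>\<kappa>\<in>multi_idx n (length l).
      Poly_Mapping.single (FMon [(i, k)], FMon [(k, j)]) 1 *
      Poly_Mapping.single (FMon (zip (map fst l) \<kappa>), FMon (zip \<kappa> (map snd l))) 1)"
    by (simp add: sum.cartesian_product mult_single FMon_plus case_prod_unfold)
  also have "\<dots> = prod_list (map (\<lambda>(i, j). \<Sum>k\<in>idx n. Poly_Mapping.single (FMon [(i, k)], FMon [(k, j)]) 1) (p # l))"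
    using Cons.IH by (simp add: p sum_product)
  finally show ?case ..
qed

definition matrix_mult ::
    "nat \<Rightarrow> nat \<Rightarrow> (int list \<Rightarrow> int list \<Rightarrow> 'k::field) \<Rightarrow> (int list \<Rightarrow> int list \<Rightarrow> 'k) \<Rightarrow> int list \<Rightarrow> int list \<Rightarrow> 'k"
  where "matrix_mult n d F G \<nu> \<mu> = (\<Sum>\<kappa>\<in>multi_idx n d. F \<nu> \<kappa> * G \<kappa> \<mu>)"

lemma tensor_eval_Delta:
  assumes f: "f \<in> xpart n d"
  shows "tensor_eval n q \<phi> \<psi> (Delta n f) =
    lin_form (entry (matrix_mult n d (form_matrix n q \<phi>) (form_matrix n q \<psi>))) f"
proof -
  define e where "e = (\<lambda>(u, w). \<phi> (qcls n q (Poly_Mapping.single u 1)) * \<psi> (qcls n q (Poly_Mapping.single w 1)))"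
  have "tensor_eval n q \<phi> \<psi> (Delta n f) = lin_form e (Delta n f)"
    by (simp add: tensor_eval_def lin_form_def e_def case_prod_unfold mult.assoc)
  also have "\<dots> = lin_form (\<lambda>w. \<Sum>\<kappa>\<in>multi_idx n (length (letters w)).
      e (FMon (zip (map fst (letters w)) \<kappa>), FMon (zip \<kappa> (map snd (letters w))))) f"
    by (simp add: Delta_def lin_form_lin_ext Delta_word lin_form_sum)
  also have "\<dots> = lin_form (entry (matrix_mult n d (form_matrix n q \<phi>) (form_matrix n q \<psi>))) f"
  proof (rule lin_form_cong)
    fix w assume "w \<in> Poly_Mapping.keys f"
    then have "length (letters w) = d" using f by (auto simp: carrier_free_part words_def)
    then show "(\<Sum>\<kappa>\<in>multi_idx n (length (letters w)).
        e (FMon (zip (map fst (letters w)) \<kappa>), FMon (zip \<kappa> (map snd (letters w))))) =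
        entry (matrix_mult n d (form_matrix n q \<phi>) (form_matrix n q \<psi>)) w"
      by (simp add: entry_def matrix_mult_def form_matrix_def e_def xmon_eq_single)
  qed
  finally show ?thesis .
qed

lemma counit_ev: "counit f = lin_form (entry (\<lambda>\<nu> \<mu>. if \<nu> = \<mu> then 1 else 0)) f"
proof -
  have "prod_list (map (\<lambda>(i, j). if i = j then 1 else 0) l) = (if map fst l = map snd l then 1 else (0::'a))" for l :: "(int \<times> int) list"
    by (induction l) auto
  then show ?thesis by (simp add: counit_def lin_form_def entry_def)
qed

lemma intertwines_one:
  assumes "t < d"
  shows "intertwines Q q t (multi_idx n d) (\<lambda>\<nu> \<mu>. if \<nu> = \<mu> then 1 else 0)"
  unfolding intertwines_def
proof (intro ballI)
  fix \<kappa> \<mu> assume "\<kappa> \<in> multi_idx n d" "\<mu> \<in> multi_idx n d"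
  then have "s_act \<kappa> t = \<mu> \<longleftrightarrow> \<kappa> = s_act \<mu> t"
    using s_act_s_act assms by (metis (mono_tags, lifting) mem_Collect_eq multi_idx_def)
  then show "(if s_act \<kappa> t \<noteq> \<kappa> then if s_act \<kappa> t = \<mu> then 1 else 0 else 0) +
      T_diag Q q t \<kappa> * (if \<kappa> = \<mu> then 1 else 0) =
      (if s_act \<mu> t \<noteq> \<mu> then if \<kappa> = s_act \<mu> t then 1 else 0 else 0) +
      T_diag Q q t \<mu> * (if \<kappa> = \<mu> then 1 else 0)"
    by auto
qed

text \<open>\<open>T(FG) = (FT)G = F(TG) = (FG)T\<close>; in the sparse form of \<open>T\<close> the associativity in the middle is a
  reindexing by the involution \<open>s\<^sub>t\<close>.\<close>

lemma intertwines_matrix_mult: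
  assumes t: "t < d"
    and F: "intertwines Q q t (multi_idx n d) F" and G: "intertwines Q q t (multi_idx n d) G"
  shows "intertwines Q q t (multi_idx n d) (matrix_mult n d F G)"
  unfolding intertwines_def
proof (intro ballI)
  let ?N = "multi_idx n d" and ?s = "\<lambda>\<kappa>. s_act \<kappa> t" and ?c = "T_diag Q q t"
  fix \<kappa> \<mu> assume \<kappa>: "\<kappa> \<in> ?N" and \<mu>: "\<mu> \<in> ?N"
  have inv: "?s (?s \<nu>) = \<nu>" "?s \<nu> \<in> ?N" if "\<nu> \<in> ?N" for \<nu>
    using that t s_act_s_act s_act_multi_idx by (auto simp: multi_idx_def)
  \<comment> \<open>the associativity \<open>(F T) G = F (T G)\<close>, off-diagonal part\<close>
  have move: "(\<Sum>\<nu>\<in>?N. (if ?s \<nu> \<noteq> \<nu> then F \<kappa> (?s \<nu>) else 0) * G \<nu> \<mu>) =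
      (\<Sum>\<nu>\<in>?N. F \<kappa> \<nu> * (if ?s \<nu> \<noteq> \<nu> then G (?s \<nu>) \<mu> else 0))"
    by (rule sum.reindex_bij_witness[of _ ?s ?s]) (auto simp: inv)
  have "(if ?s \<kappa> \<noteq> \<kappa> then matrix_mult n d F G (?s \<kappa>) \<mu> else 0) + ?c \<kappa> * matrix_mult n d F G \<kappa> \<mu> =
      (\<Sum>\<nu>\<in>?N. ((if ?s \<kappa> \<noteq> \<kappa> then F (?s \<kappa>) \<nu> else 0) + ?c \<kappa> * F \<kappa> \<nu>) * G \<nu> \<mu>)"
    by (simp add: matrix_mult_def sum_distrib_left distrib_right sum.distrib mult.assoc)
  also have "\<dots> = (\<Sum>\<nu>\<in>?N. ((if ?s \<nu> \<noteq> \<nu> then F \<kappa> (?s \<nu>) else 0) + ?c \<nu> * F \<kappa> \<nu>) * G \<nu> \<mu>)"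
    using F \<kappa> by (intro sum.cong refl) (simp add: intertwines_def)
  also have "\<dots> = (\<Sum>\<nu>\<in>?N. F \<kappa> \<nu> * ((if ?s \<nu> \<noteq> \<nu> then G (?s \<nu>) \<mu> else 0) + ?c \<nu> * G \<nu> \<mu>))"
    by (simp only: distrib_left distrib_right sum.distrib move) (simp add: ac_simps)
  also have "\<dots> = (\<Sum>\<nu>\<in>?N. F \<kappa> \<nu> * ((if ?s \<mu> \<noteq> \<mu> then G \<nu> (?s \<mu>) else 0) + ?c \<mu> * G \<nu> \<mu>))"
    using G \<mu> by (intro sum.cong refl) (simp add: intertwines_def)
  also have "\<dots> = (if ?s \<mu> \<noteq> \<mu> then matrix_mult n d F G \<kappa> (?s \<mu>) else 0) + ?c \<mu> * matrix_mult n d F G \<kappa> \<mu>"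
    by (simp add: matrix_mult_def sum_distrib_left distrib_left sum.distrib ac_simps)
  finally show "(if ?s \<kappa> \<noteq> \<kappa> then matrix_mult n d F G (?s \<kappa>) \<mu> else 0) + ?c \<kappa> * matrix_mult n d F G \<kappa> \<mu> =
      (if ?s \<mu> \<noteq> \<mu> then matrix_mult n d F G \<kappa> (?s \<mu>) else 0) + ?c \<mu> * matrix_mult n d F G \<kappa> \<mu>" .
qed

lemma intertwines_add:
  "intertwines Q q t N F \<Longrightarrow> intertwines Q q t N G \<Longrightarrow> intertwines Q q t N (\<lambda>\<nu> \<mu>. F \<nu> \<mu> + G \<nu> \<mu>)"
  unfolding intertwines_def
proof (intro ballI)
  fix \<kappa> \<mu> assume N: "\<kappa> \<in> N" "\<mu> \<in> N"
    and F: "\<forall>\<kappa>\<in>N. \<forall>\<mu>\<in>N. (if s_act \<kappa> t \<noteq> \<kappa> then F (s_act \<kappa> t) \<mu> else 0) + T_diag Q q t \<kappa> * F \<kappa> \<mu> =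
      (if s_act \<mu> t \<noteq> \<mu> then F \<kappa> (s_act \<mu> t) else 0) + T_diag Q q t \<mu> * F \<kappa> \<mu>"
    and G: "\<forall>\<kappa>\<in>N. \<forall>\<mu>\<in>N. (if s_act \<kappa> t \<noteq> \<kappa> then G (s_act \<kappa> t) \<mu> else 0) + T_diag Q q t \<kappa> * G \<kappa> \<mu> =
      (if s_act \<mu> t \<noteq> \<mu> then G \<kappa> (s_act \<mu> t) else 0) + T_diag Q q t \<mu> * G \<kappa> \<mu>"
  show "(if s_act \<kappa> t \<noteq> \<kappa> then F (s_act \<kappa> t) \<mu> + G (s_act \<kappa> t) \<mu> else 0) + T_diag Q q t \<kappa> * (F \<kappa> \<mu> + G \<kappa> \<mu>) =
      (if s_act \<mu> t \<noteq> \<mu> then F \<kappa> (s_act \<mu> t) + G \<kappa> (s_act \<mu> t) else 0) + T_diag Q q t \<mu> * (F \<kappa> \<mu> + G \<kappa> \<mu>)"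
    using arg_cong2[OF bspec[OF bspec[OF F N(1)] N(2)] bspec[OF bspec[OF G N(1)] N(2)], of "(+)"]
    by (cases "s_act \<kappa> t = \<kappa>"; cases "s_act \<mu> t = \<mu>") (simp_all add: distrib_left ac_simps)
qed

lemma intertwines_scale:
  "intertwines Q q t N F \<Longrightarrow> intertwines Q q t N (\<lambda>\<nu> \<mu>. c * F \<nu> \<mu>)"
  unfolding intertwines_def
proof (intro ballI)
  fix \<kappa> \<mu> assume N: "\<kappa> \<in> N" "\<mu> \<in> N"
    and F: "\<forall>\<kappa>\<in>N. \<forall>\<mu>\<in>N. (if s_act \<kappa> t \<noteq> \<kappa> then F (s_act \<kappa> t) \<mu> else 0) + T_diag Q q t \<kappa> * F \<kappa> \<mu> =
      (if s_act \<mu> t \<noteq> \<mu> then F \<kappa> (s_act \<mu> t) else 0) + T_diag Q q t \<mu> * F \<kappa> \<mu>"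
  show "(if s_act \<kappa> t \<noteq> \<kappa> then c * F (s_act \<kappa> t) \<mu> else 0) + T_diag Q q t \<kappa> * (c * F \<kappa> \<mu>) =
      (if s_act \<mu> t \<noteq> \<mu> then c * F \<kappa> (s_act \<mu> t) else 0) + T_diag Q q t \<mu> * (c * F \<kappa> \<mu>)"
    using arg_cong[OF bspec[OF bspec[OF F N(1)] N(2)], of "(*) c"]
    by (cases "s_act \<kappa> t = \<kappa>"; cases "s_act \<mu> t = \<mu>") (simp_all only: distrib_left if_True if_False simp_thms ac_simps mult_zero_right mult_zero_left add_0_left)
qed

section \<open>The isomorphism\<close>

text \<open>Forms on quantum matrices commute with \<open>T\<^sub>t\<close> for \<open>t \<ge> 1\<close> in any case, so that only \<open>t = 0\<close> is a
  condition.\<close>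

lemma coordB_carrier:
  fixes q Q :: "'k::field"
  assumes q: "q \<noteq> 0" and d: "0 < d"
  shows "\<phi> \<in> carrier (coordB_dual n d Q q) \<longleftrightarrow> \<phi> \<in> dual_space (qmat_part n q d) \<and>
    (\<forall>t<d. intertwines Q q t (multi_idx n d) (form_matrix n q \<phi>))"
proof -
  have "\<phi> \<in> carrier (coordB_dual n d Q q) \<longleftrightarrow> \<phi> \<in> dual_space (qmat_part n q d) \<and>
      intertwines Q q 0 (multi_idx n d) (form_matrix n q \<phi>)"
    using vanishes_on_JB_iff[OF _ d, of \<phi> n q Q] by (auto simp: coordB_dual_def qmat_dual_def)
  also have "\<dots> \<longleftrightarrow> \<phi> \<in> dual_space (qmat_part n q d) \<and>
    (\<forall>t<d. intertwines Q q t (multi_idx n d) (form_matrix n q \<phi>))"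
    using form_matrix_intertwines[of \<phi> n q d _ Q] q d by (metis less_one linorder_not_le)
  finally show ?thesis .
qed

lemma matrix_form_coordB:
  assumes q: "q \<noteq> 0" and d: "0 < d"
    and F: "\<And>t. t < d \<Longrightarrow> intertwines Q q t (multi_idx n d) F"
  shows "matrix_form n q d F \<in> carrier (coordB_dual n d Q q)"
    and "\<nu> \<in> multi_idx n d \<Longrightarrow> \<mu> \<in> multi_idx n d \<Longrightarrow>
      form_matrix n q (matrix_form n q d F) \<nu> \<mu> = F \<nu> \<mu>"
proof -
  show m: "form_matrix n q (matrix_form n q d F) \<nu> \<mu> = F \<nu> \<mu>"
    if "\<nu> \<in> multi_idx n d" "\<mu> \<in> multi_idx n d" for \<nu> \<mu>
    using form_matrix_matrix_form[OF F] that by blast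
  have "matrix_form n q d F \<in> dual_space (qmat_part n q d)"
    using matrix_form_dual[OF F] by blast
  then show "matrix_form n q d F \<in> carrier (coordB_dual n d Q q)"
    unfolding coordB_carrier[OF q d]
    using F intertwines_cong[of n d "form_matrix n q (matrix_form n q d F)" F] m by blast
qed

text \<open>The operations in terms of matrices. A form is determined by its matrix, and so the algebra axioms
  and the homomorphism properties reduce to statements about matrices.\<close>

lemma coordB_ops:
  fixes q Q :: "'k::field" and n d :: nat
  assumes q: "q \<noteq> 0" and d: "0 < d"
  defines "C \<equiv> coordB_dual n d Q q" and "N \<equiv> multi_idx n d"
  shows "\<one>\<^bsub>C\<^esub> \<in> carrier C" "\<zero>\<^bsub>C\<^esub> \<in> carrier C"
    and "\<phi> \<in> carrier C \<Longrightarrow> \<psi> \<in> carrier C \<Longrightarrow> \<phi> \<otimes>\<^bsub>C\<^esub> \<psi> \<in> carrier C"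
    and "\<phi> \<in> carrier C \<Longrightarrow> \<psi> \<in> carrier C \<Longrightarrow> \<phi> \<oplus>\<^bsub>C\<^esub> \<psi> \<in> carrier C"
    and "\<phi> \<in> carrier C \<Longrightarrow> a \<odot>\<^bsub>C\<^esub> \<phi> \<in> carrier C"
    and "\<nu> \<in> N \<Longrightarrow> \<mu> \<in> N \<Longrightarrow> form_matrix n q \<one>\<^bsub>C\<^esub> \<nu> \<mu> = (if \<nu> = \<mu> then 1 else 0)"
    and "\<nu> \<in> N \<Longrightarrow> \<mu> \<in> N \<Longrightarrow> form_matrix n q \<zero>\<^bsub>C\<^esub> \<nu> \<mu> = 0"
    and "\<phi> \<in> carrier C \<Longrightarrow> \<psi> \<in> carrier C \<Longrightarrow> \<nu> \<in> N \<Longrightarrow> \<mu> \<in> N \<Longrightarrow>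
      form_matrix n q (\<phi> \<otimes>\<^bsub>C\<^esub> \<psi>) \<nu> \<mu> = (\<Sum>\<kappa>\<in>N. form_matrix n q \<phi> \<nu> \<kappa> * form_matrix n q \<psi> \<kappa> \<mu>)"
    and "\<nu> \<in> N \<Longrightarrow> \<mu> \<in> N \<Longrightarrow>
      form_matrix n q (\<phi> \<oplus>\<^bsub>C\<^esub> \<psi>) \<nu> \<mu> = form_matrix n q \<phi> \<nu> \<mu> + form_matrix n q \<psi> \<nu> \<mu>"
    and "\<nu> \<in> N \<Longrightarrow> \<mu> \<in> N \<Longrightarrow> form_matrix n q (a \<odot>\<^bsub>C\<^esub> \<phi>) \<nu> \<mu> = a * form_matrix n q \<phi> \<nu> \<mu>"
proof -
  note carrier = coordB_carrier[OF q d, of _ n Q, folded C_def N_def]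
  note mform = matrix_form_coordB[OF q d, of Q n, folded C_def N_def]
  note P = qmat_part_module[of n q d]
  interpret P: module ground_field "qmat_part n q d" by (rule P)
  have mem: "qcls n q (xmon \<nu> \<mu>) \<in> carrier (qmat_part n q d)" if "\<nu> \<in> N" "\<mu> \<in> N" for \<nu> \<mu>
    using that by (simp add: qmat_part_sel xmon_xpart N_def)
  have "\<one>\<^bsub>C\<^esub> = matrix_form n q d (\<lambda>\<nu> \<mu>. if \<nu> = \<mu> then 1 else 0)"
    unfolding C_def coordB_dual_def qmat_dual_def
    by simp (rule descend_eq_matrix_form, rule intertwines_one, simp_all add: counit_ev)
  then show "\<one>\<^bsub>C\<^esub> \<in> carrier C"
    "\<nu> \<in> N \<Longrightarrow> \<mu> \<in> N \<Longrightarrow> form_matrix n q \<one>\<^bsub>C\<^esub> \<nu> \<mu> = (if \<nu> = \<mu> then 1 else 0)" for \<nu> \<mu>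
    using mform[OF intertwines_one[of _ d Q q n, folded N_def]] by simp_all
  have times: "\<phi> \<otimes>\<^bsub>C\<^esub> \<psi> = matrix_form n q d (matrix_mult n d (form_matrix n q \<phi>) (form_matrix n q \<psi>))"
    and times_int: "\<And>t. t < d \<Longrightarrow> intertwines Q q t N (matrix_mult n d (form_matrix n q \<phi>) (form_matrix n q \<psi>))"
    if "\<phi> \<in> carrier C" "\<psi> \<in> carrier C" for \<phi> \<psi>
  proof -
    show int: "intertwines Q q t N (matrix_mult n d (form_matrix n q \<phi>) (form_matrix n q \<psi>))" if "t < d" for t
      using that \<open>\<phi> \<in> carrier C\<close> \<open>\<psi> \<in> carrier C\<close> unfolding carrier N_def
      by (intro intertwines_matrix_mult) (auto simp: N_def)
    show "\<phi> \<otimes>\<^bsub>C\<^esub> \<psi> = matrix_form n q d (matrix_mult n d (form_matrix n q \<phi>) (form_matrix n q \<psi>))"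
      unfolding C_def coordB_dual_def qmat_dual_def
      by simp (rule descend_eq_matrix_form, rule int[unfolded N_def], simp_all add: tensor_eval_Delta)
  qed
  show "\<phi> \<otimes>\<^bsub>C\<^esub> \<psi> \<in> carrier C" if "\<phi> \<in> carrier C" "\<psi> \<in> carrier C" for \<phi> \<psi>
    unfolding times[OF that] by (rule mform(1)[OF times_int[OF that]])
  show "form_matrix n q (\<phi> \<otimes>\<^bsub>C\<^esub> \<psi>) \<nu> \<mu> = (\<Sum>\<kappa>\<in>N. form_matrix n q \<phi> \<nu> \<kappa> * form_matrix n q \<psi> \<kappa> \<mu>)"
    if "\<phi> \<in> carrier C" "\<psi> \<in> carrier C" "\<nu> \<in> N" "\<mu> \<in> N" for \<phi> \<psi> \<nu> \<mu>
    using mform(2)[OF times_int[OF that(1,2)] that(3,4)]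
    by (simp add: times[OF that(1,2)]) (simp add: matrix_mult_def N_def)
  show fzero: "form_matrix n q \<zero>\<^bsub>C\<^esub> \<nu> \<mu> = 0" if "\<nu> \<in> N" "\<mu> \<in> N" for \<nu> \<mu>
    using mem[OF that] by (simp add: form_matrix_def C_def coordB_dual_def qmat_dual_def)
  show fadd: "form_matrix n q (\<phi> \<oplus>\<^bsub>C\<^esub> \<psi>) \<nu> \<mu> = form_matrix n q \<phi> \<nu> \<mu> + form_matrix n q \<psi> \<nu> \<mu>"
    if "\<nu> \<in> N" "\<mu> \<in> N" for \<nu> \<mu> \<phi> \<psi>
    using mem[OF that] by (simp add: form_matrix_def C_def coordB_dual_def qmat_dual_def)
  show fsmult: "form_matrix n q (a \<odot>\<^bsub>C\<^esub> \<phi>) \<nu> \<mu> = a * form_matrix n q \<phi> \<nu> \<mu>"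
    if "\<nu> \<in> N" "\<mu> \<in> N" for \<nu> \<mu> a \<phi>
    using mem[OF that] by (simp add: form_matrix_def C_def coordB_dual_def qmat_dual_def)
  have add_closed: "\<phi> \<oplus>\<^bsub>C\<^esub> \<psi> \<in> carrier C" if c: "\<phi> \<in> carrier C" "\<psi> \<in> carrier C" for \<phi> \<psi>
    unfolding carrier
  proof (intro conjI allI impI)
    show "\<phi> \<oplus>\<^bsub>C\<^esub> \<psi> \<in> dual_space (qmat_part n q d)"
      using c by (auto simp: carrier) (simp add: C_def coordB_dual_def qmat_dual_def dual_space_def algebra_simps)
    fix t assume "t < d"
    then show "intertwines Q q t N (form_matrix n q (\<phi> \<oplus>\<^bsub>C\<^esub> \<psi>))"
      using c intertwines_cong[of n d, OF fadd[of _ _ \<phi> \<psi>, unfolded N_def]] unfolding carrier N_def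
      by (simp add: intertwines_add)
  qed
  then show "\<phi> \<oplus>\<^bsub>C\<^esub> \<psi> \<in> carrier C" if "\<phi> \<in> carrier C" "\<psi> \<in> carrier C" for \<phi> \<psi>
    using that by blast
  show smult_closed: "a \<odot>\<^bsub>C\<^esub> \<phi> \<in> carrier C" if c: "\<phi> \<in> carrier C" for a \<phi>
    unfolding carrier
  proof (intro conjI allI impI)
    show "a \<odot>\<^bsub>C\<^esub> \<phi> \<in> dual_space (qmat_part n q d)"
      using c by (auto simp: carrier) (simp add: C_def coordB_dual_def qmat_dual_def dual_space_def algebra_simps)
    fix t assume "t < d"
    then show "intertwines Q q t N (form_matrix n q (a \<odot>\<^bsub>C\<^esub> \<phi>))"
      using c intertwines_cong[of n d, OF fsmult[of _ _ a \<phi>, unfolded N_def]] unfolding carrier N_def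
      by (simp add: intertwines_scale)
  qed
  show "\<zero>\<^bsub>C\<^esub> \<in> carrier C"
    unfolding carrier
  proof (intro conjI allI impI)
    show "\<zero>\<^bsub>C\<^esub> \<in> dual_space (qmat_part n q d)"
      by (simp add: C_def coordB_dual_def qmat_dual_def dual_space_def)
    fix t assume "t < d"
    moreover have "intertwines Q q t N (\<lambda>\<nu> \<mu>. 0)" by (simp add: intertwines_def)
    ultimately show "intertwines Q q t N (form_matrix n q \<zero>\<^bsub>C\<^esub>)"
      using intertwines_cong[OF fzero[unfolded N_def]] unfolding N_def by simp
  qed
qed

lemma coordB_assoc_algebra:
  fixes q Q :: "'k::field" and n d :: nat
  assumes q: "q \<noteq> 0" and d: "0 < d"
  shows "assoc_algebra ground_field (coordB_dual n d Q q)"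
proof -
  define C where "C = coordB_dual n d Q q"
  define N where "N = multi_idx n d"
  note ops = coordB_ops[OF q d, where n = n and Q = Q, folded C_def N_def]
  have eqI: "\<phi> = \<psi>" if "\<phi> \<in> carrier C" "\<psi> \<in> carrier C"
    "\<And>\<nu> \<mu>. \<nu> \<in> N \<Longrightarrow> \<mu> \<in> N \<Longrightarrow> form_matrix n q \<phi> \<nu> \<mu> = form_matrix n q \<psi> \<nu> \<mu>" for \<phi> \<psi>
    using that dual_space_eqI[of \<phi> n q d \<psi>] coordB_carrier[OF q d, of _ n Q] by (auto simp: C_def N_def)
  have finN: "finite N" by (simp add: N_def)
  have abelian: "abelian_group C"
  proof (rule abelian_groupI)
    show "\<exists>\<psi>\<in>carrier C. \<psi> \<oplus>\<^bsub>C\<^esub> \<phi> = \<zero>\<^bsub>C\<^esub>" if "\<phi> \<in> carrier C" for \<phi>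
      using that by (intro bexI[of _ "(- 1) \<odot>\<^bsub>C\<^esub> \<phi>"] eqI) (simp_all add: ops)
  qed (auto intro!: eqI simp: ops ac_simps)
  have mon: "monoid C"
  proof (rule monoidI)
    show "(\<phi> \<otimes>\<^bsub>C\<^esub> \<psi>) \<otimes>\<^bsub>C\<^esub> \<chi> = \<phi> \<otimes>\<^bsub>C\<^esub> (\<psi> \<otimes>\<^bsub>C\<^esub> \<chi>)"
      if c: "\<phi> \<in> carrier C" "\<psi> \<in> carrier C" "\<chi> \<in> carrier C" for \<phi> \<psi> \<chi>
    proof (rule eqI)
      fix \<nu> \<mu> assume N: "\<nu> \<in> N" "\<mu> \<in> N"
      have "form_matrix n q ((\<phi> \<otimes>\<^bsub>C\<^esub> \<psi>) \<otimes>\<^bsub>C\<^esub> \<chi>) \<nu> \<mu> =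
          (\<Sum>\<kappa>\<in>N. \<Sum>\<rho>\<in>N. form_matrix n q \<phi> \<nu> \<rho> * form_matrix n q \<psi> \<rho> \<kappa> * form_matrix n q \<chi> \<kappa> \<mu>)"
        using c N by (simp add: ops sum_distrib_right)
      also have "\<dots> = (\<Sum>\<rho>\<in>N. \<Sum>\<kappa>\<in>N. form_matrix n q \<phi> \<nu> \<rho> * form_matrix n q \<psi> \<rho> \<kappa> * form_matrix n q \<chi> \<kappa> \<mu>)"
        by (rule sum.swap)
      also have "\<dots> = form_matrix n q (\<phi> \<otimes>\<^bsub>C\<^esub> (\<psi> \<otimes>\<^bsub>C\<^esub> \<chi>)) \<nu> \<mu>"
        using c N by (simp add: ops sum_distrib_left mult.assoc)
      finally show "form_matrix n q ((\<phi> \<otimes>\<^bsub>C\<^esub> \<psi>) \<otimes>\<^bsub>C\<^esub> \<chi>) \<nu> \<mu> = form_matrix n q (\<phi> \<otimes>\<^bsub>C\<^esub> (\<psi> \<otimes>\<^bsub>C\<^esub> \<chi>)) \<nu> \<mu>" .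
    qed (use c in \<open>simp_all add: ops\<close>)
    have delta: "(\<Sum>\<kappa>\<in>N. (if \<nu> = \<kappa> then 1 else 0) * f \<kappa>) = f \<nu>" "(\<Sum>\<kappa>\<in>N. f \<kappa> * (if \<kappa> = \<nu> then 1 else 0)) = f \<nu>"
      if "\<nu> \<in> N" for \<nu> and f :: "int list \<Rightarrow> 'k"
    proof -
      have "(\<Sum>\<kappa>\<in>N. (if \<nu> = \<kappa> then 1 else 0) * f \<kappa>) = (\<Sum>\<kappa>\<in>N. if \<nu> = \<kappa> then f \<kappa> else 0)"
        "(\<Sum>\<kappa>\<in>N. f \<kappa> * (if \<kappa> = \<nu> then 1 else 0)) = (\<Sum>\<kappa>\<in>N. if \<kappa> = \<nu> then f \<kappa> else 0)"
        by (intro sum.cong; simp)+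
      then show "(\<Sum>\<kappa>\<in>N. (if \<nu> = \<kappa> then 1 else 0) * f \<kappa>) = f \<nu>"
        "(\<Sum>\<kappa>\<in>N. f \<kappa> * (if \<kappa> = \<nu> then 1 else 0)) = f \<nu>"
        using that finN by simp_all
    qed
    show "\<one>\<^bsub>C\<^esub> \<otimes>\<^bsub>C\<^esub> \<phi> = \<phi>" "\<phi> \<otimes>\<^bsub>C\<^esub> \<one>\<^bsub>C\<^esub> = \<phi>" if "\<phi> \<in> carrier C" for \<phi>
      using that by (auto intro!: eqI simp: ops delta cong: sum.cong)
  qed (simp_all add: ops)
  have ring: "ring C"
    by (rule ringI[OF abelian mon])
      (auto intro!: eqI simp: ops distrib_left distrib_right sum.distrib)
  have module: "module ground_field C"
    by (rule moduleI[OF ring_ground_field abelian])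
      (auto intro!: eqI simp: ops distrib_left distrib_right mult.assoc)
  have "assoc_algebra_axioms ground_field C"
    by unfold_locales
      (auto intro!: eqI simp: ops sum_distrib_left ac_simps)
  then show ?thesis
    using ring module by (simp add: assoc_algebra_def C_def)
qed

text \<open>Both carriers consist of the matrices commuting with \<open>T\<^sub>0, \<dots>, T\<^sub>d\<^sub>-\<^sub>1\<close>.\<close>

lemma coordB_iso_schurB:
  fixes q Q :: "'k::field" and n d :: nat
  assumes q: "q \<noteq> 0" and Q: "Q \<noteq> 0" and d: "0 < d"
  shows "(\<lambda>\<phi>. matrix_op n d (form_matrix n q \<phi>)) \<in> algebra_iso (coordB_dual n d Q q) (schurB n d Q q)"
proof -
  define C where "C = coordB_dual n d Q q"
  define S where "S = schurB n d Q q"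
  define N where "N = multi_idx n d"
  define \<Phi> where "\<Phi> \<phi> = matrix_op n d (form_matrix n q \<phi>)" for \<phi>
  note ops = coordB_ops[OF q d, where n = n and Q = Q, folded C_def N_def]
  note carrier = coordB_carrier[OF q d, of _ n Q, folded C_def N_def]
  have S_iff: "f \<in> carrier S \<longleftrightarrow> f \<in> End_space (tspace n d) \<and> (\<forall>t<d. intertwines Q q t N (op_matrix f))" for f
    unfolding S_def using schurB_carrier[OF q Q, of d f n] d End_space_commutes_T_op[of f n d] by (auto simp: N_def)
  have op: "op_matrix (\<Phi> \<phi>) \<nu> \<mu> = form_matrix n q \<phi> \<nu> \<mu>" if "\<nu> \<in> N" "\<mu> \<in> N" for \<phi> \<nu> \<mu>
    using that by (simp add: \<Phi>_def op_matrix_matrix_op N_def)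
  have End: "\<Phi> \<phi> \<in> End_space (tspace n d)" for \<phi> by (simp add: \<Phi>_def matrix_op_End_space)
  have closed: "\<Phi> \<phi> \<in> carrier S" if "\<phi> \<in> carrier C" for \<phi>
    using that intertwines_cong[OF op[unfolded N_def]] End by (auto simp: S_iff carrier N_def)
  have eqI: "\<Phi> \<phi> = f" if "f \<in> End_space (tspace n d)"
    "\<And>\<nu> \<mu>. \<nu> \<in> N \<Longrightarrow> \<mu> \<in> N \<Longrightarrow> form_matrix n q \<phi> \<nu> \<mu> = op_matrix f \<nu> \<mu>" for \<phi> f
    using that op by (intro End_space_eqI_matrix[OF End]) (auto simp: N_def)
  have pointwise: "(\<lambda>v\<in>carrier (tspace n d). f v + g v) \<in> End_space (tspace n d)"
      "(\<lambda>v\<in>carrier (tspace n d). scl c (f v)) \<in> End_space (tspace n d)"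
      "compose (carrier (tspace n d)) f g \<in> End_space (tspace n d)"
    if f: "f \<in> End_space (tspace n d)" and g: "g \<in> End_space (tspace n d)" for f g :: "(int fmon \<Rightarrow>\<^sub>0 'k) \<Rightarrow> _" and c
    using End_space_tspace[OF f] End_space_tspace[OF g]
    by (auto simp: End_space_def compose_def tspace_closed scl_add scl_scl ac_simps)
  have ident: "(\<lambda>v\<in>carrier (tspace n d). v) \<in> End_space (tspace n d :: ('k, int fmon \<Rightarrow>\<^sub>0 'k) module)"
    by (auto simp: End_space_def tspace_closed)
  have mem: "bvec \<mu> \<in> carrier (tspace n d)" if "\<mu> \<in> N" for \<mu> using that by (simp add: bvec_in_tspace N_def)
  have "\<Phi> \<in> ring_hom C S"
  proof (rule ring_hom_memI)
    show "\<Phi> (\<phi> \<otimes>\<^bsub>C\<^esub> \<psi>) = \<Phi> \<phi> \<otimes>\<^bsub>S\<^esub> \<Phi> \<psi>" if c: "\<phi> \<in> carrier C" "\<psi> \<in> carrier C" for \<phi> \<psi>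
    proof -
      have "\<Phi> (\<phi> \<otimes>\<^bsub>C\<^esub> \<psi>) = compose (carrier (tspace n d)) (\<Phi> \<phi>) (\<Phi> \<psi>)"
      proof (rule eqI[OF pointwise(3)[OF End End]])
        fix \<nu> \<mu> assume "\<nu> \<in> N" "\<mu> \<in> N"
        then show "form_matrix n q (\<phi> \<otimes>\<^bsub>C\<^esub> \<psi>) \<nu> \<mu> = op_matrix (compose (carrier (tspace n d)) (\<Phi> \<phi>) (\<Phi> \<psi>)) \<nu> \<mu>"
          using c by (simp add: ops op_matrix_compose[OF End End] op flip: N_def)
      qed
      then show ?thesis by (simp add: S_def schurB_def)
    qed
    show "\<Phi> (\<phi> \<oplus>\<^bsub>C\<^esub> \<psi>) = \<Phi> \<phi> \<oplus>\<^bsub>S\<^esub> \<Phi> \<psi>" if c: "\<phi> \<in> carrier C" "\<psi> \<in> carrier C" for \<phi> \<psi>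
    proof -
      have "\<Phi> (\<phi> \<oplus>\<^bsub>C\<^esub> \<psi>) = (\<lambda>v\<in>carrier (tspace n d). \<Phi> \<phi> v + \<Phi> \<psi> v)"
      proof (rule eqI[OF pointwise(1)[OF End End]])
        fix \<nu> \<mu> assume N: "\<nu> \<in> N" "\<mu> \<in> N"
        then have "op_matrix (\<lambda>v\<in>carrier (tspace n d). \<Phi> \<phi> v + \<Phi> \<psi> v) \<nu> \<mu> = op_matrix (\<Phi> \<phi>) \<nu> \<mu> + op_matrix (\<Phi> \<psi>) \<nu> \<mu>"
          by (simp add: op_matrix_def mem lookup_add)
        then show "form_matrix n q (\<phi> \<oplus>\<^bsub>C\<^esub> \<psi>) \<nu> \<mu> = op_matrix (\<lambda>v\<in>carrier (tspace n d). \<Phi> \<phi> v + \<Phi> \<psi> v) \<nu> \<mu>"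
          using N by (simp add: ops op)
      qed
      then show ?thesis by (simp add: S_def schurB_def)
    qed
    have "\<Phi> \<one>\<^bsub>C\<^esub> = (\<lambda>v\<in>carrier (tspace n d). v)"
    proof (rule eqI[OF ident])
      fix \<nu> \<mu> assume N: "\<nu> \<in> N" "\<mu> \<in> N"
      then show "form_matrix n q \<one>\<^bsub>C\<^esub> \<nu> \<mu> = op_matrix (\<lambda>v\<in>carrier (tspace n d). v) \<nu> \<mu>"
        by (simp add: ops op_matrix_def mem) (auto simp: bvec_def lookup_single when_def)
    qed
    then show "\<Phi> \<one>\<^bsub>C\<^esub> = \<one>\<^bsub>S\<^esub>" by (simp add: S_def schurB_def)
  qed (rule closed)
  moreover have "\<Phi> (c \<odot>\<^bsub>C\<^esub> \<phi>) = c \<odot>\<^bsub>S\<^esub> \<Phi> \<phi>" if "\<phi> \<in> carrier C" for c \<phi>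
  proof -
    have "\<Phi> (c \<odot>\<^bsub>C\<^esub> \<phi>) = (\<lambda>v\<in>carrier (tspace n d). scl c (\<Phi> \<phi> v))"
    proof (rule eqI[OF pointwise(2)[OF End End]])
      fix \<nu> \<mu> assume N: "\<nu> \<in> N" "\<mu> \<in> N"
      then have "op_matrix (\<lambda>v\<in>carrier (tspace n d). scl c (\<Phi> \<phi> v)) \<nu> \<mu> = c * op_matrix (\<Phi> \<phi>) \<nu> \<mu>"
        by (simp add: op_matrix_def mem)
      then show "form_matrix n q (c \<odot>\<^bsub>C\<^esub> \<phi>) \<nu> \<mu> = op_matrix (\<lambda>v\<in>carrier (tspace n d). scl c (\<Phi> \<phi> v)) \<nu> \<mu>"
        using N by (simp add: ops op)
    qed
    then show ?thesis by (simp add: S_def schurB_def)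
  qed
  moreover have "bij_betw \<Phi> (carrier C) (carrier S)"
    unfolding bij_betw_def
  proof
    show "inj_on \<Phi> (carrier C)"
    proof (rule inj_onI)
      fix \<phi> \<psi> assume c: "\<phi> \<in> carrier C" "\<psi> \<in> carrier C" and eq: "\<Phi> \<phi> = \<Phi> \<psi>"
      show "\<phi> = \<psi>"
      proof (rule dual_space_eqI)
        fix \<nu> \<mu> assume "\<nu> \<in> multi_idx n d" "\<mu> \<in> multi_idx n d"
        then show "form_matrix n q \<phi> \<nu> \<mu> = form_matrix n q \<psi> \<nu> \<mu>"
          using op[of \<nu> \<mu> \<phi>] op[of \<nu> \<mu> \<psi>] eq by (simp add: N_def)
      qed (use c carrier in auto)
    qed
    have "f \<in> \<Phi> ` carrier C" if f: "f \<in> carrier S" for f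
    proof -
      have "intertwines Q q t (multi_idx n d) (op_matrix f)" if "t < d" for t
        using f that by (simp add: S_iff N_def)
      note m = matrix_form_coordB[OF q d this]
      have "\<Phi> (matrix_form n q d (op_matrix f)) = f"
        using f m(2) by (intro eqI) (auto simp: S_iff N_def)
      then show ?thesis using m(1) by (force simp: C_def)
    qed
    then show "\<Phi> ` carrier C = carrier S" using closed by auto
  qed
  ultimately have "\<Phi> \<in> algebra_iso C S"
    unfolding algebra_iso_def ring_iso_def by simp
  then show ?thesis
    unfolding \<Phi>_def[abs_def] C_def S_def .
qed

theorem proposition2p4p2:
  fixes q Q :: "'k::field" and n d :: nat
  assumes "q \<noteq> 0" and "Q \<noteq> 0" and "n \<ge> 1" and "d \<ge> 1"
  shows "assoc_algebra ground_field (coordB_dual n d Q q) \<and>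
    (\<exists>\<Phi>. \<Phi> \<in> algebra_iso (coordB_dual n d Q q) (schurB n d Q q))"
  using assms coordB_assoc_algebra[of q d n Q] coordB_iso_schurB[of q Q d n] by auto

end
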